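(* Let $n\ge 2$, let $a\in\mathbb{C}$ with $|a|<1$, write points of $\mathbb{C}^n$ as $(z',w)$ with $z'\in\mathbb{C}^{n-1}$, $w\in\mathbb{C}$, and let $$F(z',w)=\left(z',\ wz',\ w^2\frac{\sqrt{1-|a|^2}\,z'}{1-\overline a w},\ w^2\frac{w-a}{1-\overline a w}\right),$$ a proper rational holomorphic map from the unit ball $\mathbb{B}^n\subset\mathbb{C}^n$ into the unit ball $\mathbb{B}^{3n-2}\subset\mathbb{C}^{3n-2}$. Then $F$ has geometric rank $1$ and is linear (i.e. affine-linear in $z'$) along each hyperplane defined by $w=\text{constant}$. Moreover, $F$ is equivalent to a proper polynomial holomorphic map from $\mathbb{B}^n$ into $\mathbb{B}^{3n-2}$ if and only if $a=0$.
   Context: Two proper rational holomorphic maps $F,G:\mathbb{B}^n\to\mathbb{B}^N$ are called equivalent if there are $\sigma\in \mathrm{Aut}(\mathbb{B}^n)$ and $\tau\in \mathrm{Aut}(\mathbb{B}^N)$ (holomorphic automorphisms) with $F=\tau\circ G\circ\sigma$. A polynomial map is a map all of whose components are holomorphic polynomials. Geometric rank (standard notion due to Huang). Let $\mathbb{H}^n=\{(z,w)\in\mathbb{C}^{n-1}\times\mathbb{C}:\ \mathrm{Im}\,w>|z|^2\}$ be the Siegel upper half space, and $\rho_n(z,w)=\left(\frac{2z}{1-iw},\frac{1+iw}{1-iw}\right)$ the Cayley transformation, mapping $\mathbb{H}^n$ biholomorphically onto $\mathbb{B}^n$. Let $N\ge n\ge2$ and let $G$ be a nonconstant $C^2$-smooth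 CR map from $\partial\mathbb{H}^n$ (or an open piece of it) into $\partial\mathbb{H}^N$. For each $p\in\partial\mathbb{H}^n$ in the domain of $G$, there are automorphisms $\sigma_p$ of $\mathbb{H}^n$ (the Heisenberg translation taking $0$ to $p$) and $\tau_p$ of $\mathbb{H}^N$, with $\tau_p(G(p))=0$, such that $G_p^{**}=\tau_p\circ G\circ\sigma_p=(f,\phi,g)$, with $f$ valued in $\mathbb{C}^{n-1}$, $\phi$ in $\mathbb{C}^{N-n}$ and $g$ in $\mathbb{C}$, has near $0$ the normal form $$f=z+\tfrac{i}{2}a^{(1)}(z)w+o_{wt}(3),\quad \phi=\phi^{(2)}(z)+o_{wt}(2),\quad g=w+o_{wt}(4),$$ $$\langle\overline z,a^{(1)}(z)\rangle|z|^2=|\phi^{(2)}(z)|^2,$$ where $z$ has weight $1$ and $w$ has weight $2$, $o_{wt}(m)$ denotes terms of weighted order higher than $m$, $a^{(1)}(z)=z\mathcal{A}(p)$ is linear in $z$ with $\mathcal{A}(p)$ an $(n-1)\times(n-1)$ matrix, $\phi^{(2)}$ is homogeneous quadratic in $z$, and $\langle\overline z,a^{(1)}(z)\rangle=\sum_j\overline{z_j}\,a^{(1)}_j(z)$. The rank of $\mathcal{A}(p)$ is independent of the choices; it is denoted $Rk_G(p)$. The geometric rank of $G$ is $\max_pRk_G(p)$, and the geometric rank of a proper holomorphic map $F:\mathbb{B}^n\to\mathbb{B}^N$ that is $C^2$-smooth up to the boundary is that of $\rho_N^{-1}\circ F\circ\rho_n$. *)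

theory Defs
  imports "HOL-Analysis.Analysis" "HOL-Library.Landau_Symbols"
begin

section \<open>Holomorphic, polynomial and rational maps between complex coordinate spaces\<close>

text \<open>Only meaningful for open \<^term>\<open>S\<close>: the derivative is complex linear at every point.\<close>

definition holomorphic_map_on ::
  "(complex^'a::finite \<Rightarrow> complex^'b::finite) \<Rightarrow> (complex^'a) set \<Rightarrow> bool" where
  "holomorphic_map_on f S \<longleftrightarrow>
     (\<forall>x\<in>S. \<exists>D. (f has_derivative D) (at x) \<and> (\<forall>c v. D (c *s v) = c *s D v))"

definition polynomial_fun :: "(complex^'a::finite \<Rightarrow> complex) \<Rightarrow> bool" where
  "polynomial_fun p \<longleftrightarrow>
     (\<exists>(M :: ('a \<Rightarrow> nat) set) c. finite M \<and>
        (\<forall>x. p x = (\<Sum>m\<in>M. c m * (\<Prod>i\<in>UNIV. (x $ i) ^ m i))))"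

definition polynomial_map :: "(complex^'a::finite \<Rightarrow> complex^'b::finite) \<Rightarrow> bool" where
  "polynomial_map P \<longleftrightarrow> (\<forall>j. polynomial_fun (\<lambda>x. P x $ j))"

definition rational_map_on ::
  "(complex^'a::finite \<Rightarrow> complex^'b::finite) \<Rightarrow> (complex^'a) set \<Rightarrow> bool" where
  "rational_map_on f S \<longleftrightarrow>
     (\<forall>j. \<exists>p q. polynomial_fun p \<and> polynomial_fun q \<and>
        (\<forall>x\<in>S. q x \<noteq> 0 \<and> f x $ j = p x / q x))"

definition proper_holomorphic_ball_map ::
  "(complex^'a::finite \<Rightarrow> complex^'b::finite) \<Rightarrow> bool" where
  "proper_holomorphic_ball_map f \<longleftrightarrow>
     holomorphic_map_on f (ball 0 1) \<and>
     proper_map (top_of_set (ball 0 1)) (top_of_set (ball 0 1)) f"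

definition holomorphic_automorphism ::
  "(complex^'a::finite) set \<Rightarrow> (complex^'a \<Rightarrow> complex^'a) \<Rightarrow> bool" where
  "holomorphic_automorphism \<Omega> \<sigma> \<longleftrightarrow>
     holomorphic_map_on \<sigma> \<Omega> \<and> bij_betw \<sigma> \<Omega> \<Omega> \<and> holomorphic_map_on (the_inv_into \<Omega> \<sigma>) \<Omega>"

definition ball_equivalent ::
  "(complex^'a::finite \<Rightarrow> complex^'b::finite) \<Rightarrow> (complex^'a \<Rightarrow> complex^'b) \<Rightarrow> bool" where
  "ball_equivalent F G \<longleftrightarrow>
     (\<exists>\<sigma> \<tau>. holomorphic_automorphism (ball 0 1) \<sigma> \<and> holomorphic_automorphism (ball 0 1) \<tau> \<and>
        (\<forall>x\<in>ball 0 1. F x = \<tau> (G (\<sigma> x))))"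


section \<open>The Siegel upper half space\<close>

text \<open>
  The space of pairs $(z,w)$ with $z$ in $\mathbf{C}^{n-1}$ and $w$ in $\mathbf{C}$ is
  \<^typ>\<open>complex^('m option)\<close> where $n - 1$ is the cardinality of \<^typ>\<open>'m\<close>, so $n \ge 2$ is
  arbitrary; \<^term>\<open>None\<close> indexes $w$ and \<^term>\<open>Some j\<close> indexes $z_j$.
\<close>

definition horiz :: "'b^('m::finite option) \<Rightarrow> 'b^'m" where
  "horiz x = (\<chi> j. x $ Some j)"

definition siegel :: "(complex^('m::finite option)) set" where
  "siegel = {x. Im (x $ None) > (norm (horiz x))\<^sup>2}"

definition cayley :: "complex^('m::finite option) \<Rightarrow> complex^('m option)" where
  "cayley x = (\<chi> i. case i of
       Some j \<Rightarrow> 2 * x $ Some j / (1 - \<i> * x $ None)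
     | None \<Rightarrow> (1 + \<i> * x $ None) / (1 - \<i> * x $ None))"

definition cayley_inv :: "complex^('m::finite option) \<Rightarrow> complex^('m option)" where
  "cayley_inv y = (\<chi> i. case i of
       Some j \<Rightarrow> y $ Some j / (1 + y $ None)
     | None \<Rightarrow> \<i> * (1 - y $ None) / (1 + y $ None))"

lemma cayley_cayley_inv:
  assumes "y $ None \<noteq> - 1"
  shows "cayley (cayley_inv y) = y"
proof -
  have nz: "1 + y $ None \<noteq> 0"
    using assms by (metis add_eq_0_iff)
  have d: "1 - (y $ None - 1) / (1 + y $ None) = 2 / (1 + y $ None)"
    using nz by (simp add: divide_simps)
  have e: "1 + (y $ None - 1) / (1 + y $ None) = 2 * y $ None / (1 + y $ None)"
    using nz by (simp add: divide_simps)
  show ?thesis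
    unfolding vec_eq_iff
  proof
    fix i
    show "cayley (cayley_inv y) $ i = y $ i"
      using nz by (cases i) (simp_all add: cayley_def cayley_inv_def d e)
  qed
qed

lemma cayley_inv_cayley:
  assumes "1 - \<i> * x $ None \<noteq> 0"
  shows "cayley_inv (cayley x) = x"
proof -
  have d: "1 + (1 + \<i> * x $ None) / (1 - \<i> * x $ None) = 2 / (1 - \<i> * x $ None)"
    using assms by (simp add: divide_simps)
  have e: "1 - (1 + \<i> * x $ None) / (1 - \<i> * x $ None)
      = - 2 * \<i> * x $ None / (1 - \<i> * x $ None)"
    using assms by (simp add: divide_simps)
  have f: "\<i> * (\<i> * x $ None) = - x $ None"
    by (simp flip: mult.assoc)
  show ?thesis
    unfolding vec_eq_iff
  proof
    fix i
    show "cayley_inv (cayley x) $ i = x $ i"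
      using assms by (cases i) (simp_all add: cayley_def cayley_inv_def d e f)
  qed
qed

definition heisenberg_translation ::
  "complex^('m::finite option) \<Rightarrow> complex^('m option) \<Rightarrow> complex^('m option)" where
  "heisenberg_translation p x = (\<chi> i. case i of
       Some j \<Rightarrow> x $ Some j + p $ Some j
     | None \<Rightarrow> x $ None + p $ None + 2 * \<i> * (\<Sum>j\<in>UNIV. x $ Some j * cnj (p $ Some j)))"


section \<open>Geometric rank\<close>

text \<open>
  \<^term>\<open>o_wt F m h\<close>: along \<^term>\<open>F\<close>, \<^term>\<open>h\<close> consists of terms of weighted order higher than
  \<^term>\<open>m\<close>, where $z$ has weight 1 and $w$ has weight 2.
\<close>

definition o_wt ::
  "(complex^('m::finite option)) filter \<Rightarrow> nat
     \<Rightarrow> (complex^('m option) \<Rightarrow> 'b::real_normed_vector) \<Rightarrow> bool" where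
  "o_wt F m h \<longleftrightarrow>
     (\<lambda>x. norm (h x)) \<in> o[F](\<lambda>x. (norm (horiz x) + sqrt (norm (x $ None))) ^ m)"

definition homogeneous_quadratic :: "(complex^'m::finite \<Rightarrow> complex^'k::finite) \<Rightarrow> bool" where
  "homogeneous_quadratic q \<longleftrightarrow>
     (\<exists>b. \<forall>z k. q z $ k = (\<Sum>i\<in>UNIV. \<Sum>j\<in>UNIV. b k i j * z $ i * z $ j))"

text \<open>
  A map into $\mathbf{C}^N$ splits as $(f, \phi, g)$, with $f$ in the components \<^term>\<open>Some (Inl j)\<close>,
  $\phi$ in the components \<^term>\<open>Some (Inr k)\<close> and $g$ in the component \<^term>\<open>None\<close>. The filter is
  the one along which the normal form is to hold, that is, $x \to 0$ in the boundary of the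
  Siegel half space.
\<close>

definition normal_form ::
  "(complex^('m::finite option)) filter \<Rightarrow> (complex^('m option) \<Rightarrow> complex^(('m + 'k::finite) option))
     \<Rightarrow> complex^'m^'m \<Rightarrow> (complex^'m \<Rightarrow> complex^'k) \<Rightarrow> bool" where
  "normal_form F H A \<phi>2 \<longleftrightarrow>
     homogeneous_quadratic \<phi>2 \<and>
     o_wt F 3 (\<lambda>x. (\<chi> j. H x $ Some (Inl j))
                 - (horiz x + (\<i> / 2 * x $ None) *s (horiz x v* A))) \<and>
     o_wt F 2 (\<lambda>x. (\<chi> k. H x $ Some (Inr k)) - \<phi>2 (horiz x)) \<and>
     o_wt F 4 (\<lambda>x. H x $ None - x $ None) \<and>
     (\<forall>z. (\<Sum>j\<in>UNIV. cnj (z $ j) * (z v* A) $ j) * of_real ((norm z)\<^sup>2)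
           = of_real ((norm (\<phi>2 z))\<^sup>2))"

text \<open>
  \<^term>\<open>rank_at M G p r\<close> says that $Rk_G(p) = r$, for a map \<^term>\<open>G\<close> defined on the open piece
  \<^term>\<open>M\<close> of the boundary of the Siegel half space. The automorphism \<^term>\<open>\<tau>\<close> of the target half
  space acts on the boundary point \<^term>\<open>G p\<close> through its holomorphic extension across
  that point.
\<close>

definition rank_at ::
  "(complex^('m::finite option)) set \<Rightarrow> (complex^('m option) \<Rightarrow> complex^(('m + 'k::finite) option))
     \<Rightarrow> complex^('m option) \<Rightarrow> nat \<Rightarrow> bool" where
  "rank_at M G p r \<longleftrightarrow>
     (\<exists>\<tau> U A \<phi>2.
        holomorphic_automorphism siegel \<tau> \<and>
        open U \<and> siegel \<union> {G p} \<subseteq> U \<and> holomorphic_map_on \<tau> U \<and> \<tau> (G p) = 0 \<and>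
        normal_form (at 0 within (heisenberg_translation p -` M))
          (\<tau> \<circ> G \<circ> heisenberg_translation p) A \<phi>2 \<and>
        rank A = r)"

definition siegel_geometric_rank ::
  "(complex^('m::finite option)) set \<Rightarrow> (complex^('m option) \<Rightarrow> complex^(('m + 'k::finite) option))
     \<Rightarrow> nat" where
  "siegel_geometric_rank M G = Max {r. \<exists>p\<in>M. rank_at M G p r}"

text \<open>
  \<^term>\<open>F\<close> is the proper map together with its $C^2$ extension to the closed ball. The transported
  map is defined at the boundary points which \<^term>\<open>F\<close> does not send to $(0,-1)$, the point at
  infinity of the target.
\<close>

definition geometric_rank ::
  "(complex^('m::finite option) \<Rightarrow> complex^(('m + 'k::finite) option)) \<Rightarrow> nat" where
  "geometric_rank F = siegel_geometric_rank
     {p \<in> frontier siegel. F (cayley p) $ None \<noteq> - 1} (cayley_inv \<circ> F \<circ> cayley)"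


section \<open>The family of maps\<close>

definition F_map ::
  "complex \<Rightarrow> complex^('m::finite option) \<Rightarrow> complex^(('m + ('m + 'm)) option)" where
  "F_map a x = (let w = x $ None in \<chi> i. case i of
       Some (Inl j) \<Rightarrow> x $ Some j
     | Some (Inr (Inl j)) \<Rightarrow> w * x $ Some j
     | Some (Inr (Inr j)) \<Rightarrow>
         w\<^sup>2 * (of_real (sqrt (1 - (norm a)\<^sup>2)) * x $ Some j / (1 - cnj a * w))
     | None \<Rightarrow> w\<^sup>2 * ((w - a) / (1 - cnj a * w)))"

lemma card_source: "CARD('m::finite option) \<ge> 2"
  by (simp add: Suc_le_eq)

lemma card_target: "CARD(('m::finite + ('m + 'm)) option) = 3 * CARD('m option) - 2"
  by simp

end

(*
  Automorphisms of the ball fixing the origin are linear, by the Schwarz lemma on complex lines, so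
  all automorphisms of the ball, and of the Siegel half space, are fractional linear.

  Geometric rank at most one: along w = const the map is affine in z', and this forces the quadratic
  part phi^(2) of the normal form at p to vanish on the vectors orthogonal to the z'-part of p. The
  Hermitian form of A(p) is positive semidefinite and vanishes where phi^(2) does, so the kernel of
  A(p) contains a hyperplane. Rank one is attained at a boundary point over w = 0, where a normalizing
  automorphism is explicit.

  Polynomial equivalence: on the disc z' = 0 the map is the Blaschke product
  B(w) = w^2 (w - a) / (1 - conj(a) w). If F is equivalent to a polynomial map, some linear combination
  of the homogenized numerator and denominator of B is the cube of a linear form, and comparing
  coefficients leaves a = 0 or |a| = 3.
*)
theory Submission
  imports Defs "HOL-Complex_Analysis.Conformal_Mappings"
    "HOL-Computational_Algebra.Fundamental_Theorem_Algebra"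
begin

section \<open>Complex differentiability\<close>

text \<open>\<open>rank_at\<close> accepts every automorphism \<tau> that achieves the normal form,
  so the upper bound must cover all of them. This is where fractional linearity enters: composing
  with \<tau> keeps the numerators over a common denominator affine in z', so the absence of a
  quadratic term survives the normalization. Attaining rank one takes a single \<tau>, which can be
  written down. In the polynomial question, fractional linearity makes \<sigma> carry the disc z' =
  0 into a complex line with parameter u = w / (1 + \<gamma> w). A polynomial in u can have a pole
  only at u = infinity, that is, where 1 + \<gamma> w = 0. Hence the denominator c w^2 (w - a) + 1 -
  conj(a) w must be (1 + \<gamma> w)^3. Matching coefficients gives conj(a) = -3 \<gamma>, a c = -3
  \<gamma>^2 and c = \<gamma>^3, so \<gamma> = 0 or a \<gamma> = -3. The second case says |a|^2 = 9,
  which is the source of the value 3.\<close>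

definition complex_diff_at :: "(complex^'a::finite \<Rightarrow> complex) \<Rightarrow> complex^'a \<Rightarrow> bool" where
  "complex_diff_at g x \<longleftrightarrow>
     (\<exists>D. (g has_derivative D) (at x) \<and> (\<forall>c v. D (c *s v) = c * D v))"

named_theorems complex_diff_intros

lemma complex_diff_at_const [complex_diff_intros]: "complex_diff_at (\<lambda>x. k) x"
  unfolding complex_diff_at_def by (rule exI[of _ "\<lambda>_. 0"]) auto

lemma complex_diff_at_nth [complex_diff_intros]: "complex_diff_at (\<lambda>x. x $ i) x"
  unfolding complex_diff_at_def
  by (rule exI[of _ "\<lambda>v. v $ i"])
     (auto intro: bounded_linear_imp_has_derivative)

lemma complex_diff_at_add [complex_diff_intros]:
  assumes "complex_diff_at f x" "complex_diff_at g x"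
  shows "complex_diff_at (\<lambda>x. f x + g x) x"
proof -
  obtain D E where "(f has_derivative D) (at x)" "(g has_derivative E) (at x)"
    "\<forall>c v. D (c *s v) = c * D v" "\<forall>c v. E (c *s v) = c * E v"
    using assms unfolding complex_diff_at_def by blast
  then show ?thesis
    unfolding complex_diff_at_def
    by (intro exI[of _ "\<lambda>v. D v + E v"] conjI has_derivative_add) (auto simp: algebra_simps)
qed

lemma complex_diff_at_mult [complex_diff_intros]:
  assumes "complex_diff_at f x" "complex_diff_at g x"
  shows "complex_diff_at (\<lambda>x. f x * g x) x"
proof -
  obtain D E where "(f has_derivative D) (at x)" "(g has_derivative E) (at x)"
    "\<forall>c v. D (c *s v) = c * D v" "\<forall>c v. E (c *s v) = c * E v"
    using assms unfolding complex_diff_at_def by blast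
  then show ?thesis
    unfolding complex_diff_at_def
    by (intro exI[of _ "\<lambda>v. f x * E v + D v * g x"] conjI has_derivative_mult)
       (auto simp: algebra_simps)
qed

lemma complex_diff_at_diff [complex_diff_intros]:
  assumes "complex_diff_at f x" "complex_diff_at g x"
  shows "complex_diff_at (\<lambda>x. f x - g x) x"
  using complex_diff_at_add[OF assms(1) complex_diff_at_mult[OF complex_diff_at_const[of "-1"] assms(2)]]
  by simp

lemma complex_diff_at_power [complex_diff_intros]:
  assumes "complex_diff_at f x"
  shows "complex_diff_at (\<lambda>x. f x ^ n) x"
  by (induction n) (auto intro: complex_diff_intros assms)

lemma complex_diff_at_sum [complex_diff_intros]:
  assumes "\<And>i. i \<in> I \<Longrightarrow> complex_diff_at (f i) x"
  shows "complex_diff_at (\<lambda>x. \<Sum>i\<in>I. f i x) x"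
  using assms by (induction I rule: infinite_finite_induct) (auto intro: complex_diff_intros)

lemma complex_diff_at_divide [complex_diff_intros]:
  assumes f: "complex_diff_at f x" and g: "complex_diff_at g x" and nz: "g x \<noteq> 0"
  shows "complex_diff_at (\<lambda>x. f x / g x) x"
proof -
  obtain E where E: "(g has_derivative E) (at x)" "\<forall>c v. E (c *s v) = c * E v"
    using g unfolding complex_diff_at_def by blast
  have "complex_diff_at (\<lambda>x. inverse (g x)) x"
    unfolding complex_diff_at_def
    by (intro exI[of _ "\<lambda>h. - (inverse (g x) * E h * inverse (g x))"] conjI
          Deriv.has_derivative_inverse[OF nz E(1)]) (auto simp: E algebra_simps)
  from complex_diff_at_mult[OF f this] show ?thesis
    by (simp add: divide_inverse)
qed

lemma complex_diff_at_if [complex_diff_intros]: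
  "(b \<Longrightarrow> complex_diff_at f x) \<Longrightarrow> (\<not> b \<Longrightarrow> complex_diff_at g x) \<Longrightarrow>
    complex_diff_at (\<lambda>x. if b then f x else g x) x"
  by (cases b) simp_all

text \<open>Reassembles the derivative from its components along \<open>axis j\<close>, so that
  holomorphy of each explicit rational map below reduces to the scalar rules
  \<open>complex_diff_intros\<close>.\<close>

lemma holomorphic_map_onI:
  fixes f :: "complex^'a::finite \<Rightarrow> complex^'b::finite"
  assumes "\<And>x j. x \<in> S \<Longrightarrow> complex_diff_at (\<lambda>x. f x $ j) x"
  shows "holomorphic_map_on f S"
  unfolding holomorphic_map_on_def
proof
  fix x assume "x \<in> S"
  then have "\<forall>j. \<exists>D. ((\<lambda>x. f x $ j) has_derivative D) (at x) \<and> (\<forall>c v. D (c *s v) = c * D v)"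
    using assms unfolding complex_diff_at_def by blast
  then obtain D where D: "\<And>j. ((\<lambda>x. f x $ j) has_derivative D j) (at x)"
    "\<And>j c v. D j (c *s v) = c * D j v"
    by metis
  have ax: "bounded_linear (axis j :: complex \<Rightarrow> complex^'b)" for j
    by (subst linear_conv_bounded_linear[symmetric]) (auto intro!: linearI simp: vec_eq_iff axis_def)
  have "(\<lambda>x. \<Sum>j\<in>UNIV. axis j (f x $ j)) = f"
    "(\<lambda>v. \<Sum>j\<in>UNIV. axis j (D j v)) = (\<lambda>v. \<chi> j. D j v)"
    by (auto simp: fun_eq_iff vec_eq_iff axis_def)
  moreover have "((\<lambda>x. \<Sum>j\<in>UNIV. axis j (f x $ j)) has_derivative (\<lambda>v. \<Sum>j\<in>UNIV. axis j (D j v))) (at x)"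
    by (intro has_derivative_sum bounded_linear.has_derivative[OF ax] D)
  ultimately have "(f has_derivative (\<lambda>v. \<chi> j. D j v)) (at x)"
    by simp
  then show "\<exists>D. (f has_derivative D) (at x) \<and> (\<forall>c v. D (c *s v) = c *s D v)"
    by (intro exI[of _ "\<lambda>v. \<chi> j. D j v"]) (auto simp: D vec_eq_iff)
qed

lemma holomorphic_map_on_imp_complex_diff_at:
  assumes "holomorphic_map_on f S" "x \<in> S"
  shows "complex_diff_at (\<lambda>x. f x $ j) x"
proof -
  obtain D where D: "(f has_derivative D) (at x)" "\<forall>c v. D (c *s v) = c *s D v"
    using assms unfolding holomorphic_map_on_def by blast
  have "((\<lambda>x. f x $ j) has_derivative (\<lambda>v. D v $ j)) (at x)"
    by (rule bounded_linear.has_derivative[OF bounded_linear_vec_nth D(1)])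
  then show ?thesis
    unfolding complex_diff_at_def by (intro exI[of _ "\<lambda>v. D v $ j"]) (auto simp: D)
qed

lemma holomorphic_map_on_compose:
  assumes f: "holomorphic_map_on f S" and g: "holomorphic_map_on g T" and "f \<in> S \<rightarrow> T"
  shows "holomorphic_map_on (\<lambda>x. g (f x)) S"
  unfolding holomorphic_map_on_def
proof
  fix x assume x: "x \<in> S"
  obtain D where D: "(f has_derivative D) (at x)" "\<forall>c v. D (c *s v) = c *s D v"
    using f x unfolding holomorphic_map_on_def by blast
  obtain E where E: "(g has_derivative E) (at (f x))" "\<forall>c v. E (c *s v) = c *s E v"
    using g x assms(3) unfolding holomorphic_map_on_def by blast
  show "\<exists>D. ((\<lambda>x. g (f x)) has_derivative D) (at x) \<and> (\<forall>c v. D (c *s v) = c *s D v)"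
    using has_derivative_compose[OF D(1) E(1)] D(2) E(2) by auto
qed

lemma holomorphic_map_on_cong:
  assumes "open S" "holomorphic_map_on f S" "\<And>x. x \<in> S \<Longrightarrow> f x = g x"
  shows "holomorphic_map_on g S"
  using assms unfolding holomorphic_map_on_def by (metis has_derivative_transform_within_open)

lemma holomorphic_map_on_imp_continuous_on:
  "holomorphic_map_on f S \<Longrightarrow> continuous_on S f"
  unfolding holomorphic_map_on_def
  by (meson continuous_at_imp_continuous_on has_derivative_continuous)

lemma norm_vector_scalar_mult [simp]: "norm (c *s (v :: complex^'n::finite)) = norm c * norm v"
  by (simp add: norm_vec_def norm_mult L2_set_right_distrib)

text \<open>The bridge to one complex variable: complex homogeneity turns the derivative along
  \<open>v\<close> into multiplication by \<open>D v\<close>. It makes \<open>Schwarz_Lemma\<close>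
  applicable to discs in complex lines.\<close>

lemma holomorphic_map_on_line:
  fixes f :: "complex^'a::finite \<Rightarrow> complex^'b::finite"
  assumes "holomorphic_map_on f S"
  shows "(\<lambda>\<zeta>. f (b + \<zeta> *s v) $ j) holomorphic_on {\<zeta>. b + \<zeta> *s v \<in> S}"
proof (rule holomorphic_onI)
  fix \<zeta> assume "\<zeta> \<in> {\<zeta>. b + \<zeta> *s v \<in> S}"
  then have "complex_diff_at (\<lambda>x. f x $ j) (b + \<zeta> *s v)"
    using assms holomorphic_map_on_imp_complex_diff_at by blast
  then obtain D where D: "((\<lambda>x. f x $ j) has_derivative D) (at (b + \<zeta> *s v))"
    "\<forall>c v. D (c *s v) = c * D v"
    unfolding complex_diff_at_def by blast
  have "bounded_linear (\<lambda>\<zeta>. \<zeta> *s v)"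
    by (rule bounded_linear_intro[where K = "norm v"]) (auto simp: vec_eq_iff algebra_simps)
  then have "((\<lambda>\<zeta>. b + \<zeta> *s v) has_derivative (\<lambda>h. h *s v)) (at \<zeta>)"
    using has_derivative_add[OF has_derivative_const bounded_linear_imp_has_derivative] by simp
  from has_derivative_compose[OF this D(1)]
  have "((\<lambda>\<zeta>. f (b + \<zeta> *s v) $ j) has_derivative (\<lambda>h. D v * h)) (at \<zeta>)"
    by (simp add: D(2) mult.commute)
  then show "(\<lambda>\<zeta>. f (b + \<zeta> *s v) $ j) field_differentiable (at \<zeta> within {\<zeta>. b + \<zeta> *s v \<in> S})"
    by (meson field_differentiable_at_within field_differentiable_def has_field_derivative_def)
qed

section \<open>Biholomorphisms\<close>

text \<open>The inverse is an explicit argument and source and target may differ, so that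
  composition and inversion are immediate and the Cayley transformation fits the same notion as the
  automorphisms.\<close>

definition biholomorphism ::
  "(complex^'a::finite) set \<Rightarrow> (complex^'b::finite) set
     \<Rightarrow> (complex^'a \<Rightarrow> complex^'b) \<Rightarrow> (complex^'b \<Rightarrow> complex^'a) \<Rightarrow> bool" where
  "biholomorphism S T f g \<longleftrightarrow>
     holomorphic_map_on f S \<and> holomorphic_map_on g T \<and> f \<in> S \<rightarrow> T \<and> g \<in> T \<rightarrow> S \<and>
     (\<forall>x\<in>S. g (f x) = x) \<and> (\<forall>y\<in>T. f (g y) = y)"

lemma biholomorphism_sym: "biholomorphism S T f g \<Longrightarrow> biholomorphism T S g f"
  unfolding biholomorphism_def by blast

lemma biholomorphism_compose:
  assumes "biholomorphism S T f g" "biholomorphism T U h k"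
  shows "biholomorphism S U (\<lambda>x. h (f x)) (\<lambda>y. g (k y))"
  using assms unfolding biholomorphism_def
  by (auto intro: holomorphic_map_on_compose simp: Pi_iff)

lemma holomorphic_automorphism_imp_biholomorphism:
  assumes "holomorphic_automorphism S f"
  shows "biholomorphism S S f (the_inv_into S f)"
  using assms unfolding holomorphic_automorphism_def biholomorphism_def
  by (auto simp: bij_betw_def the_inv_into_f_f f_the_inv_into_f the_inv_into_into)

text \<open>\<open>the_inv_into S f\<close> agrees with \<open>g\<close> only on \<open>S\<close>;
  openness of \<open>S\<close> is what transfers the derivative.\<close>

lemma biholomorphism_imp_holomorphic_automorphism:
  assumes "open S" "biholomorphism S S f g"
  shows "holomorphic_automorphism S f"
proof -
  have b: "bij_betw f S S"
    by (rule bij_betw_byWitness[where f' = g]) (use assms(2) in \<open>auto simp: biholomorphism_def\<close>)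
  have "the_inv_into S f y = g y" if "y \<in> S" for y
    using assms(2) that b the_inv_into_f_eq[of f S "g y" y]
    unfolding biholomorphism_def bij_betw_def by auto
  then have "holomorphic_map_on (the_inv_into S f) S"
    using assms unfolding biholomorphism_def by (metis holomorphic_map_on_cong)
  with b assms(2) show ?thesis
    unfolding holomorphic_automorphism_def biholomorphism_def by blast
qed

section \<open>The Hermitian inner product\<close>

text \<open>Complex linear in the first argument; its real part is the inner product of the
  underlying real space. Denominators of fractional linear maps have the form
  \<open>1 - hinner x c\<close>.\<close>

definition hinner :: "complex^'n::finite \<Rightarrow> complex^'n \<Rightarrow> complex" where
  "hinner x y = (\<Sum>i\<in>UNIV. x $ i * cnj (y $ i))"

lemma hinner_add_left: "hinner (x + y) z = hinner x z + hinner y z"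
  by (simp add: hinner_def sum.distrib algebra_simps)

lemma hinner_diff_left: "hinner (x - y) z = hinner x z - hinner y z"
  by (simp add: hinner_def sum_subtractf algebra_simps)

lemma hinner_add_right: "hinner z (x + y) = hinner z x + hinner z y"
  by (simp add: hinner_def sum.distrib algebra_simps)

lemma hinner_diff_right: "hinner z (x - y) = hinner z x - hinner z y"
  by (simp add: hinner_def sum_subtractf algebra_simps)

lemma hinner_scale_left [simp]: "hinner (c *s x) y = c * hinner x y"
  by (simp add: hinner_def sum_distrib_left algebra_simps)

lemma hinner_scale_right [simp]: "hinner x (c *s y) = cnj c * hinner x y"
  by (simp add: hinner_def sum_distrib_left algebra_simps)

lemma hinner_zero [simp]: "hinner 0 y = 0" "hinner x 0 = 0"
  by (simp_all add: hinner_def)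

lemma cnj_hinner: "cnj (hinner x y) = hinner y x"
  by (simp add: hinner_def mult.commute)

lemma norm_vec_sum_squares: "(norm (x :: complex^'n::finite))\<^sup>2 = (\<Sum>i\<in>UNIV. (norm (x $ i))\<^sup>2)"
  by (simp add: norm_vec_def L2_set_def sum_nonneg)

lemma hinner_self: "hinner x x = of_real ((norm x)\<^sup>2)"
  by (simp add: hinner_def norm_vec_sum_squares complex_norm_square del: of_real_power)

lemma norm_diff_hinner: "(norm (x - y))\<^sup>2 = (norm x)\<^sup>2 + (norm y)\<^sup>2 - 2 * Re (hinner x y)"
proof -
  have "of_real ((norm (x - y))\<^sup>2) =
      of_real ((norm x)\<^sup>2) + of_real ((norm y)\<^sup>2) - (hinner x y + cnj (hinner x y))"
    unfolding hinner_self[symmetric] by (simp add: hinner_diff_left hinner_diff_right cnj_hinner)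
  also have "\<dots> = of_real ((norm x)\<^sup>2 + (norm y)\<^sup>2 - 2 * Re (hinner x y))"
    by (simp add: complex_add_cnj)
  finally show ?thesis
    using of_real_eq_iff by blast
qed

lemma norm_hinner_le: "norm (hinner x y) \<le> norm x * norm y"
proof -
  have "norm (hinner x y) \<le> (\<Sum>i\<in>UNIV. norm (x $ i) * norm (y $ i))"
    unfolding hinner_def by (intro sum_norm_le) (simp add: norm_mult)
  also have "\<dots> \<le> norm x * norm y"
    unfolding norm_vec_def using L2_set_mult_ineq[of "\<lambda>i. norm (x $ i)" "\<lambda>i. norm (y $ i)" UNIV] by simp
  finally show ?thesis .
qed

section \<open>Automorphisms of the ball\<close>

text \<open>The standard involution of the ball exchanging 0 and b, usually (b - P x - s (x - P x))
  / (1 - t) with P the orthogonal projection onto the line of b. From P x = (t / |b|^2) b and |b|^2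
  = (1 - s)(1 + s) one gets (1 - s) P x = (t / (1 + s)) b; this form avoids dividing by |b|^2 and
  makes sense for b = 0.\<close>

definition moebius :: "complex^'n::finite \<Rightarrow> complex^'n \<Rightarrow> complex^'n" where
  "moebius b x = (let s = of_real (sqrt (1 - (norm b)\<^sup>2)); t = hinner x b in
     (1 / (1 - t)) *s ((1 - t / (1 + s)) *s b - s *s x))"

lemma one_minus_hinner_nonzero:
  assumes "norm b < 1" "norm x \<le> 1"
  shows "1 - hinner x b \<noteq> 0"
proof
  assume "1 - hinner x b = 0"
  then have "norm (hinner x b) = 1" by simp
  with norm_hinner_le[of x b] have "1 \<le> norm x * norm b" by simp
  moreover have "norm x * norm b \<le> norm b"
    using assms by (simp add: mult_left_le_one_le)
  ultimately show False using assms by simp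
qed

text \<open>Expanding the numerator leaves only |x|^2 and the single number t =
  \<open>hinner x b\<close>, so the claim is a real identity in Re t, Im t and s. The right-hand
  side has the sign of 1 - |x|^2, which gives invariance of the ball.\<close>

lemma norm_moebius:
  assumes b: "norm b < 1" and x: "norm x \<le> 1"
  shows "1 - (norm (moebius b x))\<^sup>2 =
    (1 - (norm b)\<^sup>2) * (1 - (norm x)\<^sup>2) / (norm (1 - hinner x b))\<^sup>2"
proof -
  define s where "s = sqrt (1 - (norm b)\<^sup>2)"
  define t where "t = hinner x b"
  have b2: "(norm b)\<^sup>2 < 1"
    using b by (simp add: abs_square_less_1)
  have s: "s > 0" "s\<^sup>2 = 1 - (norm b)\<^sup>2"
    using b2 unfolding s_def by auto
  then have sb: "(norm b)\<^sup>2 = 1 - s\<^sup>2" by simp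
  have nz: "1 - t \<noteq> 0"
    unfolding t_def by (rule one_minus_hinner_nonzero[OF b x])
  let ?k = "1 - t / (1 + of_real s)"
  have ns: "(norm (1 + complex_of_real s)) = 1 + s"
    using s by (metis abs_of_pos add_pos_pos norm_of_real of_real_1 of_real_add zero_less_one)
  then have s1: "1 + complex_of_real s \<noteq> 0"
    using s by (metis add_pos_pos less_irrefl norm_zero zero_less_one)
  have k1: "(norm ?k)\<^sup>2 * (1 + s)\<^sup>2 = (1 + s - Re t)\<^sup>2 + (Im t)\<^sup>2"
  proof -
    have "?k * (1 + of_real s) = (1 + of_real s) - t"
      using s1 by (simp add: divide_simps)
    then have "norm ?k * (1 + s) = norm ((1 + of_real s) - t)"
      using ns by (metis norm_mult)
    then have "(norm ?k)\<^sup>2 * (1 + s)\<^sup>2 = (norm ((1 + of_real s) - t))\<^sup>2"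
      by (metis power_mult_distrib)
    then show ?thesis by (simp add: cmod_power2)
  qed
  have k2: "Re (?k * cnj t) * (1 + s) = (1 + s) * Re t - ((Re t)\<^sup>2 + (Im t)\<^sup>2)"
  proof -
    show ?thesis using s by (simp add: field_simps power2_eq_square)
  qed
  have gen: "(norm (k *s b - of_real s *s x))\<^sup>2 =
      (norm k)\<^sup>2 * (norm b)\<^sup>2 + s\<^sup>2 * (norm x)\<^sup>2 - 2 * s * Re (k * cnj t)" for k
    using s cnj_hinner[of x b]
    by (simp add: norm_diff_hinner power_mult_distrib t_def[symmetric] algebra_simps)
  have "(norm (?k *s b - of_real s *s x))\<^sup>2 =
      (norm ?k)\<^sup>2 * (1 - s\<^sup>2) + s\<^sup>2 * (norm x)\<^sup>2 - 2 * s * Re (?k * cnj t)"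
    using gen[of ?k] by (simp only: sb)
  moreover have "\<dots> = (norm (1 - t))\<^sup>2 - s\<^sup>2 * (1 - (norm x)\<^sup>2)"
  proof -
    \<comment> \<open>Multiplying by 1 + s and splitting 1 - s^2 = (1 - s)(1 + s) brings the terms
      into the shape of \<open>k1\<close> and \<open>k2\<close>, where the division by 1 + s inside
      \<open>?k\<close> is gone.\<close>
    have "((norm ?k)\<^sup>2 * (1 - s\<^sup>2) - 2 * s * Re (?k * cnj t)) * (1 + s)
       = (1 - s) * ((norm ?k)\<^sup>2 * (1 + s)\<^sup>2) - 2 * s * (Re (?k * cnj t) * (1 + s))"
      by (simp add: algebra_simps power2_eq_square)
    also have "\<dots> = ((1 - Re t)\<^sup>2 + (Im t)\<^sup>2 - s\<^sup>2) * (1 + s)"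
      unfolding k1 k2 by (simp add: algebra_simps power2_eq_square)
    finally have "(norm ?k)\<^sup>2 * (1 - s\<^sup>2) - 2 * s * Re (?k * cnj t) = (1 - Re t)\<^sup>2 + (Im t)\<^sup>2 - s\<^sup>2"
      using s by simp
    then show ?thesis by (simp add: cmod_power2 algebra_simps)
  qed
  moreover have "(norm (moebius b x))\<^sup>2 = (norm (?k *s b - of_real s *s x))\<^sup>2 / (norm (1 - t))\<^sup>2"
    unfolding moebius_def Let_def s_def[symmetric] t_def[symmetric]
    by (simp only: norm_vector_scalar_mult power_mult_distrib norm_divide power_divide) simp
  ultimately show ?thesis
    using nz by (simp add: field_simps s t_def[symmetric])
qed

lemma moebius_in_ball:
  assumes "norm b < 1" "x \<in> ball 0 1"
  shows "moebius b x \<in> ball 0 1"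
proof -
  have "(norm b)\<^sup>2 < 1" "(norm x)\<^sup>2 < 1"
    using assms by (auto simp: abs_square_less_1)
  moreover have "norm (1 - hinner x b) > 0"
    using one_minus_hinner_nonzero[of b x] assms by simp
  ultimately have "1 - (norm (moebius b x))\<^sup>2 > 0"
    using norm_moebius[of b x] assms by simp
  then show ?thesis by (simp add: abs_square_less_1)
qed

text \<open>The inner product with b transforms by t' = (1 - s^2 - t) / (1 - t), so 1 - t' = s^2 /
  (1 - t). With both denominators explicit, each component is a field identity.\<close>

lemma moebius_involution:
  assumes b: "norm b < 1" and x: "x \<in> ball 0 1"
  shows "moebius b (moebius b x) = x"
proof -
  define s where "s = complex_of_real (sqrt (1 - (norm b)\<^sup>2))"
  define t where "t = hinner x b"
  define t' where "t' = hinner (moebius b x) b"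
  have b2: "(norm b)\<^sup>2 < 1"
    using b by (simp add: abs_square_less_1)
  have s2: "s\<^sup>2 = 1 - of_real ((norm b)\<^sup>2)"
    unfolding s_def of_real_power[symmetric] using b2 by simp
  then have bb: "hinner b b = (1 - s) * (1 + s)"
    by (simp add: hinner_self power2_eq_square algebra_simps)
  have s0: "s \<noteq> 0" "1 + s \<noteq> 0"
    using b2 unfolding s_def by (auto simp: complex_eq_iff) (smt (verit) real_sqrt_ge_zero)+
  have nz: "1 - t \<noteq> 0"
    unfolding t_def using one_minus_hinner_nonzero[of b x] assms by simp
  have m: "moebius b y = (1 / (1 - hinner y b)) *s ((1 - hinner y b / (1 + s)) *s b - s *s y)" for y
    by (simp add: moebius_def Let_def s_def)
  have t': "t' = ((1 - t / (1 + s)) * ((1 - s) * (1 + s)) - s * t) / (1 - t)"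
    unfolding t'_def m by (simp only: hinner_scale_left hinner_diff_left bb t_def) simp
  have t'': "t' = (1 - s\<^sup>2 - t) / (1 - t)"
  proof -
    have "(1 - t / (1 + s)) * (1 + s) = 1 + s - t"
      using s0 by (simp add: field_simps)
    then have "(1 - t / (1 + s)) * ((1 - s) * (1 + s)) = (1 - s) * (1 + s - t)"
      by (metis mult.assoc mult.commute)
    then show ?thesis
      unfolding t' by (simp add: algebra_simps power2_eq_square)
  qed
  have nz': "1 - t' = s\<^sup>2 / (1 - t)"
    unfolding t'' using nz by (simp add: field_simps)
  have "moebius b (moebius b x) $ i = x $ i" for i
  proof -
    have 1: "(moebius b x) $ i = ((1 - t / (1 + s)) * b $ i - s * x $ i) / (1 - t)"
      by (simp only: m t_def vector_smult_component vector_minus_component) simp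
    have "moebius b (moebius b x) $ i = ((1 - t' / (1 + s)) * b $ i - s * (moebius b x) $ i) / (1 - t')"
      by (simp only: m[of "moebius b x"] t'_def vector_smult_component vector_minus_component) simp
    also have "\<dots> = x $ i"
      unfolding nz' unfolding 1 t'' using s0 nz by (simp add: divide_simps) (simp add: algebra_simps power2_eq_square)
    finally show ?thesis .
  qed
  then show ?thesis by (simp add: vec_eq_iff)
qed

lemma biholomorphism_moebius:
  assumes b: "norm b < 1"
  shows "biholomorphism (ball 0 1) (ball 0 1) (moebius b) (moebius b)"
proof -
  have "(norm b)\<^sup>2 < 1"
    using b by (simp add: abs_square_less_1)
  then have "1 + complex_of_real (sqrt (1 - (norm b)\<^sup>2)) \<noteq> 0"
    by (simp add: complex_eq_iff) (smt (verit) real_sqrt_ge_zero)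
  then have "complex_diff_at (\<lambda>x. moebius b x $ j) x" if "x \<in> ball 0 1" for x j
    using one_minus_hinner_nonzero[of b x] that b unfolding moebius_def Let_def hinner_def
    by (auto intro!: complex_diff_intros)
  then have "holomorphic_map_on (moebius b) (ball 0 1)"
    by (intro holomorphic_map_onI)
  then show ?thesis
    using moebius_in_ball[OF b] moebius_involution[OF b]
    unfolding biholomorphism_def by blast
qed


section \<open>The Schwarz lemma on the ball and linearity of automorphisms fixing the
  origin\<close>

text \<open>With e = x / |x| and a unit vector u, the scalar function \<zeta> -> <f(\<zeta> e), u>
  satisfies the one-variable Schwarz lemma. Choosing u along a value of f bounds its norm; equality
  at one point makes the scalar function equal to \<zeta>, and then f itself must be \<zeta> u on
  the whole disc.\<close>

lemma schwarz_ball: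
  fixes f :: "complex^'n::finite \<Rightarrow> complex^'m::finite"
  assumes hol: "holomorphic_map_on f (ball 0 1)" and im: "f \<in> ball 0 1 \<rightarrow> ball 0 1"
    and f0: "f 0 = 0" and x: "x \<in> ball 0 1" "x \<noteq> 0"
  shows "norm (f x) \<le> norm x"
    and "norm (f x) = norm x \<Longrightarrow> norm \<zeta> < 1 \<Longrightarrow>
      f ((\<zeta> / of_real (norm x)) *s x) = (\<zeta> / of_real (norm x)) *s f x"
proof -
  define e where "e = (1 / complex_of_real (norm x)) *s x"
  have e: "norm e = 1"
    using x by (simp add: e_def norm_divide)
  have xe: "x = of_real (norm x) *s e"
    using x by (simp add: e_def)
  have in_ball: "\<zeta> *s e \<in> ball 0 1" if "norm \<zeta> < 1" for \<zeta>
    using that e by simp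
  have S: "norm (hinner (f (\<zeta> *s e)) u) \<le> norm \<zeta>"
    "(\<exists>z. norm z < 1 \<and> z \<noteq> 0 \<and> norm (hinner (f (z *s e)) u) = norm z) \<Longrightarrow>
       \<exists>\<alpha>. (\<forall>z. norm z < 1 \<longrightarrow> hinner (f (z *s e)) u = \<alpha> * z) \<and> norm \<alpha> = 1"
    if u: "norm u = 1" and z: "norm \<zeta> < 1" for u \<zeta>
  proof -
    let ?h = "\<lambda>\<zeta>. hinner (f (\<zeta> *s e)) u"
    have "(\<lambda>\<zeta>. f (\<zeta> *s e) $ i) holomorphic_on {\<zeta>. \<zeta> *s e \<in> ball 0 1}" for i
      using holomorphic_map_on_line[OF hol, of 0 e i] by simp
    then have "(\<lambda>\<zeta>. f (\<zeta> *s e) $ i) holomorphic_on ball 0 1" for i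
      by (rule holomorphic_on_subset) (use e in auto)
    then have h: "?h holomorphic_on ball 0 1"
      unfolding hinner_def by (intro holomorphic_intros)
    have h0: "?h 0 = 0" by (simp add: f0)
    have h1: "norm (?h \<zeta>) < 1" if "norm \<zeta> < 1" for \<zeta>
    proof -
      have "f (\<zeta> *s e) \<in> ball 0 1" using im in_ball[OF that] by blast
      then show ?thesis using norm_hinner_le[of "f (\<zeta> *s e)" u] u by simp
    qed
    show "norm (?h \<zeta>) \<le> norm \<zeta>" by (rule Schwarz_Lemma(1)[OF h h0 h1 z])
    show "\<exists>\<alpha>. (\<forall>z. norm z < 1 \<longrightarrow> ?h z = \<alpha> * z) \<and> norm \<alpha> = 1"
      if "\<exists>z. norm z < 1 \<and> z \<noteq> 0 \<and> norm (?h z) = norm z"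
      using Schwarz_Lemma(3)[OF h h0 h1 z] that by blast
  qed
  have bound: "norm (f (\<zeta> *s e)) \<le> norm \<zeta>" if z: "norm \<zeta> < 1" for \<zeta>
  proof (cases "f (\<zeta> *s e) = 0")
    case False
    define r where "r = norm (f (\<zeta> *s e))"
    have r: "r > 0" using False by (simp add: r_def)
    \<comment> \<open>The unit vector in the direction of the value, against which the inner product
      is exactly the norm.\<close>
    define u where "u = (1 / complex_of_real r) *s f (\<zeta> *s e)"
    have "norm u = 1" using r by (simp add: u_def r_def[symmetric] norm_divide)
    moreover have "hinner (f (\<zeta> *s e)) u = of_real r"
      using r by (simp add: u_def hinner_self r_def[symmetric] power2_eq_square)
    ultimately show ?thesis
      using S(1)[of u \<zeta>] z r by (simp add: r_def)
  qed auto
  have nx: "norm (complex_of_real (norm x)) < 1" "complex_of_real (norm x) \<noteq> 0" using x by auto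
  show "norm (f x) \<le> norm x"
    using bound[OF nx(1)] xe by simp
  show "f ((\<zeta> / of_real (norm x)) *s x) = (\<zeta> / of_real (norm x)) *s f x"
    if eq: "norm (f x) = norm x" and z: "norm \<zeta> < 1"
  proof -
    define u where "u = (1 / complex_of_real (norm x)) *s f x"
    have u: "norm u = 1" using eq x by (simp add: u_def norm_divide)
    have hx: "hinner (f (of_real (norm x) *s e)) u = of_real (norm x)"
      using x eq by (simp add: xe[symmetric] u_def hinner_self power2_eq_square)
    then obtain \<alpha> where \<alpha>: "\<And>z. norm z < 1 \<Longrightarrow> hinner (f (z *s e)) u = \<alpha> * z"
      using S(2)[OF u z] nx by (metis)
    then have "\<alpha> = 1"
      using hx nx by (metis mult_cancel_right1)
    then have hz: "hinner (f (\<zeta> *s e)) u = \<zeta>"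
      using \<alpha> z by simp
    \<comment> \<open>The cross term is 2 |\<zeta>|^2 by \<open>hz\<close>, and |f(\<zeta> e)| is at
      most |\<zeta>|: there is no room left for a component of f(\<zeta> e) orthogonal to u.\<close>
    have "(norm (f (\<zeta> *s e) - \<zeta> *s u))\<^sup>2 = (norm (f (\<zeta> *s e)))\<^sup>2 + (norm \<zeta>)\<^sup>2 - 2 * (norm \<zeta>)\<^sup>2"
      using u hz by (simp add: norm_diff_hinner cmod_power2) (simp add: power2_eq_square)
    also have "\<dots> \<le> 0"
      using power_mono[OF bound[OF z], of 2] by simp
    finally have "f (\<zeta> *s e) = \<zeta> *s u" by simp
    then show ?thesis by (simp add: e_def u_def)
  qed
qed

text \<open>The Schwarz bound for f and for its inverse gives |f(x)| = |x|, so the equality case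
  yields f(t x) = t f(x) for 0 < t < 1. A map that is homogeneous along rays and differentiable at 0
  equals its derivative there.\<close>

lemma ball_biholomorphism_fixing_zero_linear:
  fixes f :: "complex^'n::finite \<Rightarrow> complex^'n"
  assumes bih: "biholomorphism (ball 0 1) (ball 0 1) f g" and f0: "f 0 = 0"
  obtains L where "\<And>x. x \<in> ball 0 1 \<Longrightarrow> f x = L *v x"
proof -
  have f: "holomorphic_map_on f (ball 0 1)" "f \<in> ball 0 1 \<rightarrow> ball 0 1"
    and g: "holomorphic_map_on g (ball 0 1)" "g \<in> ball 0 1 \<rightarrow> ball 0 1"
    and gf: "\<And>x. x \<in> ball 0 1 \<Longrightarrow> g (f x) = x"
    using bih unfolding biholomorphism_def by auto
  have g0: "g 0 = 0" using gf[of 0] f0 by simp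
  have iso: "norm (f x) = norm x" if x: "x \<in> ball 0 1" for x
  proof (cases "x = 0")
    case False
    then have "f x \<noteq> 0" using gf[OF x] g0 by metis
    moreover have "f x \<in> ball 0 1" using f x by blast
    ultimately show ?thesis
      using schwarz_ball(1)[OF f f0 x False] schwarz_ball(1)[OF g g0, of "f x"] gf[OF x] by simp
  qed (simp add: f0)
  have hom: "f (of_real t *s x) = of_real t *s f x" if "x \<in> ball 0 1" "0 < t" "t < 1" for x t
  proof (cases "x = 0")
    case False
    have "norm (of_real (t * norm x) :: complex) < 1"
      using that mult_left_le_one_le[of "norm x" t] by (simp add: norm_mult)
    from schwarz_ball(2)[OF f f0 that(1) False iso[OF that(1)] this]
    show ?thesis using False by simp
  qed (simp add: f0)
  obtain D where D: "(f has_derivative D) (at 0)" "\<And>c v. D (c *s v) = c *s D v"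
    using f(1) unfolding holomorphic_map_on_def by force
  interpret D: bounded_linear D
    using D(1) by (rule has_derivative_bounded_linear)
  have fD: "f x = D x" if x: "x \<in> ball 0 1" for x
  proof (cases "x = 0")
    case False
    have sc: "complex_of_real t *s y = t *\<^sub>R y" for t and y :: "complex^'n"
      by (simp add: vec_eq_iff complex_eq_iff)
    have "((\<lambda>h. norm (f h - D h) / norm h) \<longlongrightarrow> 0) (at 0)"
      using D(1) f0 by (simp add: has_derivative_at)
    moreover have "filterlim (\<lambda>t. t *\<^sub>R x) (at 0) (at_right (0::real))"
      using False by (auto simp: filterlim_at eventually_at_right_field intro!: tendsto_eq_intros exI[of _ 1])
    ultimately have "((\<lambda>t. norm (f (t *\<^sub>R x) - D (t *\<^sub>R x)) / norm (t *\<^sub>R x)) \<longlongrightarrow> 0) (at_right 0)"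
      by (rule filterlim_compose)
    \<comment> \<open>By \<open>hom\<close> the difference quotient does not depend on t, so its
      limit 0 is also its value.\<close>
    moreover have "\<forall>\<^sub>F t in at_right 0.
        norm (f (t *\<^sub>R x) - D (t *\<^sub>R x)) / norm (t *\<^sub>R x) = norm (f x - D x) / norm x"
      unfolding eventually_at_right_field
    proof (intro exI[of _ 1] conjI allI impI)
      fix t :: real assume t: "0 < t" "t < 1"
      have "f (t *\<^sub>R x) - D (t *\<^sub>R x) = t *\<^sub>R (f x - D x)"
        using hom[OF x t] by (simp add: sc D.scaleR scaleR_diff_right)
      then show "norm (f (t *\<^sub>R x) - D (t *\<^sub>R x)) / norm (t *\<^sub>R x) = norm (f x - D x) / norm x"
        using t by simp
    qed simp
    ultimately have "((\<lambda>t::real. norm (f x - D x) / norm x) \<longlongrightarrow> 0) (at_right 0)"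
      by (rule Lim_transform_eventually)
    then show ?thesis using False by (simp add: tendsto_const_iff)
  qed (simp add: f0 D.zero)
  have "Vector_Spaces.linear (*s) (*s) D"
    by unfold_locales (auto simp: D.add D(2) vec_eq_iff algebra_simps)
  then have "matrix D *v x = D x" for x by (rule matrix_works)
  then show thesis using that[of "matrix D"] fD by simp
qed

text \<open>Precomposing with the involution at c = g(0) produces an automorphism fixing 0, hence a
  matrix \<open>U\<close>, and f = U o \<open>moebius c\<close>. The denominator is controlled on
  the closed ball because boundary values are needed later.\<close>

lemma ball_automorphism_fractional_linear:
  fixes f :: "complex^'n::finite \<Rightarrow> complex^'n"
  assumes bih: "biholomorphism (ball 0 1) (ball 0 1) f g"
  obtains L :: "complex^'n^'n" and b c :: "complex^'n"
    where "\<And>x. norm x \<le> 1 \<Longrightarrow> 1 - hinner x c \<noteq> 0"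
      and "\<And>x. x \<in> ball 0 1 \<Longrightarrow> f x = (1 / (1 - hinner x c)) *s (b + L *v x)"
proof -
  define c where "c = g 0"
  have fc: "f c = 0" and c: "norm c < 1"
    using bih unfolding biholomorphism_def c_def by auto
  have "biholomorphism (ball 0 1) (ball 0 1) (\<lambda>x. f (moebius c x)) (\<lambda>x. moebius c (g x))"
    using biholomorphism_compose[OF biholomorphism_moebius[OF c] bih] .
  moreover have "f (moebius c 0) = 0"
  proof -
    have "moebius c 0 = c" by (simp add: moebius_def Let_def vec_eq_iff)
    with fc show ?thesis by simp
  qed
  ultimately obtain U where U: "\<And>x. x \<in> ball 0 1 \<Longrightarrow> f (moebius c x) = U *v x"
    using ball_biholomorphism_fixing_zero_linear by metis
  define s where "s = complex_of_real (sqrt (1 - (norm c)\<^sup>2))"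
  \<comment> \<open>The linear part of the numerator of \<open>moebius c\<close>; its constant term
    is \<open>c\<close>.\<close>
  define N where "N = (\<lambda>x. - (hinner x c / (1 + s)) *s c - s *s x)"
  have "Vector_Spaces.linear (*s) (*s) N"
    unfolding N_def
    by unfold_locales (auto simp: vec_eq_iff hinner_add_left add_divide_distrib algebra_simps)
  then have N: "matrix N *v x = N x" for x by (rule matrix_works)
  show thesis
  proof
    show "1 - hinner x c \<noteq> 0" if "norm x \<le> 1" for x
      by (rule one_minus_hinner_nonzero[OF c that])
    show "f x = (1 / (1 - hinner x c)) *s (U *v c + (U ** matrix N) *v x)" if x: "x \<in> ball 0 1" for x
    proof -
      have "f x = U *v (moebius c x)"
        using U[OF moebius_in_ball[OF c x]] moebius_involution[OF c x] by simp
      also have "moebius c x = (1 / (1 - hinner x c)) *s (c + N x)"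
        by (simp add: moebius_def Let_def s_def[symmetric] N_def vec_eq_iff algebra_simps)
      also have "U *v \<dots> = (1 / (1 - hinner x c)) *s (U *v c + U *v N x)"
        by (simp add: matrix_vector_right_distrib vector_scalar_commute[symmetric])
      finally show ?thesis by (simp add: N matrix_vector_mul_assoc[symmetric])
    qed
  qed
qed

section \<open>Sums over option and sum types\<close>

lemma sum_UNIV_option:
  "(\<Sum>i\<in>(UNIV :: 'a::finite option set). f i) = f None + (\<Sum>j\<in>UNIV. f (Some j))"
  by (simp add: UNIV_option_conv sum.reindex)

lemma sum_UNIV_sum:
  "(\<Sum>i\<in>(UNIV :: ('a::finite + 'b::finite) set). f i) =
    (\<Sum>j\<in>UNIV. f (Inl j)) + (\<Sum>j\<in>UNIV. f (Inr j))"
  using sum.Plus[of "UNIV :: 'a set" "UNIV :: 'b set" f] by (simp add: comp_def)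

lemma norm_option_squared:
  fixes x :: "complex^('m::finite option)"
  shows "(norm x)\<^sup>2 = (norm (x $ None))\<^sup>2 + (norm (horiz x))\<^sup>2"
  by (simp add: norm_vec_sum_squares sum_UNIV_option horiz_def)

section \<open>The map on the closed ball\<close>

lemma F_map_nth [simp]:
  "F_map a x $ None = (x $ None)\<^sup>2 * ((x $ None - a) / (1 - cnj a * x $ None))"
  "F_map a x $ Some (Inl j) = x $ Some j"
  "F_map a x $ Some (Inr (Inl j)) = x $ None * x $ Some j"
  "F_map a x $ Some (Inr (Inr j)) =
     (x $ None)\<^sup>2 * (of_real (sqrt (1 - (norm a)\<^sup>2)) * x $ Some j / (1 - cnj a * x $ None))"
  by (simp_all add: F_map_def Let_def)

lemma one_minus_cnj_mult_nonzero:
  assumes "norm a < 1" "norm w \<le> 1"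
  shows "1 - cnj a * w \<noteq> 0"
proof
  assume "1 - cnj a * w = 0"
  then have "norm a * norm w = 1"
    by (metis complex_mod_cnj eq_iff_diff_eq_0 norm_mult norm_one)
  moreover have "norm a * norm w \<le> norm a"
    using assms by (simp add: mult_left_le)
  ultimately show False using assms by simp
qed

lemma one_minus_cnj_mult_nth_nonzero:
  assumes "norm a < 1" "norm (x :: complex^'n::finite) \<le> 1"
  shows "1 - cnj a * x $ i \<noteq> 0"
  using one_minus_cnj_mult_nonzero[OF assms(1) order_trans[OF Finite_Cartesian_Product.norm_nth_le assms(2)]] .

lemma index_cases:
  fixes i :: "('m + ('m + 'm)) option"
  obtains "i = None" | j where "i = Some (Inl j)" | j where "i = Some (Inr (Inl j))"
    | j where "i = Some (Inr (Inr j))"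
  by (metis not_Some_eq sum.exhaust)

lemma holomorphic_map_on_F_map:
  "holomorphic_map_on (F_map a :: complex^('m::finite option) \<Rightarrow> _) {x. 1 - cnj a * x $ None \<noteq> 0}"
proof (rule holomorphic_map_onI)
  fix x :: "complex^('m option)" and j
  assume "x \<in> {x. 1 - cnj a * x $ None \<noteq> 0}"
  then have nz: "1 - cnj a * x $ None \<noteq> 0" by simp
  show "complex_diff_at (\<lambda>x. F_map a x $ j) x"
  proof (cases j)
    case (Some k)
    show ?thesis
    proof (cases k)
      case (Inr l)
      then show ?thesis using Some nz by (cases l) (auto intro!: complex_diff_intros)
    qed (auto simp: Some intro!: complex_diff_intros)
  qed (use nz in \<open>auto intro!: complex_diff_intros\<close>)
qed

text \<open>F arises by tensoring the last coordinate twice: (z', w) becomes (z', w (z', w)), and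
  then w^2 is replaced by w^2 \<psi>, where \<psi> = (sqrt(1 - |a|^2) z', w - a) / (1 - conj(a) w)
  is a ball automorphism up to order of coordinates. The three summands of the second factor are the
  contributions of these stages. That factor is positive, so F sends sphere to sphere and ball to
  ball.\<close>

lemma norm_F_map:
  fixes x :: "complex^('m::finite option)"
  assumes a: "norm a < 1" and nz: "1 - cnj a * x $ None \<noteq> 0"
  shows "1 - (norm (F_map a x))\<^sup>2 = (1 - (norm x)\<^sup>2) *
    (1 + (norm (x $ None))\<^sup>2 + (norm (x $ None)) ^ 4 * (1 - (norm a)\<^sup>2) / (norm (1 - cnj a * x $ None))\<^sup>2)"
proof -
  define w where "w = x $ None"
  define Z where "Z = (norm (horiz x))\<^sup>2"
  define W where "W = (norm w)\<^sup>2"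
  define q where "q = (norm (1 - cnj a * w))\<^sup>2"
  define r where "r = (1 - (norm a)\<^sup>2) / q"
  have a2: "1 - (norm a)\<^sup>2 > 0" using a by (simp add: abs_square_less_1)
  have q0: "q > 0" using nz by (simp add: q_def w_def)
  have q: "q = (1 - (norm a)\<^sup>2) * (1 - W) + (norm (w - a))\<^sup>2"
    unfolding q_def cmod_power2 W_def by (simp add: algebra_simps power2_eq_square)
  have Zs: "Z = (\<Sum>j\<in>UNIV. (norm (x $ Some j))\<^sup>2)"
    by (simp add: Z_def norm_vec_sum_squares horiz_def)
  have W2: "(norm w) ^ 4 = W\<^sup>2" by (simp add: W_def)
  have N: "(norm (F_map a x))\<^sup>2 = W\<^sup>2 * ((norm (w - a))\<^sup>2 / q) + (Z + (W * Z + W\<^sup>2 * (r * Z)))"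
    using a2 unfolding norm_vec_sum_squares sum_UNIV_option sum_UNIV_sum Zs q_def r_def W2[symmetric] W_def
    by (simp add: w_def[symmetric] norm_mult norm_divide norm_power power_mult_distrib power_divide
        sum_distrib_left sum_divide_distrib power_mult[symmetric])
  have X: "(norm x)\<^sup>2 = W + Z"
    by (simp add: norm_option_squared w_def Z_def W_def)
  have M: "(norm (w - a))\<^sup>2 / q = 1 - r * (1 - W)"
    using q q0 by (simp add: r_def field_simps)
  have K: "1 + (norm w)\<^sup>2 + (norm w) ^ 4 * (1 - (norm a)\<^sup>2) / q = 1 + W + W\<^sup>2 * r"
    unfolding W2 r_def W_def[symmetric] by simp
  show ?thesis
    unfolding w_def[symmetric] q_def[symmetric] K N X M by (simp add: algebra_simps power2_eq_square)
qed

lemma norm_F_map_iff: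
  fixes x :: "complex^('m::finite option)"
  assumes a: "norm a < 1" and x: "norm x \<le> 1"
  shows "norm (F_map a x) < 1 \<longleftrightarrow> norm x < 1" "norm (F_map a x) \<le> 1"
    "norm (F_map a x) = 1 \<longleftrightarrow> norm x = 1"
proof -
  define k where "k = 1 + (norm (x $ None))\<^sup>2 +
    (norm (x $ None)) ^ 4 * (1 - (norm a)\<^sup>2) / (norm (1 - cnj a * x $ None))\<^sup>2"
  have "1 - (norm a)\<^sup>2 > 0" using a by (simp add: abs_square_less_1)
  then have k: "k > 0" unfolding k_def by (intro add_pos_nonneg) auto
  have eq: "1 - (norm (F_map a x))\<^sup>2 = (1 - (norm x)\<^sup>2) * k"
    using norm_F_map[OF a one_minus_cnj_mult_nth_nonzero[OF a x]] by (simp add: k_def)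
  have sq: "y < 1 \<longleftrightarrow> 1 - y\<^sup>2 > 0" "y \<le> 1 \<longleftrightarrow> 1 - y\<^sup>2 \<ge> 0" if "y \<ge> 0" for y :: real
    using that by (auto simp: abs_square_less_1 abs_square_le_1)
  show "norm (F_map a x) < 1 \<longleftrightarrow> norm x < 1" "norm (F_map a x) \<le> 1"
    using k x by (simp_all only: sq norm_ge_zero eq) (auto simp: zero_less_mult_iff)
  then show "norm (F_map a x) = 1 \<longleftrightarrow> norm x = 1"
    using x by linarith
qed

text \<open>A continuous map between the compact closed balls is proper, and properness passes to
  the open ball because by \<open>norm_F_map_iff\<close> it is the full preimage of the open
  ball.\<close>

lemma proper_holomorphic_ball_map_F_map:
  assumes a: "norm a < 1"
  shows "proper_holomorphic_ball_map (F_map a :: complex^('m::finite option) \<Rightarrow> _)"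
proof -
  let ?F = "F_map a :: complex^('m option) \<Rightarrow> _"
  have sub: "cball 0 1 \<subseteq> {x :: complex^('m option). 1 - cnj a * x $ None \<noteq> 0}"
    using one_minus_cnj_mult_nth_nonzero[OF a, where i = "None :: 'm option"] by auto
  have "holomorphic_map_on ?F (ball 0 1)"
    using holomorphic_map_on_F_map[of a] sub ball_subset_cball unfolding holomorphic_map_on_def by blast
  moreover have "continuous_on (cball 0 1) ?F"
    using holomorphic_map_on_imp_continuous_on[OF holomorphic_map_on_F_map] sub
    by (rule continuous_on_subset)
  then have "continuous_map (top_of_set (cball 0 1)) (top_of_set (cball 0 1)) ?F"
    using norm_F_map_iff(2)[OF a] by auto
  then have "proper_map (top_of_set (cball 0 1)) (top_of_set (cball 0 1)) ?F"
    by (intro continuous_imp_proper_map Hausdorff_imp_kc_space)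
       (auto simp: compact_space_subtopology Hausdorff_space_subtopology compact_imp_compactin_subtopology)
  then have "proper_map (subtopology (top_of_set (cball 0 1)) (ball 0 1))
      (subtopology (top_of_set (cball 0 1)) (ball 0 1)) ?F"
    by (rule proper_map_restriction) (use norm_F_map_iff(1)[OF a, where 'm = 'm] in auto)
  then have "proper_map (top_of_set (ball 0 1)) (top_of_set (ball 0 1)) ?F"
    by (simp add: subtopology_subtopology inf_absorb2 ball_subset_cball)
  ultimately show ?thesis unfolding proper_holomorphic_ball_map_def by blast
qed

text \<open>For fixed w the components are constants or constant multiples of the coordinates of z'.
  At a w with 1 - conj(a) w = 0, division by zero yields 0 on both sides.\<close>

lemma F_map_affine:
  fixes w :: complex
  shows "\<exists>(A :: complex^'m^(('m::finite + ('m + 'm)) option)) b.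
    \<forall>x. x $ None = w \<longrightarrow> F_map a x = A *v horiz x + b"
proof -
  define e :: "('m + ('m + 'm)) option \<Rightarrow> 'm \<Rightarrow> complex" where
    "e i j = (case i of None \<Rightarrow> 0
       | Some (Inl k) \<Rightarrow> if k = j then 1 else 0
       | Some (Inr (Inl k)) \<Rightarrow> if k = j then w else 0
       | Some (Inr (Inr k)) \<Rightarrow> if k = j
           then w\<^sup>2 * of_real (sqrt (1 - (norm a)\<^sup>2)) / (1 - cnj a * w) else 0)" for i j
  have "F_map a x $ i = ((\<chi> i j. e i j) *v horiz x
      + axis None (w\<^sup>2 * ((w - a) / (1 - cnj a * w)))) $ i"
    if "x $ None = w" for x i
    using that
    by (cases i rule: index_cases)
       (auto simp: matrix_vector_mult_def e_def horiz_def axis_def if_distrib[of "\<lambda>c. c * _"] cong: if_cong)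
  then show ?thesis
    by (intro exI[of _ "\<chi> i j. e i j"] exI[of _ "axis None (w\<^sup>2 * ((w - a) / (1 - cnj a * w)))"])
       (simp add: vec_eq_iff)
qed

section \<open>Polynomial maps\<close>

lemma polynomial_fun_add:
  assumes "polynomial_fun p" "polynomial_fun q"
  shows "polynomial_fun (\<lambda>x. p x + q x)"
proof -
  obtain M c where M: "finite M" "\<And>x. p x = (\<Sum>m\<in>M. c m * (\<Prod>i\<in>UNIV. (x $ i) ^ m i))"
    using assms(1) unfolding polynomial_fun_def by blast
  obtain M' c' where M': "finite M'" "\<And>x. q x = (\<Sum>m\<in>M'. c' m * (\<Prod>i\<in>UNIV. (x $ i) ^ m i))"
    using assms(2) unfolding polynomial_fun_def by blast
  let ?d = "\<lambda>m. (if m \<in> M then c m else 0) + (if m \<in> M' then c' m else 0)"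
  have "p x + q x = (\<Sum>m\<in>M \<union> M'. ?d m * (\<Prod>i\<in>UNIV. (x $ i) ^ m i))" for x
    using M(1) M'(1)
    by (simp add: M(2) M'(2) distrib_right sum.distrib if_distrib[of "\<lambda>c. c * _"] sum.If_cases
        Int_absorb1 Int_absorb2 Un_Int_distrib2 cong: if_cong)
  then show ?thesis
    unfolding polynomial_fun_def using M(1) M'(1)
    by (intro exI[of _ "M \<union> M'"] exI[of _ ?d]) auto
qed

lemma polynomial_fun_monomial: "polynomial_fun (\<lambda>x. c * (\<Prod>i\<in>UNIV. (x $ i) ^ m i))"
  unfolding polynomial_fun_def by (intro exI[of _ "{m}"] exI[of _ "\<lambda>_. c"]) simp

lemma prod_UNIV_option:
  "(\<Prod>i\<in>(UNIV :: 'a::finite option set). f i) = f None * (\<Prod>j\<in>UNIV. f (Some j))"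
  by (simp add: UNIV_option_conv prod.reindex)

lemma polynomial_fun_vertical:
  "polynomial_fun (\<lambda>x :: complex^('m::finite option). c * (x $ None) ^ k)"
  using polynomial_fun_monomial[of c "\<lambda>i. if i = None then k else 0 :: nat"]
  by (simp add: prod_UNIV_option)

lemma polynomial_fun_vertical_horizontal:
  "polynomial_fun (\<lambda>x :: complex^('m::finite option). c * (x $ None) ^ k * x $ Some j)"
proof -
  have "(\<Prod>i\<in>UNIV. x $ i ^ (case i of None \<Rightarrow> k | Some l \<Rightarrow> if l = j then 1 else 0))
      = (x $ None) ^ k * x $ Some j" for x :: "complex^('m option)"
    by (simp add: prod_UNIV_option if_distrib[of "\<lambda>n. _ ^ n"] cong: if_cong)
  then show ?thesis
    using polynomial_fun_monomial[of c "\<lambda>i. case i of None \<Rightarrow> k | Some l \<Rightarrow> (if l = j then 1 else 0)"]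
    by (simp add: mult.assoc)
qed

lemma rational_map_on_F_map:
  assumes a: "norm a < 1"
  shows "rational_map_on (F_map a :: complex^('m::finite option) \<Rightarrow> _) (ball 0 1)"
  unfolding rational_map_on_def
proof
  fix i :: "('m + ('m + 'm)) option"
  let ?s = "complex_of_real (sqrt (1 - (norm a)\<^sup>2))"
  let ?F = "F_map a :: complex^('m option) \<Rightarrow> _"
  have one: "polynomial_fun (\<lambda>x :: complex^('m option). 1)"
    using polynomial_fun_vertical[of 1 0] by simp
  have q: "polynomial_fun (\<lambda>x :: complex^('m option). 1 - cnj a * x $ None)"
    using polynomial_fun_add[OF one polynomial_fun_vertical[of "- cnj a" 1]] by simp
  have nz: "1 - cnj a * x $ None \<noteq> 0" if "x \<in> ball 0 1" for x :: "complex^('m option)"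
    using one_minus_cnj_mult_nth_nonzero[OF a, where i = "None :: 'm option"] that by simp
  have quot: "\<exists>p q. polynomial_fun p \<and> polynomial_fun q \<and> (\<forall>x\<in>ball 0 1. q x \<noteq> 0 \<and> ?F x $ i = p x / q x)"
    if "polynomial_fun p" "\<And>x. ?F x $ i = p x / (1 - cnj a * x $ None)" for p
    using that q nz by (intro exI[of _ p] exI[of _ "\<lambda>x. 1 - cnj a * x $ None"]) simp
  have pol: "\<exists>p q. polynomial_fun p \<and> polynomial_fun q \<and> (\<forall>x\<in>ball 0 1. q x \<noteq> 0 \<and> ?F x $ i = p x / q x)"
    if "polynomial_fun p" "\<And>x. ?F x $ i = p x" for p
    using that one by (intro exI[of _ p] exI[of _ "\<lambda>x. 1"]) simp
  show "\<exists>p q. polynomial_fun p \<and> polynomial_fun q \<and>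
      (\<forall>x\<in>ball 0 1. q x \<noteq> 0 \<and> ?F x $ i = p x / q x)"
  proof (cases i rule: index_cases)
    case 1
    show ?thesis
      by (rule quot[OF polynomial_fun_add[OF polynomial_fun_vertical[of 1 3] polynomial_fun_vertical[of "- a" 2]]])
         (simp add: 1 algebra_simps power2_eq_square power3_eq_cube)
  next
    case (2 j)
    show ?thesis
      by (rule pol[OF polynomial_fun_vertical_horizontal[of 1 0 j]]) (simp add: 2)
  next
    case (3 j)
    show ?thesis
      by (rule pol[OF polynomial_fun_vertical_horizontal[of 1 1 j]]) (simp add: 3)
  next
    case (4 j)
    show ?thesis
      by (rule quot[OF polynomial_fun_vertical_horizontal[of ?s 2 j]]) (simp add: 4)
  qed
qed

lemma polynomial_map_F_map_0: "polynomial_map (F_map 0 :: complex^('m::finite option) \<Rightarrow> _)"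
  unfolding polynomial_map_def
proof
  fix i :: "('m + ('m + 'm)) option"
  show "polynomial_fun (\<lambda>x :: complex^('m option). F_map 0 x $ i)"
    using polynomial_fun_vertical[of 1 3, where ?'m = 'm]
      polynomial_fun_vertical_horizontal[of 1 0, where ?'m = 'm]
      polynomial_fun_vertical_horizontal[of 1 1, where ?'m = 'm]
      polynomial_fun_vertical_horizontal[of 1 2, where ?'m = 'm]
    by (cases i rule: index_cases) (auto simp: power3_eq_cube power2_eq_square mult.assoc)
qed

lemma polynomial_fun_line:
  assumes "polynomial_fun q"
  obtains p where "\<And>u. poly p u = q (b + u *s v)"
proof -
  obtain M c where M: "\<And>x. q x = (\<Sum>m\<in>M. c m * (\<Prod>i\<in>UNIV. (x $ i) ^ m i))"
    using assms unfolding polynomial_fun_def by blast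
  show thesis
    by (rule that[of "\<Sum>m\<in>M. smult (c m) (\<Prod>i\<in>UNIV. [:b $ i, v $ i:] ^ m i)"])
       (simp add: M poly_sum poly_prod)
qed

section \<open>Rigidity of the Blaschke disc under polynomial equivalence\<close>

text \<open>The condition \<open>l \<noteq> b * c\<close> says that (b + l B) / (1 + c B) is not
  constant in B. In the parameter u the numerator R and denominator E of this quotient then have no
  common zero, while p E = R forces every zero of E to be one of R. Hence E is a constant
  polynomial.\<close>

lemma blaschke_polynomial_imp_zero:
  fixes a b c l \<gamma> :: complex
  assumes a: "norm a < 1" and ne: "l \<noteq> b * c"
    and eq: "\<And>w. norm w < 1 \<Longrightarrow> 1 + \<gamma> * w \<noteq> 0 \<and>
      1 + c * (w\<^sup>2 * ((w - a) / (1 - cnj a * w))) \<noteq> 0 \<and>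
      poly p (w / (1 + \<gamma> * w)) = (b + l * (w\<^sup>2 * ((w - a) / (1 - cnj a * w)))) /
        (1 + c * (w\<^sup>2 * ((w - a) / (1 - cnj a * w))))"
  shows "a = 0"
proof -
  \<comment> \<open>Homogeneous coordinates on the w-line: for u = w / (1 + \<gamma> w) one has w =
    U / T, and E, R are the denominator and numerator of the quotient after multiplication by T^2 (T
    - conj(a) U).\<close>
  define U T where "U = [:0, 1 :: complex:]" and "T = [:1, - \<gamma>:]"
  define E where "E = smult c (U^2 * (U - smult a T)) + T^2 * (T - smult (cnj a) U)"
  define R where "R = smult l (U^2 * (U - smult a T)) + smult b (T^2 * (T - smult (cnj a) U))"
  have E: "poly E u = c * (u\<^sup>2 * (u - a * (1 - \<gamma> * u))) + (1 - \<gamma> * u)\<^sup>2 * ((1 - \<gamma> * u) - cnj a * u)" for u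
    by (simp add: E_def U_def T_def algebra_simps)
  have R: "poly R u = l * (u\<^sup>2 * (u - a * (1 - \<gamma> * u))) + b * ((1 - \<gamma> * u)\<^sup>2 * ((1 - \<gamma> * u) - cnj a * u))" for u
    by (simp add: R_def U_def T_def algebra_simps)
  have "poly (p * E - R) (w / (1 + \<gamma> * w)) = 0" if w: "norm w < 1" for w
  proof -
    define k where "k = 1 + \<gamma> * w"
    define q where "q = 1 - cnj a * w"
    define B where "B = w\<^sup>2 * ((w - a) / q)"
    have k: "k \<noteq> 0" and d: "1 + c * B \<noteq> 0" and p: "poly p (w / k) = (b + l * B) / (1 + c * B)"
      using eq[OF w] by (auto simp: k_def q_def B_def)
    have q: "q \<noteq> 0" unfolding q_def using one_minus_cnj_mult_nonzero[OF a] w by simp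
    have T: "1 - \<gamma> * (w / k) = 1 / k" using k by (simp add: k_def field_simps)
    have B: "w\<^sup>2 * (w - a) = B * q" using q by (simp add: B_def)
    have 1: "(w / k)\<^sup>2 * (w / k - a * (1 / k)) = B * q / k^3"
      using k by (simp add: B[symmetric] power_divide field_simps power2_eq_square power3_eq_cube)
    have 2: "(1 / k)\<^sup>2 * (1 / k - cnj a * (w / k)) = q / k^3"
      using k by (simp add: q_def power_divide field_simps power2_eq_square power3_eq_cube)
    have "poly E (w / k) = (1 + c * B) * (q / k^3)"
      unfolding E T 1 2 by (simp add: ring_distribs add_divide_distrib)
    moreover have "poly R (w / k) = (b + l * B) * (q / k^3)"
      unfolding R T 1 2 by (simp add: ring_distribs add_divide_distrib)
    ultimately show ?thesis
      unfolding k_def[symmetric] using p d by simp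
  qed
  then have roots: "(\<lambda>w. w / (1 + \<gamma> * w)) ` ball 0 1 \<subseteq> {u. poly (p * E - R) u = 0}"
    by auto
  \<comment> \<open>Injectivity supplies infinitely many zeros of p E - R, turning the identity on
    the disc into one of polynomials.\<close>
  have "inj_on (\<lambda>w. w / (1 + \<gamma> * w)) (ball 0 1)"
  proof (rule inj_onI)
    fix w w' assume "w \<in> ball 0 1" "w' \<in> ball 0 1" and e: "w / (1 + \<gamma> * w) = w' / (1 + \<gamma> * w')"
    then have "1 + \<gamma> * w \<noteq> 0" "1 + \<gamma> * w' \<noteq> 0" using eq by auto
    then have "w * (1 + \<gamma> * w') = w' * (1 + \<gamma> * w)" using e by (simp add: frac_eq_eq)
    then show "w = w'" by (simp add: algebra_simps)
  qed
  moreover have "infinite (ball (0::complex) 1)"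
    using finite_imp_not_open[of "ball (0::complex) 1"] by force
  ultimately have "infinite {u. poly (p * E - R) u = 0}"
    using roots finite_subset finite_imageD by blast
  then have pER: "p * E = R" using poly_roots_finite[of "p * E - R"] by auto
  have noroot: "poly E u \<noteq> 0" for u
  proof
    assume e: "poly E u = 0"
    then have r: "poly R u = 0" using pER by (metis mult_zero_right poly_mult)
    \<comment> \<open>Numerator and denominator of B in the parameter u. The 2 x 2 system E = R = 0
      in X, Y has determinant b c - l up to sign, so both vanish, which |a| < 1 excludes.\<close>
    define X Y where "X = u\<^sup>2 * (u - a * (1 - \<gamma> * u))"
      and "Y = (1 - \<gamma> * u)\<^sup>2 * ((1 - \<gamma> * u) - cnj a * u)"
    have XY: "c * X + Y = 0" "l * X + b * Y = 0"
      using e r unfolding E R X_def Y_def by auto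
    then have "Y = - (c * X)" by (simp add: add_eq_0_iff)
    with XY(2) have "(l - b * c) * X = 0" by (simp add: algebra_simps)
    then have X: "X = 0" using ne by simp
    with XY have Y: "Y = 0" by simp
    from X consider "u = 0" | "u = a * (1 - \<gamma> * u)" by (auto simp: X_def)
    then show False
    proof cases
      case 1 with Y show False by (simp add: Y_def)
    next
      case 2
      have "1 - cnj a * a \<noteq> 0" using one_minus_cnj_mult_nonzero[OF a] a by simp
      moreover have "Y = (1 - \<gamma> * u)\<^sup>2 * ((1 - \<gamma> * u) * (1 - cnj a * a))"
        unfolding Y_def by (subst (3) 2) (simp add: algebra_simps)
      ultimately have "1 - \<gamma> * u = 0" using Y by simp
      then show False using 2 by simp
    qed
  qed
  then have "constant (poly E)" using Fundamental_Theorem_Algebra.fundamental_theorem_of_algebra[of E] by blast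
  then have "poly E u = poly E 0" for u unfolding constant_def by blast
  then have E1: "poly E u = 1" for u by (simp add: E)
  \<comment> \<open>The coefficients of E - 1, the value 1 being E(0).\<close>
  have "poly [:0, - 3 * \<gamma> - cnj a, 3 * \<gamma>\<^sup>2 + 2 * \<gamma> * cnj a - a * c,
      c * (1 + a * \<gamma>) - \<gamma> ^ 3 - \<gamma>\<^sup>2 * cnj a:] u = 0" for u
    using E1[of u] by (simp add: E algebra_simps power2_eq_square power3_eq_cube)
  then have "[:0, - 3 * \<gamma> - cnj a, 3 * \<gamma>\<^sup>2 + 2 * \<gamma> * cnj a - a * c,
      c * (1 + a * \<gamma>) - \<gamma> ^ 3 - \<gamma>\<^sup>2 * cnj a:] = 0"
    using poly_all_0_iff_0 by blast
  then have c1: "cnj a = - 3 * \<gamma>" and c2: "a * c = 3 * \<gamma>\<^sup>2 + 2 * \<gamma> * cnj a"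
    and c3: "c * (1 + a * \<gamma>) = \<gamma> ^ 3 + \<gamma>\<^sup>2 * cnj a"
    by (auto simp: algebra_simps)
  have c2': "a * c = - 3 * \<gamma>\<^sup>2" using c2 by (simp add: c1 power2_eq_square)
  have "a * (c * (1 + a * \<gamma>)) = - 2 * a * \<gamma> ^ 3"
    unfolding c3 c1 by (simp add: power2_eq_square power3_eq_cube)
  moreover have "a * (c * (1 + a * \<gamma>)) = - 3 * \<gamma>\<^sup>2 * (1 + a * \<gamma>)"
    using c2' by (simp add: mult.assoc[symmetric])
  ultimately have "\<gamma>\<^sup>2 * (3 + a * \<gamma>) = 0"
    by (simp add: algebra_simps power2_eq_square power3_eq_cube)
  moreover have "3 + a * \<gamma> \<noteq> 0"
  proof
    assume "3 + a * \<gamma> = 0"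
    \<comment> \<open>Since conj(a) = -3 \<gamma>, the equation a \<gamma> = -3 is a conj(a) =
      9.\<close>
    then have "9 = a * (- 3 * \<gamma>)" by algebra
    then have "of_real 9 = complex_of_real ((norm a)\<^sup>2)"
      unfolding c1[symmetric] complex_norm_square by simp
    then have "(norm a)\<^sup>2 = 9" by (metis of_real_eq_iff)
    with a show False using abs_square_less_1[of "norm a"] by simp
  qed
  ultimately have "\<gamma> = 0" by simp
  with c1 show "a = 0" by simp
qed

text \<open>Moving \<tau> to the other side gives P o \<sigma> = \<tau>' o F. On the disc w e the
  left-hand side is P along a complex line and the right-hand side is \<tau>' along the disc B(w)
  e', so one component has the shape treated by \<open>blaschke_polynomial_imp_zero\<close>.\<close>

theorem ball_equivalent_polynomial_imp_zero:
  fixes P :: "complex^('m::finite option) \<Rightarrow> complex^(('m + ('m + 'm)) option)"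
  assumes a: "norm a < 1" and P: "polynomial_map P" "proper_holomorphic_ball_map P"
    and equiv: "ball_equivalent (F_map a) P"
  shows "a = 0"
proof -
  obtain \<sigma> \<tau> where \<sigma>: "holomorphic_automorphism (ball 0 1) \<sigma>"
    and \<tau>: "holomorphic_automorphism (ball 0 1) \<tau>"
    and F: "\<And>x. x \<in> ball 0 1 \<Longrightarrow> F_map a x = \<tau> (P (\<sigma> x))"
    using equiv unfolding ball_equivalent_def by blast
  obtain \<sigma>' where b\<sigma>: "biholomorphism (ball 0 1) (ball 0 1) \<sigma> \<sigma>'"
    using holomorphic_automorphism_imp_biholomorphism[OF \<sigma>] by blast
  obtain \<tau>' where b\<tau>: "biholomorphism (ball 0 1) (ball 0 1) \<tau>' \<tau>"
    using holomorphic_automorphism_imp_biholomorphism[OF \<tau>] biholomorphism_sym by blast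
  have P_ball: "P y \<in> ball 0 1" if "y \<in> ball 0 1" for y
    using proper_map_imp_subset_topspace[of "top_of_set (ball 0 1)" "top_of_set (ball 0 1)" P] P(2) that
    unfolding proper_holomorphic_ball_map_def by auto
  have F': "\<tau>' (F_map a x) = P (\<sigma> x)" if "x \<in> ball 0 1" for x
  proof -
    have "P (\<sigma> x) \<in> ball 0 1"
      using P_ball[of "\<sigma> x"] b\<sigma> that unfolding biholomorphism_def by blast
    with F[OF that] b\<tau> show ?thesis unfolding biholomorphism_def by simp
  qed
  obtain L b c where \<sigma>eq: "\<And>x. norm x \<le> 1 \<Longrightarrow> 1 - hinner x c \<noteq> 0"
    "\<And>x. x \<in> ball 0 1 \<Longrightarrow> \<sigma> x = (1 / (1 - hinner x c)) *s (b + L *v x)"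
    using ball_automorphism_fractional_linear[OF b\<sigma>] by metis
  obtain L' b' c' where \<tau>eq: "\<And>x. norm x \<le> 1 \<Longrightarrow> 1 - hinner x c' \<noteq> 0"
    "\<And>x. x \<in> ball 0 1 \<Longrightarrow> \<tau>' x = (1 / (1 - hinner x c')) *s (b' + L' *v x)"
    using ball_automorphism_fractional_linear[OF b\<tau>] by metis
  define e :: "complex^('m option)" where "e = axis None 1"
  define e' :: "complex^(('m + ('m + 'm)) option)" where "e' = axis None 1"
  define \<gamma> where "\<gamma> = - hinner e c"
  \<comment> \<open>From (b + w L e) / (1 + \<gamma> w) = b + (w / (1 + \<gamma> w)) (L e - \<gamma>
    b): the image disc lies on the line through b with direction v.\<close>
  define v where "v = L *v e - \<gamma> *s b"
  define g where "g = - hinner e' c'"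
  define h where "h = L' *v e'"
  define B where "B w = w\<^sup>2 * ((w - a) / (1 - cnj a * w))" for w
  have ne: "norm e = 1" "norm e' = 1"
    by (auto simp: e_def e'_def norm_axis_1)
  have Fe: "F_map a (w *s e) = B w *s e'" for w
  proof -
    have "F_map a (w *s e) $ i = (B w *s e') $ i" for i
      by (cases i rule: index_cases) (auto simp: e_def e'_def axis_def B_def)
    then show ?thesis by (simp add: vec_eq_iff)
  qed
  have \<sigma>e: "\<sigma> (w *s e) = b + (w / (1 + \<gamma> * w)) *s v \<and> 1 + \<gamma> * w \<noteq> 0" if w: "norm w < 1" for w
  proof -
    have nz: "1 + \<gamma> * w \<noteq> 0"
      using \<sigma>eq(1)[of "w *s e"] w ne by (simp add: \<gamma>_def mult.commute)
    have "\<sigma> (w *s e) = (1 / (1 + \<gamma> * w)) *s (b + w *s (L *v e))"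
      using \<sigma>eq(2)[of "w *s e"] w ne by (simp add: \<gamma>_def mult.commute vector_scalar_commute)
    also have "\<dots> = b + (w / (1 + \<gamma> * w)) *s v"
      using nz by (simp add: v_def vec_eq_iff field_simps)
    finally show ?thesis using nz by simp
  qed
  have \<tau>e: "\<tau>' (\<zeta> *s e') = (1 / (1 + g * \<zeta>)) *s (b' + \<zeta> *s h) \<and> 1 + g * \<zeta> \<noteq> 0"
    if z: "norm \<zeta> < 1" for \<zeta>
    using \<tau>eq(1)[of "\<zeta> *s e'"] \<tau>eq(2)[of "\<zeta> *s e'"] z ne
    by (simp add: g_def h_def mult.commute vector_scalar_commute)
  \<comment> \<open>If every component were constant along e', then \<tau>' would be constant on
    that disc, against its injectivity.\<close>
  have "\<exists>k. h $ k \<noteq> b' $ k * g"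
  proof (rule ccontr)
    assume "\<not> ?thesis"
    then have h: "h = g *s b'" by (simp add: vec_eq_iff mult.commute)
    have "\<tau>' (\<zeta> *s e') = b'" if "norm \<zeta> < 1" for \<zeta>
    proof -
      have "b' + \<zeta> *s h = (1 + g * \<zeta>) *s b'" by (simp add: h vec_eq_iff algebra_simps)
      with \<tau>e[OF that] have "\<tau>' (\<zeta> *s e') = (1 / (1 + g * \<zeta>)) *s ((1 + g * \<zeta>) *s b')"
        by argo
      also have "\<dots> = b'"
        using \<tau>e[OF that] by (simp only: vector_smult_assoc) simp
      finally show ?thesis .
    qed
    from this[of 0] this[of "1/2"] have "\<tau>' (0 *s e') = \<tau>' ((1/2) *s e')" by (simp add: norm_divide)
    moreover have "0 *s e' \<in> ball 0 1" "(1/2) *s e' \<in> ball 0 1"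
      using ne by (auto simp: norm_divide)
    ultimately have "0 *s e' = (1/2) *s e'"
      using b\<tau> unfolding biholomorphism_def by metis
    with ne show False by (auto simp: e'_def axis_def vec_eq_iff split: if_splits)
  qed
  then obtain k where k: "h $ k \<noteq> b' $ k * g" by blast
  obtain p where p: "\<And>u. poly p u = P (b + u *s v) $ k"
    using polynomial_fun_line[of "\<lambda>x. P x $ k" b v] P(1) unfolding polynomial_map_def by metis
  show "a = 0"
  proof (rule blaschke_polynomial_imp_zero[OF a k, of \<gamma> p], fold B_def)
    fix w :: complex assume w: "norm w < 1"
    have we: "w *s e \<in> ball 0 1" using w ne by simp
    have "F_map a (w *s e) \<in> ball 0 1"
      using norm_F_map_iff(1)[OF a, of "w *s e"] we by simp
    then have Bw: "norm (B w) < 1" using Fe ne by simp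
    have "poly p (w / (1 + \<gamma> * w)) = \<tau>' (F_map a (w *s e)) $ k"
      using p \<sigma>e[OF w] F'[OF we] by simp
    also have "\<dots> = (b' $ k + h $ k * B w) / (1 + g * B w)"
      using \<tau>e[OF Bw] by (simp add: Fe mult.commute add_divide_distrib)
    finally show "1 + \<gamma> * w \<noteq> 0 \<and> 1 + g * B w \<noteq> 0 \<and>
        poly p (w / (1 + \<gamma> * w)) = (b' $ k + h $ k * B w) / (1 + g * B w)"
      using \<sigma>e[OF w] \<tau>e[OF Bw] by simp
  qed
qed

section \<open>The Siegel half space\<close>

lemma continuous_horiz [continuous_intros]: "continuous_on S (horiz :: complex^('m::finite option) \<Rightarrow> _)"
  unfolding horiz_def by (intro continuous_intros)

lemma horiz_nth [simp]: "horiz x $ j = x $ Some j"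
  by (simp add: horiz_def)

lemma siegel_Re_pos:
  fixes x :: "complex^('m::finite option)"
  assumes "Im (x $ None) \<ge> (norm (horiz x))\<^sup>2"
  shows "1 - \<i> * x $ None \<noteq> 0"
proof
  assume "1 - \<i> * x $ None = 0"
  then have "Re (1 - \<i> * x $ None) = 0" by simp
  then have "1 + Im (x $ None) = 0" by simp
  with assms show False using zero_le_power2[of "norm (horiz x)"] by linarith
qed

lemma open_siegel: "open (siegel :: (complex^('m::finite option)) set)"
  unfolding siegel_def by (intro open_Collect_less continuous_intros)

text \<open>Moving in this direction enters the half space from each point of its closure;
  identities at boundary points are obtained as one-sided limits along it.\<close>

definition vertical :: "complex^('m::finite option)" where
  "vertical = axis None \<i>"

lemma vertical_shift:
  assumes "Im (x $ None) \<ge> (norm (horiz x))\<^sup>2" "t > 0"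
  shows "x + t *\<^sub>R vertical \<in> siegel"
proof -
  have "horiz (x + t *\<^sub>R vertical) = horiz x"
    by (simp add: horiz_def vertical_def axis_def vec_eq_iff)
  moreover have "Im ((x + t *\<^sub>R vertical) $ None) = Im (x $ None) + t"
    by (simp add: vertical_def)
  ultimately show ?thesis using assms by (simp add: siegel_def)
qed

lemma vertical_shift_tendsto: "((\<lambda>t. x + t *\<^sub>R vertical) \<longlongrightarrow> x) (at_right 0)"
  by (auto intro!: tendsto_eq_intros)

lemma frontier_siegel:
  "frontier (siegel :: (complex^('m::finite option)) set) = {x. Im (x $ None) = (norm (horiz x))\<^sup>2}"
proof
  have "closed {x :: complex^('m option). Im (x $ None) \<ge> (norm (horiz x))\<^sup>2}"
    by (intro closed_Collect_le continuous_intros)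
  then have "closure siegel \<subseteq> {x :: complex^('m option). Im (x $ None) \<ge> (norm (horiz x))\<^sup>2}"
    by (intro closure_minimal) (auto simp: siegel_def)
  then show "frontier siegel \<subseteq> {x :: complex^('m option). Im (x $ None) = (norm (horiz x))\<^sup>2}"
    using interior_open[OF open_siegel] by (fastforce simp: frontier_def siegel_def)
next
  show "{x. Im (x $ None) = (norm (horiz x))\<^sup>2} \<subseteq> frontier (siegel :: (complex^('m option)) set)"
  proof
    fix x :: "complex^('m option)" assume "x \<in> {x. Im (x $ None) = (norm (horiz x))\<^sup>2}"
    then have x: "Im (x $ None) = (norm (horiz x))\<^sup>2" by simp
    have "\<forall>\<^sub>F t in at_right 0. x + t *\<^sub>R vertical \<in> closure siegel"
      using vertical_shift[of x] x closure_subset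
      by (auto simp: eventually_at_right_field intro!: exI[of _ 1] subsetD[OF closure_subset])
    then have "x \<in> closure siegel"
      using Lim_in_closed_set[OF closed_closure _ _ vertical_shift_tendsto] by auto
    moreover have "x \<notin> interior siegel"
      using x by (simp only: interior_open[OF open_siegel]) (simp add: siegel_def)
    ultimately show "x \<in> frontier siegel" by (simp add: frontier_def)
  qed
qed

lemma cayley_nth [simp]:
  "cayley x $ None = (1 + \<i> * x $ None) / (1 - \<i> * x $ None)"
  "cayley x $ Some j = 2 * x $ Some j / (1 - \<i> * x $ None)"
  by (simp_all add: cayley_def)

lemma cayley_inv_nth [simp]:
  "cayley_inv y $ None = \<i> * (1 - y $ None) / (1 + y $ None)"
  "cayley_inv y $ Some j = y $ Some j / (1 + y $ None)"
  by (simp_all add: cayley_inv_def)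

lemma holomorphic_map_on_cayley:
  "holomorphic_map_on (cayley :: complex^('m::finite option) \<Rightarrow> _) {x. 1 - \<i> * x $ None \<noteq> 0}"
proof (rule holomorphic_map_onI)
  fix x :: "complex^('m option)" and j assume "x \<in> {x. 1 - \<i> * x $ None \<noteq> 0}"
  then show "complex_diff_at (\<lambda>x. cayley x $ j) x"
    by (cases j) (auto intro!: complex_diff_intros)
qed

lemma holomorphic_map_on_cayley_inv:
  "holomorphic_map_on (cayley_inv :: complex^('m::finite option) \<Rightarrow> _) {y. 1 + y $ None \<noteq> 0}"
proof (rule holomorphic_map_onI)
  fix x :: "complex^('m option)" and j assume "x \<in> {y. 1 + y $ None \<noteq> 0}"
  then show "complex_diff_at (\<lambda>x. cayley_inv x $ j) x"
    by (cases j) (auto intro!: complex_diff_intros)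
qed

lemma norm_cayley:
  fixes x :: "complex^('m::finite option)"
  assumes nz: "1 - \<i> * x $ None \<noteq> 0"
  shows "1 - (norm (cayley x))\<^sup>2 =
    4 * (Im (x $ None) - (norm (horiz x))\<^sup>2) / (norm (1 - \<i> * x $ None))\<^sup>2"
proof -
  define q where "q = (norm (1 - \<i> * x $ None))\<^sup>2"
  have q: "q > 0" using nz by (simp add: q_def)
  have "(norm (cayley x))\<^sup>2 = (norm (1 + \<i> * x $ None))\<^sup>2 / q + 4 * (norm (horiz x))\<^sup>2 / q"
    unfolding norm_vec_sum_squares sum_UNIV_option q_def
    by (simp add: norm_divide norm_mult power_divide power_mult_distrib sum_distrib_left sum_divide_distrib)
  moreover have "q - (norm (1 + \<i> * x $ None))\<^sup>2 = 4 * Im (x $ None)"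
    unfolding q_def cmod_power2 by (simp add: algebra_simps power2_eq_square)
  ultimately have "(1 - (norm (cayley x))\<^sup>2) * q = 4 * (Im (x $ None) - (norm (horiz x))\<^sup>2)"
    using q by (simp add: field_simps)
  then show ?thesis using q unfolding q_def[symmetric] by (simp add: field_simps)
qed

lemma one_plus_nth_nonzero:
  fixes y :: "complex^'n::finite"
  assumes "y \<in> ball 0 1"
  shows "1 + y $ i \<noteq> 0"
proof
  assume "1 + y $ i = 0"
  then have "norm (y $ i) = 1" by (metis add_eq_0_iff norm_minus_cancel norm_one)
  with Finite_Cartesian_Product.norm_nth_le[of y i] assms show False by simp
qed

lemma one_minus_i_cayley_inv:
  assumes "1 + y $ None \<noteq> 0"
  shows "1 - \<i> * cayley_inv y $ None = 2 / (1 + y $ None)"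
  using assms by (simp add: field_simps)

lemma cayley_inv_height:
  fixes y :: "complex^('m::finite option)"
  assumes nz: "1 + y $ None \<noteq> 0"
  shows "norm y < 1 \<Longrightarrow> cayley_inv y \<in> siegel"
    and "norm y = 1 \<Longrightarrow> Im (cayley_inv y $ None) = (norm (horiz (cayley_inv y)))\<^sup>2"
proof -
  have nz': "1 - \<i> * cayley_inv y $ None \<noteq> 0"
    using one_minus_i_cayley_inv[OF nz] nz by simp
  have "cayley (cayley_inv y) = y"
    by (rule cayley_cayley_inv) (use nz in \<open>auto simp: add_eq_0_iff\<close>)
  then have eq: "1 - (norm y)\<^sup>2 = 4 * (Im (cayley_inv y $ None) - (norm (horiz (cayley_inv y)))\<^sup>2) /
      (norm (1 - \<i> * cayley_inv y $ None))\<^sup>2"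
    using norm_cayley[OF nz'] by simp
  have pos: "(norm (1 - \<i> * cayley_inv y $ None))\<^sup>2 > 0" using nz' by simp
  show "cayley_inv y \<in> siegel" if "norm y < 1"
  proof -
    have "1 - (norm y)\<^sup>2 > 0" using that by (simp add: abs_square_less_1)
    then show ?thesis using pos unfolding eq by (simp add: zero_less_divide_iff siegel_def)
  qed
  show "Im (cayley_inv y $ None) = (norm (horiz (cayley_inv y)))\<^sup>2" if "norm y = 1"
  proof -
    have "1 - (norm y)\<^sup>2 = 0" using that by simp
    then show ?thesis using pos unfolding eq by auto
  qed
qed

lemma cayley_norm_eq:
  fixes x :: "complex^('m::finite option)"
  shows "Im (x $ None) > (norm (horiz x))\<^sup>2 \<Longrightarrow> norm (cayley x) < 1"
    and "Im (x $ None) = (norm (horiz x))\<^sup>2 \<Longrightarrow> norm (cayley x) = 1"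
proof -
  show "norm (cayley x) < 1" if h: "Im (x $ None) > (norm (horiz x))\<^sup>2"
  proof -
    have "1 - (norm (cayley x))\<^sup>2 > 0"
      using norm_cayley[OF siegel_Re_pos[of x]] siegel_Re_pos[of x] h by simp
    then show ?thesis by (simp add: abs_square_less_1)
  qed
  show "norm (cayley x) = 1" if h: "Im (x $ None) = (norm (horiz x))\<^sup>2"
  proof -
    have "1 - (norm (cayley x))\<^sup>2 = 0"
      using norm_cayley[OF siegel_Re_pos[of x]] h by simp
    then show ?thesis using power2_eq_1_iff[of "norm (cayley x)"] norm_ge_zero[of "cayley x"] by linarith
  qed
qed

lemma biholomorphism_cayley:
  "biholomorphism siegel (ball 0 1) (cayley :: complex^('m::finite option) \<Rightarrow> _) cayley_inv"
proof -
  have s: "1 - \<i> * x $ None \<noteq> 0" if "x \<in> siegel" for x :: "complex^('m option)"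
    using that siegel_Re_pos[of x] by (simp add: siegel_def)
  have b: "1 + y $ None \<noteq> 0" if "y \<in> ball 0 1" for y :: "complex^('m option)"
    using one_plus_nth_nonzero[OF that] .
  have "holomorphic_map_on (cayley :: complex^('m option) \<Rightarrow> _) siegel"
    using holomorphic_map_on_cayley s unfolding holomorphic_map_on_def by blast
  moreover have "holomorphic_map_on (cayley_inv :: complex^('m option) \<Rightarrow> _) (ball 0 1)"
    using holomorphic_map_on_cayley_inv b unfolding holomorphic_map_on_def by blast
  moreover have "cayley_inv (cayley x) = x" if "x \<in> siegel" for x :: "complex^('m option)"
    using cayley_inv_cayley[OF s[OF that]] .
  moreover have "cayley (cayley_inv y) = y" if "y \<in> ball 0 1" for y :: "complex^('m option)"
    by (rule cayley_cayley_inv) (use b[OF that] in \<open>auto simp: add_eq_0_iff\<close>)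
  moreover have "cayley x \<in> ball 0 1" if "x \<in> siegel" for x :: "complex^('m option)"
    using cayley_norm_eq(1)[of x] that by (simp add: siegel_def)
  moreover have "cayley_inv y \<in> siegel" if "y \<in> ball 0 1" for y :: "complex^('m option)"
    using cayley_inv_height(1)[OF b[OF that]] that by simp
  ultimately show ?thesis unfolding biholomorphism_def by blast
qed

lemma holomorphic_map_on_imp_isCont: "holomorphic_map_on f S \<Longrightarrow> x \<in> S \<Longrightarrow> isCont f x"
  unfolding holomorphic_map_on_def using has_derivative_continuous by blast

text \<open>Conjugation by the Cayley transformation reduces this to the ball. The denominators are
  cleared because the combined denominator may vanish at a boundary point; in product form both
  identities extend from the half space to the points of its closure in \<open>U\<close> by
  continuity alone.\<close>

lemma siegel_automorphism_fractional_linear: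
  fixes \<tau> :: "complex^('m::finite option) \<Rightarrow> complex^('m option)"
  assumes aut: "holomorphic_automorphism siegel \<tau>" and hol: "holomorphic_map_on \<tau> U"
  obtains L :: "complex^('m option)^('m option)" and b c
  where "\<And>y. norm y \<le> 1 \<Longrightarrow> 1 - hinner y c \<noteq> 0"
    and "\<And>q k. q \<in> U \<Longrightarrow> Im (q $ None) \<ge> (norm (horiz q))\<^sup>2 \<Longrightarrow>
      (1 - hinner (cayley q) c + (b + L *v cayley q) $ None) * \<tau> q $ Some k = (b + L *v cayley q) $ Some k"
    and "\<And>q. q \<in> U \<Longrightarrow> Im (q $ None) \<ge> (norm (horiz q))\<^sup>2 \<Longrightarrow>
      (1 - hinner (cayley q) c + (b + L *v cayley q) $ None) * \<tau> q $ None
        = \<i> * (1 - hinner (cayley q) c - (b + L *v cayley q) $ None)"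
proof -
  obtain \<tau>' where b\<tau>: "biholomorphism siegel siegel \<tau> \<tau>'"
    using holomorphic_automorphism_imp_biholomorphism[OF aut] by blast
  have "biholomorphism (ball 0 1) (ball 0 1) (\<lambda>y. cayley (\<tau> (cayley_inv y))) (\<lambda>y. cayley (\<tau>' (cayley_inv y)))"
    using biholomorphism_compose[OF biholomorphism_compose[OF biholomorphism_sym[OF biholomorphism_cayley] b\<tau>]
        biholomorphism_cayley] .
  then obtain L :: "complex^('m option)^('m option)" and b c
    where nz: "\<And>y. norm y \<le> 1 \<Longrightarrow> 1 - hinner y c \<noteq> 0"
      and eq: "\<And>y. y \<in> ball 0 1 \<Longrightarrow>
        cayley (\<tau> (cayley_inv y)) = (1 / (1 - hinner y c)) *s (b + L *v y)"
    using ball_automorphism_fractional_linear by metis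
  define E where "E q = 1 - hinner (cayley q) c" for q
  define N where "N i q = (b + L *v cayley q) $ i" for i q
  have S: "(E q + N None q) * \<tau> q $ Some k = N (Some k) q \<and>
      (E q + N None q) * \<tau> q $ None = \<i> * (E q - N None q)" if q: "q \<in> siegel" for q k
  proof -
    have y: "cayley q \<in> ball 0 1" "cayley_inv (cayley q) = q"
      using q biholomorphism_cayley unfolding biholomorphism_def by auto
    have e: "E q \<noteq> 0" unfolding E_def using nz y(1) by simp
    have t: "\<tau> q \<in> siegel" using b\<tau> q unfolding biholomorphism_def by auto
    have c: "cayley (\<tau> q) = (1 / E q) *s (b + L *v cayley q)"
      using eq[OF y(1)] y(2) by (simp add: E_def)
    have "cayley (\<tau> q) \<in> ball 0 1"
      using t biholomorphism_cayley unfolding biholomorphism_def by auto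
    from one_plus_nth_nonzero[OF this, of None] have d: "1 + N None q / E q \<noteq> 0"
      unfolding c by (simp add: N_def add_divide_distrib)
    define y where "y = (1 / E q) *s (b + L *v cayley q)"
    have yi: "y $ i = N i q / E q" for i
      unfolding y_def N_def vector_smult_component by simp
    have "\<tau> q = cayley_inv y"
      using t biholomorphism_cayley unfolding y_def c[symmetric] biholomorphism_def by auto
    then have "\<tau> q $ Some k = (N (Some k) q / E q) / (1 + N None q / E q)"
      "\<tau> q $ None = \<i> * (1 - N None q / E q) / (1 + N None q / E q)"
      by (simp_all only: cayley_inv_nth yi)
    moreover have "1 + N None q / E q = (E q + N None q) / E q" "1 - N None q / E q = (E q - N None q) / E q"
      using e by (simp_all add: field_simps)
    moreover have "E q + N None q \<noteq> 0" using d e by (auto simp: field_simps)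
    ultimately show ?thesis using e by simp
  qed
  \<comment> \<open>Passage to the boundary: two functions that agree on the half space and are
    continuous at q agree at q, by approach along \<open>vertical\<close>.\<close>
  have T: "f q = g q"
    if q: "q \<in> U" "Im (q $ None) \<ge> (norm (horiz q))\<^sup>2" and "isCont f q" "isCont g q"
      and fg: "\<And>x. x \<in> siegel \<Longrightarrow> f x = g x" for f g :: "complex^('m option) \<Rightarrow> complex" and q
  proof -
    have lim: "((\<lambda>t. h (q + t *\<^sub>R vertical)) \<longlongrightarrow> h q) (at_right 0)"
      if "isCont h q" for h :: "complex^('m option) \<Rightarrow> complex"
      by (rule isCont_tendsto_compose[OF that vertical_shift_tendsto])
    have "\<forall>\<^sub>F t in at_right 0. f (q + t *\<^sub>R vertical) = g (q + t *\<^sub>R vertical)"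
      using vertical_shift[OF q(2)] fg by (auto simp: eventually_at_right_field intro: exI[of _ 1])
    then have "((\<lambda>t. g (q + t *\<^sub>R vertical)) \<longlongrightarrow> f q) (at_right 0)"
      by (rule Lim_transform_eventually[OF lim[OF \<open>isCont f q\<close>]])
    then show ?thesis
      using tendsto_unique[OF trivial_limit_at_right_real _ lim[OF \<open>isCont g q\<close>]] by blast
  qed
  have c1: "isCont cayley q" if "Im (q $ None) \<ge> (norm (horiz q))\<^sup>2" for q :: "complex^('m option)"
    using holomorphic_map_on_imp_isCont[OF holomorphic_map_on_cayley] siegel_Re_pos[OF that] by simp
  have cN: "isCont (N i) q" if "Im (q $ None) \<ge> (norm (horiz q))\<^sup>2" for i q
    using c1[OF that] unfolding N_def matrix_vector_mult_def by (auto intro!: continuous_intros)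
  have cE: "isCont E q" if "Im (q $ None) \<ge> (norm (horiz q))\<^sup>2" for q
    using c1[OF that] unfolding E_def hinner_def by (auto intro!: continuous_intros)
  have c\<tau>: "isCont (\<lambda>q. \<tau> q $ i) q" if "q \<in> U" for i q
    using holomorphic_map_on_imp_isCont[OF hol that] by (intro continuous_intros)
  show thesis
  proof (rule that[of c b L, folded E_def N_def])
    show "1 - hinner y c \<noteq> 0" if "norm y \<le> 1" for y using nz[OF that] .
    fix q assume q: "q \<in> U" "Im (q $ None) \<ge> (norm (horiz q))\<^sup>2"
    show "(E q + N None q) * \<tau> q $ Some k = N (Some k) q" for k
      by (rule T[OF q]) (use S q cN cE c\<tau> in \<open>auto intro!: continuous_intros\<close>)
    show "(E q + N None q) * \<tau> q $ None = \<i> * (E q - N None q)"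
      by (rule T[OF q]) (use S q cN cE c\<tau> in \<open>auto intro!: continuous_intros\<close>)
  qed
qed

section \<open>Positive semidefinite Hermitian forms\<close>

text \<open>A nonzero linear term of the right sign beats the quadratic one near 0. The test value
  -k / (t + 1) makes the expression a negative square and stays defined for t = 0.\<close>

lemma real_linear_dominates_quadratic:
  fixes k t :: real
  assumes "t \<ge> 0" "\<And>\<epsilon>. \<epsilon> * k + \<epsilon>\<^sup>2 * t \<ge> 0"
  shows "k = 0"
proof -
  define e where "e = - k / (t + 1)"
  have k: "k = - e * (t + 1)" using assms(1) by (simp add: e_def)
  have "e * k + e\<^sup>2 * t = - (e\<^sup>2)"
    unfolding k by (simp add: algebra_simps power2_eq_square)
  with assms(2)[of e] have "e = 0" by simp
  then show ?thesis by (simp add: k)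
qed

text \<open>Perturb v by s u with u = v A. Nonnegativity for all real s gives Re B + |u|^2 = 0, and
  reality of the form at s = \<i> gives Re B - |u|^2 = 0; together u = 0.\<close>

lemma psd_form_kernel:
  fixes A :: "complex^'m::finite^'m"
  assumes psd: "\<And>z. \<exists>t\<ge>0. hinner (z v* A) z = of_real t" and v: "hinner (v v* A) v = 0"
  shows "v v* A = 0"
proof -
  define u where "u = v v* A"
  define B where "B = hinner (u v* A) v"
  obtain t where t: "t \<ge> 0" "hinner (u v* A) u = of_real t" using psd by blast
  have u: "hinner (v v* A) u = of_real ((norm u)\<^sup>2)" by (simp add: u_def hinner_self)
  have expand: "hinner ((v + s *s u) v* A) (v + s *s u) =
      s * B + cnj s * of_real ((norm u)\<^sup>2) + s * cnj s * of_real t" for s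
    by (simp add: vector_matrix_left_distrib scalar_vector_matrix_assoc hinner_add_left hinner_add_right v u t B_def
        algebra_simps del: of_real_power)
  have pos: "Im (s * B + cnj s * of_real ((norm u)\<^sup>2) + s * cnj s * of_real t) = 0"
    "Re (s * B + cnj s * of_real ((norm u)\<^sup>2) + s * cnj s * of_real t) \<ge> 0" for s
    using psd[of "v + s *s u"] unfolding expand
    by (metis Im_complex_of_real, metis Re_complex_of_real)
  have "\<epsilon> * (Re B + (norm u)\<^sup>2) + \<epsilon>\<^sup>2 * t \<ge> 0" for \<epsilon>
    using pos(2)[of "of_real \<epsilon>"] by (simp add: algebra_simps power2_eq_square)
  then have "Re B + (norm u)\<^sup>2 = 0"
    by (rule real_linear_dominates_quadratic[OF t(1)])
  moreover have "Re B - (norm u)\<^sup>2 = 0"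
    using pos(1)[of \<i>] by simp
  ultimately show ?thesis by (simp add: u_def)
qed

text \<open>Subtracting from each basis vector its projection onto u lands in the kernel, so every
  row of A is a multiple of u A.\<close>

lemma rank_le_1_of_kernel:
  fixes A :: "complex^'m::finite^'m"
  assumes ker: "\<And>v. hinner v u = 0 \<Longrightarrow> v v* A = 0"
  shows "rank A \<le> 1"
proof -
  have "rows A \<subseteq> vec.span {u v* A}"
  proof
    fix y assume "y \<in> rows A"
    then obtain i where y: "y = row i A" unfolding rows_def by blast
    have yi: "y = axis i 1 v* A"
      by (simp add: y vec_eq_iff row_def vector_matrix_mult_def axis_def if_distrib[of "\<lambda>c. c * _"] cong: if_cong)
    define e :: "complex^'m" where "e = axis i 1"
    define c where "c = (if u = 0 then 0 else hinner e u / hinner u u)"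
    have "hinner (e - c *s u) u = 0"
      by (simp add: c_def hinner_diff_left) (simp add: hinner_self)
    then have "(e - c *s u) v* A = 0" by (rule ker)
    then have "(e - c *s u) v* A + (c *s u) v* A = c *s (u v* A)"
      by (simp add: scalar_vector_matrix_assoc)
    then have "y = c *s (u v* A)"
      unfolding vector_matrix_left_distrib[symmetric] by (simp add: yi e_def)
    then show "y \<in> vec.span {u v* A}"
      by (metis vec.span_base vec.span_scale singletonI)
  qed
  then have "vec.dim (rows A) \<le> card {u v* A}"
    by (intro vec.dim_le_card) auto
  then show ?thesis by (simp add: row_rank_def_gen)
qed

section \<open>The geometric rank is at most one\<close>

lemma isCont_heisenberg: "isCont (heisenberg_translation p) x"
proof -
  have "isCont (\<lambda>x. heisenberg_translation p x $ i) x" for i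
    by (cases i) (auto simp: heisenberg_translation_def intro!: continuous_intros)
  then have "isCont (\<lambda>x. \<chi> i. heisenberg_translation p x $ i) x"
    unfolding isCont_def by (intro tendsto_vec_lambda) auto
  then show ?thesis by simp
qed

lemma heisenberg_nth [simp]:
  "heisenberg_translation p x $ Some j = x $ Some j + p $ Some j"
  "heisenberg_translation p x $ None = x $ None + p $ None + 2 * \<i> * hinner (horiz x) (horiz p)"
  by (simp_all add: heisenberg_translation_def hinner_def)

lemma heisenberg_0 [simp]: "heisenberg_translation p 0 = p"
proof -
  have "heisenberg_translation p 0 $ i = p $ i" for i
    by (cases i) (simp_all add: hinner_def)
  then show ?thesis by (simp add: vec_eq_iff)
qed

lemma isCont_F_map:
  fixes y :: "complex^('m::finite option)"
  assumes "norm a < 1" "norm y \<le> 1"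
  shows "isCont (F_map a) y"
  using holomorphic_map_on_imp_isCont[OF holomorphic_map_on_F_map]
    one_minus_cnj_mult_nth_nonzero[OF assms] by blast

text \<open>
  If \<open>v\<close> is orthogonal to \<open>p\<close> then the points \<open>(\<theta> r v, i r\<^sup>2 |v|\<^sup>2)\<close> with \<open>|\<theta>| = 1\<close> are moved by the
  translation to \<open>p\<close> and by the Cayley transformation to points with the same last coordinate.
  There the map is affine in \<open>z'\<close>, so the numerators of the normalized map are affine in \<open>\<theta>\<close>, while
  \<open>\<phi>2\<close> contributes \<open>\<theta>\<^sup>2\<close>; comparing \<open>\<theta> = 1, -1\<close> with \<open>\<theta> = i, -i\<close> gives \<open>\<phi>2 v = 0\<close>.
\<close>

lemma normal_form_quadratic_vanishes:
  fixes p :: "complex^('m::finite option)" and a :: complex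
    and \<tau> :: "complex^(('m + ('m + 'm)) option) \<Rightarrow> _"
  defines "M \<equiv> {p \<in> frontier siegel. F_map a (cayley p) $ None \<noteq> - 1}"
    and "G \<equiv> cayley_inv \<circ> F_map a \<circ> (cayley :: complex^('m option) \<Rightarrow> _)"
  assumes a: "norm a < 1" and p: "p \<in> M"
    and \<tau>: "holomorphic_automorphism siegel \<tau>" "open U" "siegel \<union> {G p} \<subseteq> U"
      "holomorphic_map_on \<tau> U" "\<tau> (G p) = 0"
    and nf: "normal_form (at 0 within (heisenberg_translation p -` M))
          (\<tau> \<circ> G \<circ> heisenberg_translation p) A \<phi>2"
    and v: "hinner v (horiz p) = 0"
  shows "\<phi>2 v = 0"
proof (cases "v = 0")
  case True
  have "homogeneous_quadratic \<phi>2" using nf unfolding normal_form_def by blast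
  then show ?thesis
    unfolding homogeneous_quadratic_def True by (auto simp: vec_eq_iff)
next
  case v0: False
  obtain L b c where nz: "\<And>y. norm y \<le> 1 \<Longrightarrow> 1 - hinner y c \<noteq> 0"
    and frac: "\<And>q k. q \<in> U \<Longrightarrow> Im (q $ None) \<ge> (norm (horiz q))\<^sup>2 \<Longrightarrow>
      (1 - hinner (cayley q) c + (b + L *v cayley q) $ None) * \<tau> q $ Some k = (b + L *v cayley q) $ Some k"
    and frac0: "\<And>q. q \<in> U \<Longrightarrow> Im (q $ None) \<ge> (norm (horiz q))\<^sup>2 \<Longrightarrow>
      (1 - hinner (cayley q) c + (b + L *v cayley q) $ None) * \<tau> q $ None
        = \<i> * (1 - hinner (cayley q) c - (b + L *v cayley q) $ None)"
    using siegel_automorphism_fractional_linear[OF \<tau>(1,4)] by metis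
  define Den where "Den y = 1 - hinner y c + (b + L *v y) $ None" for y
  define Y where "Y x = F_map a (cayley (heisenberg_translation p x))" for x
  have pM: "Im (p $ None) = (norm (horiz p))\<^sup>2" "F_map a (cayley p) $ None \<noteq> - 1"
    using p unfolding M_def frontier_siegel by auto
  have Y0: "Y 0 = F_map a (cayley p)" by (simp add: Y_def)
  have boundary: "norm (F_map a (cayley x)) = 1" "Im (G x $ None) = (norm (horiz (G x)))\<^sup>2"
    "cayley (G x) = F_map a (cayley x)" if "x \<in> M" for x
  proof -
    have x: "Im (x $ None) = (norm (horiz x))\<^sup>2" "F_map a (cayley x) $ None \<noteq> - 1"
      using that unfolding M_def frontier_siegel by auto
    show n: "norm (F_map a (cayley x)) = 1"
      using norm_F_map_iff(3)[OF a, of "cayley x"] cayley_norm_eq(2)[OF x(1)] by simp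
    show "Im (G x $ None) = (norm (horiz (G x)))\<^sup>2"
      using cayley_inv_height(2)[of "F_map a (cayley x)"] n x(2) by (simp add: G_def add_eq_0_iff)
    show "cayley (G x) = F_map a (cayley x)"
      using cayley_cayley_inv[OF x(2)] by (simp add: G_def)
  qed
  have contY: "isCont Y 0"
  proof -
    have "isCont cayley p"
      using holomorphic_map_on_imp_isCont[OF holomorphic_map_on_cayley] siegel_Re_pos[of p] pM(1) by simp
    moreover have "isCont (F_map a) (cayley p)"
      by (rule isCont_F_map[OF a]) (simp add: cayley_norm_eq(2)[OF pM(1)])
    moreover have "(heisenberg_translation p \<longlongrightarrow> p) (at 0)"
      using isCont_heisenberg[where p = p and x = 0] unfolding isCont_def by simp
    ultimately have "(Y \<longlongrightarrow> F_map a (cayley p)) (at 0)"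
      unfolding Y_def
      by (intro isCont_tendsto_compose[where g = "F_map a"] isCont_tendsto_compose[where g = cayley])
    then show ?thesis unfolding isCont_def Y0 .
  qed
  \<comment> \<open>At the base point \<tau> takes the value 0, so the second fractional identity
    says E = N. If also E + N = 0, then E = 0, impossible on the closed ball.\<close>
  have Den0: "Den (Y 0) \<noteq> 0"
  proof
    assume D: "Den (Y 0) = 0"
    have "Den (Y 0) * \<tau> (G p) $ None = \<i> * (1 - hinner (Y 0) c - (b + L *v Y 0) $ None)"
      using frac0[of "G p"] \<tau>(3) boundary(2,3)[OF p] by (simp add: Den_def Y0)
    then have "1 - hinner (Y 0) c - (b + L *v Y 0) $ None = 0"
      by (simp add: \<tau>(5))
    with D have "1 - hinner (Y 0) c = 0" unfolding Den_def by algebra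
    with nz[of "Y 0"] boundary(1)[OF p] show False by (simp add: Y0)
  qed
  define X :: "complex \<Rightarrow> real \<Rightarrow> complex^('m option)" where
    "X \<theta> r = (\<chi> i. case i of None \<Rightarrow> \<i> * of_real (r\<^sup>2 * (norm v)\<^sup>2) | Some j \<Rightarrow> \<theta> * of_real r * v $ j)" for \<theta> r
  have XN: "X \<theta> r $ None = \<i> * of_real (r\<^sup>2 * (norm v)\<^sup>2)" for \<theta> r by (simp add: X_def)
  have XS: "X \<theta> r $ Some j = \<theta> * of_real r * v $ j" for \<theta> r j by (simp add: X_def)
  have Xh: "horiz (X \<theta> r) = (\<theta> * of_real r) *s v" for \<theta> r by (simp add: X_def vec_eq_iff)
  define S where "S = heisenberg_translation p -` M"
  define H where "H = \<tau> \<circ> G \<circ> heisenberg_translation p"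
  have sN: "heisenberg_translation p (X \<theta> r) $ None = \<i> * of_real (r\<^sup>2 * (norm v)\<^sup>2) + p $ None" for \<theta> r
    by (simp add: XN Xh v)
  have sh: "horiz (heisenberg_translation p (X \<theta> r)) = (\<theta> * of_real r) *s v + horiz p" for \<theta> r
    by (simp add: vec_eq_iff XS)
  have sfront: "heisenberg_translation p (X \<theta> r) \<in> frontier siegel" if "norm \<theta> = 1" for \<theta> r
  proof -
    let ?w = "(\<theta> * of_real r) *s v"
    have "hinner (?w - (- horiz p)) (?w - (- horiz p)) = hinner ?w ?w + hinner (horiz p) (horiz p)"
      using v cnj_hinner[of v "horiz p"] by (simp add: hinner_add_left hinner_add_right)
    then have "of_real ((norm (?w + horiz p))\<^sup>2) = (of_real ((norm ?w)\<^sup>2 + (norm (horiz p))\<^sup>2) :: complex)"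
      by (simp add: hinner_self)
    then have "(norm (?w + horiz p))\<^sup>2 = (norm ?w)\<^sup>2 + (norm (horiz p))\<^sup>2"
      using of_real_eq_iff by blast
    then show ?thesis
      unfolding frontier_siegel mem_Collect_eq sN sh using that pM(1)
      by (simp add: norm_mult power_mult_distrib)
  qed
  have Xlim0: "(X \<theta> \<longlongrightarrow> 0) (at_right 0)" for \<theta>
  proof -
    have "((\<lambda>r. X \<theta> r $ i) \<longlongrightarrow> 0 $ i) (at_right 0)" for i
      by (cases i) (auto simp: X_def intro!: tendsto_eq_intros)
    then show ?thesis by (rule vec_tendstoI)
  qed
  have Ylim: "((\<lambda>r. Y (X \<theta> r)) \<longlongrightarrow> Y 0) (at_right 0)" for \<theta>
    using isCont_tendsto_compose[OF contY Xlim0] .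
  have evM: "\<forall>\<^sub>F r in at_right 0. heisenberg_translation p (X \<theta> r) \<in> M" if "norm \<theta> = 1" for \<theta>
  proof -
    have "((\<lambda>r. Y (X \<theta> r) $ None) \<longlongrightarrow> Y 0 $ None) (at_right 0)"
      by (intro tendsto_vec_nth Ylim)
    then have "\<forall>\<^sub>F r in at_right 0. Y (X \<theta> r) $ None \<noteq> - 1"
      using pM(2) by (intro tendsto_imp_eventually_ne) (auto simp: Y0)
    then show ?thesis
      by eventually_elim (use sfront[OF that] in \<open>simp add: M_def Y_def\<close>)
  qed
  have Xlim: "filterlim (X \<theta>) (at 0 within S) (at_right 0)" if "norm \<theta> = 1" for \<theta>
  proof -
    have "\<forall>\<^sub>F r in at_right 0. X \<theta> r \<noteq> 0"
    proof (rule eventually_at_rightI[of 0 1])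
      fix r :: real assume "r \<in> {0<..<1}"
      then have "X \<theta> r $ None \<noteq> 0" using v0 by (simp add: XN)
      then show "X \<theta> r \<noteq> 0" by auto
    qed simp
    then have "\<forall>\<^sub>F r in at_right 0. X \<theta> r \<in> S \<and> X \<theta> r \<noteq> 0"
      using evM[OF that] by eventually_elim (simp add: S_def)
    then show ?thesis using Xlim0 unfolding filterlim_at by blast
  qed
  have \<phi>quad: "\<phi>2 (s *s z) $ k = s\<^sup>2 * \<phi>2 z $ k" for s z k
  proof -
    obtain q where "\<And>z k. \<phi>2 z $ k = (\<Sum>i\<in>UNIV. \<Sum>j\<in>UNIV. q k i j * z $ i * z $ j)"
      using nf unfolding normal_form_def homogeneous_quadratic_def by blast
    then show ?thesis by (simp add: sum_distrib_left power2_eq_square algebra_simps)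
  qed
  have Hlim: "((\<lambda>r. H (X \<theta> r) $ Some (Inr k) / of_real (r\<^sup>2)) \<longlongrightarrow> \<theta>\<^sup>2 * \<phi>2 v $ k) (at_right 0)"
    if \<theta>: "norm \<theta> = 1" for \<theta> k
  proof -
    let ?e = "\<lambda>x. (\<chi> k. H x $ Some (Inr k)) - \<phi>2 (horiz x)"
    have "(\<lambda>x. norm (?e x)) \<in> o[at 0 within S](\<lambda>x. (norm (horiz x) + sqrt (norm (x $ None)))\<^sup>2)"
      using nf unfolding normal_form_def o_wt_def S_def H_def by blast
    from landau_o.small.compose[OF this Xlim[OF \<theta>]]
    have "(\<lambda>r. norm (?e (X \<theta> r))) \<in> o[at_right 0](\<lambda>r. (norm (horiz (X \<theta> r)) + sqrt (norm (X \<theta> r $ None)))\<^sup>2)" .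
    then have l1: "((\<lambda>r. norm (?e (X \<theta> r)) / (norm (horiz (X \<theta> r)) + sqrt (norm (X \<theta> r $ None)))\<^sup>2) \<longlongrightarrow> 0) (at_right 0)"
      by (rule smalloD_tendsto)
    \<comment> \<open>On these points |z| and sqrt |w| both equal r |v|, hence the factor 4 =
      2^2.\<close>
    have w: "(norm (horiz (X \<theta> r)) + sqrt (norm (X \<theta> r $ None)))\<^sup>2 = 4 * r\<^sup>2 * (norm v)\<^sup>2" for r
      using \<theta> by (simp add: Xh XN norm_mult power_mult_distrib real_sqrt_mult abs_mult
          distrib_right[symmetric] norm_power del: of_real_mult of_real_power)
    have cancel: "(4 * (norm v)\<^sup>2) * (e / (4 * r\<^sup>2 * (norm v)\<^sup>2)) = e / r\<^sup>2" for e r :: real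
      using v0 by (simp add: field_simps)
    have "((\<lambda>r. (4 * (norm v)\<^sup>2) * (norm (?e (X \<theta> r)) / (4 * r\<^sup>2 * (norm v)\<^sup>2))) \<longlongrightarrow> (4 * (norm v)\<^sup>2) * 0) (at_right 0)"
      using l1 unfolding w by (intro tendsto_mult tendsto_const)
    then have l2: "((\<lambda>r. norm (?e (X \<theta> r)) / r\<^sup>2) \<longlongrightarrow> 0) (at_right 0)"
      unfolding cancel by simp
    have "((\<lambda>r. ?e (X \<theta> r) $ k / of_real (r\<^sup>2)) \<longlongrightarrow> 0) (at_right 0)"
    proof (rule Lim_null_comparison[OF _ l2])
      show "\<forall>\<^sub>F r in at_right 0. norm (?e (X \<theta> r) $ k / of_real (r\<^sup>2)) \<le> norm (?e (X \<theta> r)) / r\<^sup>2"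
        using Finite_Cartesian_Product.norm_nth_le[of "?e (X \<theta> _)" k]
        by (intro always_eventually allI) (simp add: norm_divide norm_power divide_right_mono del: vector_minus_component vec_lambda_beta)
    qed
    then have "((\<lambda>r. ?e (X \<theta> r) $ k / of_real (r\<^sup>2) + \<theta>\<^sup>2 * \<phi>2 v $ k) \<longlongrightarrow> 0 + \<theta>\<^sup>2 * \<phi>2 v $ k) (at_right 0)"
      by (intro tendsto_add tendsto_const)
    moreover have "\<forall>\<^sub>F r in at_right 0. ?e (X \<theta> r) $ k / of_real (r\<^sup>2) + \<theta>\<^sup>2 * \<phi>2 v $ k
        = H (X \<theta> r) $ Some (Inr k) / of_real (r\<^sup>2)"
      by (rule eventually_at_rightI[of 0 1])
         (auto simp: Xh \<phi>quad diff_divide_distrib power_mult_distrib)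
    ultimately show ?thesis
      using Lim_transform_eventually by fastforce
  qed
  define N where "N k r \<theta> = (b + L *v Y (X \<theta> r)) $ Some (Inr k) / of_real (r\<^sup>2)" for k r \<theta>
  have Nlim: "((\<lambda>r. N k r \<theta>) \<longlongrightarrow> Den (Y 0) * (\<theta>\<^sup>2 * \<phi>2 v $ k)) (at_right 0)"
    if \<theta>: "norm \<theta> = 1" for \<theta> k
  proof -
    have "((\<lambda>r. Den (Y (X \<theta> r))) \<longlongrightarrow> Den (Y 0)) (at_right 0)"
      unfolding Den_def hinner_def matrix_vector_mult_def
      by (auto intro!: tendsto_intros Ylim)
    then have "((\<lambda>r. Den (Y (X \<theta> r)) * (H (X \<theta> r) $ Some (Inr k) / of_real (r\<^sup>2)))
        \<longlongrightarrow> Den (Y 0) * (\<theta>\<^sup>2 * \<phi>2 v $ k)) (at_right 0)"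
      by (intro tendsto_mult Hlim[OF \<theta>])
    moreover have "\<forall>\<^sub>F r in at_right 0. Den (Y (X \<theta> r)) * (H (X \<theta> r) $ Some (Inr k) / of_real (r\<^sup>2)) = N k r \<theta>"
    proof -
      have "1 + Y 0 $ None \<noteq> 0" using pM(2) by (simp add: Y0 add_eq_0_iff)
      then have "isCont cayley_inv (Y 0)"
        using holomorphic_map_on_imp_isCont[OF holomorphic_map_on_cayley_inv] by blast
      then have "((\<lambda>r. cayley_inv (Y (X \<theta> r))) \<longlongrightarrow> G p) (at_right 0)"
        using isCont_tendsto_compose[OF _ Ylim] by (fastforce simp: G_def Y0)
      \<comment> \<open>The fractional identities are available only for points in U; openness of U
        and continuity at p keep the curve inside it for small r.\<close>
      then have "\<forall>\<^sub>F r in at_right 0. cayley_inv (Y (X \<theta> r)) \<in> U"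
        using \<tau>(2,3) by (auto intro: topological_tendstoD)
      then show ?thesis
        using evM[OF \<theta>]
      proof eventually_elim
        case (elim r)
        let ?q = "G (heisenberg_translation p (X \<theta> r))"
        have "?q \<in> U" using elim(1) by (simp add: G_def Y_def)
        with frac[of ?q "Inr k"] boundary(2,3)[OF elim(2)]
        have "Den (Y (X \<theta> r)) * H (X \<theta> r) $ Some (Inr k) = (b + L *v Y (X \<theta> r)) $ Some (Inr k)"
          by (simp add: Den_def Y_def H_def)
        then show ?case by (simp add: N_def)
      qed
    qed
    ultimately show ?thesis by (rule Lim_transform_eventually)
  qed
  \<comment> \<open>The numerator is affine in \<theta>, and both pairs of opposite values of
    \<theta> cancel the linear part, leaving twice the constant.\<close>
  have Nsum: "N k r 1 + N k r (- 1) = N k r \<i> + N k r (- \<i>)" for k r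
  proof -
    define x0 where "x0 = \<i> * of_real (r\<^sup>2 * (norm v)\<^sup>2) + p $ None"
    obtain A' :: "complex^'m^(('m + ('m + 'm)) option)" and b' where
      aff: "\<And>x. x $ None = (1 + \<i> * x0) / (1 - \<i> * x0) \<Longrightarrow> F_map a x = A' *v horiz x + b'"
      using F_map_affine[of "(1 + \<i> * x0) / (1 - \<i> * x0)" a] by blast
    define V where "V = A' *v ((2 * of_real r / (1 - \<i> * x0)) *s v)"
    define C where "C = A' *v ((2 / (1 - \<i> * x0)) *s horiz p) + b'"
    have "Y (X \<theta> r) = \<theta> *s V + C" for \<theta>
    proof -
      have "Y (X \<theta> r) = A' *v horiz (cayley (heisenberg_translation p (X \<theta> r))) + b'"
        unfolding Y_def by (rule aff) (simp only: cayley_nth sN x0_def)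
      also have "horiz (cayley (heisenberg_translation p (X \<theta> r))) =
          \<theta> *s ((2 * of_real r / (1 - \<i> * x0)) *s v) + (2 / (1 - \<i> * x0)) *s horiz p"
        unfolding vec_eq_iff horiz_nth cayley_nth sN x0_def[symmetric]
        by (simp add: XS add_divide_distrib algebra_simps)
      finally show ?thesis
        by (simp add: V_def C_def matrix_vector_right_distrib vector_scalar_commute)
    qed
    then have "N k r \<theta> = ((b + L *v C) $ Some (Inr k) + \<theta> * (L *v V) $ Some (Inr k)) / of_real (r\<^sup>2)" for \<theta>
      by (simp add: N_def matrix_vector_right_distrib vector_scalar_commute algebra_simps)
    then show ?thesis by (simp add: add_divide_distrib diff_divide_distrib)
  qed
  have "\<phi>2 v $ k = 0" for k
  proof -
    have "((\<lambda>r. N k r 1 + N k r (- 1)) \<longlongrightarrow> Den (Y 0) * (1\<^sup>2 * \<phi>2 v $ k) + Den (Y 0) * ((- 1)\<^sup>2 * \<phi>2 v $ k)) (at_right 0)"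
      by (intro tendsto_add Nlim) auto
    moreover have "((\<lambda>r. N k r 1 + N k r (- 1)) \<longlongrightarrow> Den (Y 0) * (\<i>\<^sup>2 * \<phi>2 v $ k) + Den (Y 0) * ((- \<i>)\<^sup>2 * \<phi>2 v $ k)) (at_right 0)"
      unfolding Nsum by (intro tendsto_add Nlim) auto
    ultimately have "Den (Y 0) * (1\<^sup>2 * \<phi>2 v $ k) + Den (Y 0) * ((- 1)\<^sup>2 * \<phi>2 v $ k)
        = Den (Y 0) * (\<i>\<^sup>2 * \<phi>2 v $ k) + Den (Y 0) * ((- \<i>)\<^sup>2 * \<phi>2 v $ k)"
      by (rule tendsto_unique[OF trivial_limit_at_right_real])
    \<comment> \<open>The squares add up to 2 for the pair 1, -1 and to -2 for the pair \<i>,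
      -\<i>.\<close>
    then have "4 * (Den (Y 0) * \<phi>2 v $ k) = 0" by simp
    with Den0 show ?thesis by simp
  qed
  then show ?thesis by (simp add: vec_eq_iff)
qed

lemma rank_at_F_map_le_1:
  fixes p :: "complex^('m::finite option)" and a :: complex
  defines "M \<equiv> {p \<in> frontier siegel. F_map a (cayley p) $ None \<noteq> - 1}"
    and "G \<equiv> cayley_inv \<circ> F_map a \<circ> (cayley :: complex^('m option) \<Rightarrow> _)"
  assumes a: "norm a < 1" and p: "p \<in> M" and r: "rank_at M G p r"
  shows "r \<le> 1"
proof -
  obtain \<tau> U A \<phi>2 where \<tau>: "holomorphic_automorphism siegel \<tau>" "open U" "siegel \<union> {G p} \<subseteq> U"
      "holomorphic_map_on \<tau> U" "\<tau> (G p) = 0"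
    and nf: "normal_form (at 0 within (heisenberg_translation p -` M))
          (\<tau> \<circ> G \<circ> heisenberg_translation p) A \<phi>2"
    and rA: "rank A = r"
    using r unfolding rank_at_def by blast
  have eq: "hinner (z v* A) z * of_real ((norm z)\<^sup>2) = of_real ((norm (\<phi>2 z))\<^sup>2)" for z
    using nf unfolding normal_form_def hinner_def by (simp add: mult.commute)
  have psd: "\<exists>t\<ge>0. hinner (z v* A) z = of_real t" for z
  proof (cases "z = 0")
    case False
    then have "hinner (z v* A) z = of_real ((norm (\<phi>2 z))\<^sup>2 / (norm z)\<^sup>2)"
      using eq[of z] by (simp add: field_simps)
    then show ?thesis by (metis zero_le_power2 divide_nonneg_nonneg)
  qed (auto intro: exI[of _ 0])
  have "v v* A = 0" if v: "hinner v (horiz p) = 0" for v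
  proof (cases "v = 0")
    case False
    have "\<phi>2 v = 0"
      using normal_form_quadratic_vanishes[OF a p[unfolded M_def] \<tau>[unfolded G_def]
          nf[unfolded M_def G_def] v] .
    then have "hinner (v v* A) v = 0" using eq[of v] False by simp
    with psd show ?thesis by (rule psd_form_kernel)
  qed simp
  then show ?thesis using rank_le_1_of_kernel rA by blast
qed

section \<open>Weighted orders\<close>

definition wt_norm :: "complex^('m::finite option) \<Rightarrow> real" where
  "wt_norm x = norm (horiz x) + sqrt (norm (x $ None))"

text \<open>Stated along the full punctured neighbourhood of 0, since the map extends across the
  base point; \<open>o_wt_within\<close> restricts to the boundary at the end. Orders add under
  products, which the little-o form alone does not record.\<close>

definition O_wt :: "nat \<Rightarrow> (complex^('m::finite option) \<Rightarrow> complex) \<Rightarrow> bool" where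
  "O_wt k h \<longleftrightarrow> (\<lambda>x. norm (h x)) \<in> O[at 0](\<lambda>x. wt_norm x ^ k)"

lemma o_wt_alt: "o_wt F k h \<longleftrightarrow> (\<lambda>x. norm (h x)) \<in> o[F](\<lambda>x. wt_norm x ^ k)"
  by (simp add: o_wt_def wt_norm_def)

lemma wt_norm_nonneg [simp]: "wt_norm x \<ge> 0"
  by (simp add: wt_norm_def)

lemma wt_norm_tendsto: "((wt_norm :: complex^('m::finite option) \<Rightarrow> real) \<longlongrightarrow> 0) (at 0)"
proof -
  have "continuous_on UNIV (wt_norm :: complex^('m option) \<Rightarrow> real)"
    unfolding wt_norm_def[abs_def] by (intro continuous_intros)
  then have "((wt_norm :: complex^('m option) \<Rightarrow> real) \<longlongrightarrow> wt_norm (0 :: complex^('m option))) (at 0)"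
    by (simp add: continuous_on_def)
  then show ?thesis by (simp add: wt_norm_def horiz_def zero_vec_def[symmetric])
qed

lemma O_wt_mult: "O_wt k f \<Longrightarrow> O_wt l g \<Longrightarrow> O_wt (k + l) (\<lambda>x. f x * g x)"
  unfolding O_wt_def by (simp add: norm_mult power_add landau_o.big.mult)

lemma O_wt_bounded:
  assumes "(g \<longlongrightarrow> c) (at 0)"
  shows "O_wt 0 g"
proof -
  have "((\<lambda>x. norm (g x)) \<longlongrightarrow> norm c) (at 0)" by (rule tendsto_norm[OF assms])
  then have "(\<lambda>x. norm (g x)) \<in> O[at 0](\<lambda>_. 1)"
    by (intro bigoI_tendsto[where c = "norm c"]) auto
  then show ?thesis by (simp add: O_wt_def)
qed

lemma O_wt_const_mult: "O_wt k f \<Longrightarrow> O_wt k (\<lambda>x. c * f x)"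
  using O_wt_mult[OF O_wt_bounded[OF tendsto_const]] by simp

lemma O_wt_mult_bounded: "O_wt k f \<Longrightarrow> (g \<longlongrightarrow> c) (at 0) \<Longrightarrow> O_wt k (\<lambda>x. f x * g x)"
  using O_wt_mult[OF _ O_wt_bounded] by force

lemma O_wt_add: "O_wt k f \<Longrightarrow> O_wt k g \<Longrightarrow> O_wt k (\<lambda>x. f x + g x)"
proof -
  assume "O_wt k f" "O_wt k g"
  then have "(\<lambda>x. norm (f x) + norm (g x)) \<in> O[at 0](\<lambda>x. wt_norm x ^ k)"
    unfolding O_wt_def by (rule sum_in_bigo)
  moreover have "(\<lambda>x. norm (f x + g x)) \<in> O[at 0](\<lambda>x. norm (f x) + norm (g x))"
    by (rule bigoI[of _ 1]) (simp add: norm_triangle_ineq abs_of_nonneg)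
  ultimately show ?thesis
    unfolding O_wt_def by (rule landau_o.big_trans[rotated])
qed

lemma O_wt_Suc_imp_o_wt:
  assumes "O_wt (Suc k) h"
  shows "o_wt (at 0) k h"
proof -
  have "wt_norm \<in> o[at 0](\<lambda>_. 1)"
    by (rule smalloI_tendsto) (use wt_norm_tendsto in auto)
  then have "(\<lambda>x. wt_norm x * wt_norm x ^ k) \<in> o[at 0](\<lambda>x. 1 * wt_norm x ^ k)"
    by (intro landau_o.small_big_mult) auto
  then show ?thesis
    using assms unfolding o_wt_alt O_wt_def by (auto intro: landau_o.big_small_trans)
qed

lemma O_wt_Suc_imp_O_wt: "O_wt (Suc k) h \<Longrightarrow> O_wt k h"
  using O_wt_Suc_imp_o_wt unfolding O_wt_def o_wt_alt by (blast intro: landau_o.small_imp_big)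

text \<open>For replacing a convergent factor by its limit when no rate of convergence is
  tracked.\<close>

lemma o_wt_mult_vanishing:
  assumes "O_wt k f" "(g \<longlongrightarrow> 0) (at 0)"
  shows "o_wt (at 0) k (\<lambda>x. f x * g x)"
proof -
  have "((\<lambda>x. norm (g x)) \<longlongrightarrow> 0) (at 0)"
    using tendsto_norm[OF assms(2)] by simp
  then have "(\<lambda>x. norm (g x)) \<in> o[at 0](\<lambda>_. 1)"
    by (intro smalloI_tendsto) auto
  then have "(\<lambda>x. norm (f x) * norm (g x)) \<in> o[at 0](\<lambda>x. wt_norm x ^ k * 1)"
    using assms(1) unfolding O_wt_def by (intro landau_o.big_small_mult) auto
  then show ?thesis by (simp add: o_wt_alt norm_mult)
qed

lemma o_wt_add:
  fixes f g :: "complex^('m::finite option) \<Rightarrow> complex"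
  assumes "o_wt F k f" "o_wt F k g"
  shows "o_wt F k (\<lambda>x. f x + g x)"
proof -
  have "(\<lambda>x. norm (f x) + norm (g x)) \<in> o[F](\<lambda>x. wt_norm x ^ k)"
    using assms unfolding o_wt_alt by (rule sum_in_smallo)
  moreover have "(\<lambda>x. norm (f x + g x)) \<in> O[F](\<lambda>x. norm (f x) + norm (g x))"
    by (rule bigoI[of _ 1]) (simp add: norm_triangle_ineq abs_of_nonneg)
  ultimately show ?thesis
    unfolding o_wt_alt by (rule landau_o.big_small_trans[rotated])
qed

lemma o_wt_cong:
  assumes "o_wt F k f" "\<forall>\<^sub>F x in F. f x = g x"
  shows "o_wt F k g"
proof -
  have "\<forall>\<^sub>F x in F. norm (f x) = norm (g x)"
    using assms(2) by eventually_elim simp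
  then show ?thesis using assms(1) unfolding o_wt_alt by (simp cong: landau_o.small.in_cong)
qed

lemma o_wt_vec:
  fixes h :: "complex^('m::finite option) \<Rightarrow> complex^'n::finite"
  assumes "\<And>j. o_wt F k (\<lambda>x. h x $ j)"
  shows "o_wt F k h"
proof -
  have "(\<lambda>x. \<Sum>j\<in>UNIV. norm (h x $ j)) \<in> o[F](\<lambda>x. wt_norm x ^ k)"
    using assms unfolding o_wt_alt by (intro big_sum_in_smallo) auto
  moreover have "(\<lambda>x. norm (h x)) \<in> O[F](\<lambda>x. \<Sum>j\<in>UNIV. norm (h x $ j))"
    by (rule bigoI[of _ 1]) (simp add: norm_vec_def L2_set_le_sum sum_nonneg abs_of_nonneg)
  ultimately show ?thesis
    unfolding o_wt_alt by (rule landau_o.big_small_trans[rotated])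
qed

lemma o_wt_within: "o_wt (at 0) k h \<Longrightarrow> o_wt (at 0 within S) k h"
  unfolding o_wt_alt by (rule landau_o.small.filter_mono[OF at_le[OF subset_UNIV]])

lemma O_wt_horizontal: "O_wt 1 (\<lambda>x. x $ Some j)"
  unfolding O_wt_def
proof (rule bigoI[of _ 1], rule always_eventually, rule allI)
  fix x :: "complex^('a option)"
  have "norm (x $ Some j) \<le> norm (horiz x)"
    using Finite_Cartesian_Product.norm_nth_le[of "horiz x" j] by simp
  moreover have "sqrt (norm (x $ None)) \<ge> 0" by simp
  ultimately have "norm (x $ Some j) \<le> wt_norm x" unfolding wt_norm_def by linarith
  then show "norm (norm (x $ Some j)) \<le> 1 * norm (wt_norm x ^ 1)" by simp
qed

lemma O_wt_vertical: "O_wt 2 (\<lambda>x. x $ None)"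
  unfolding O_wt_def
proof (rule bigoI[of _ 1], rule always_eventually, rule allI)
  fix x :: "complex^('a option)"
  have "(sqrt (norm (x $ None)))\<^sup>2 \<le> (wt_norm x)\<^sup>2"
    by (rule power_mono) (simp_all add: wt_norm_def)
  then show "norm (norm (x $ None)) \<le> 1 * norm ((wt_norm x)\<^sup>2)" by simp
qed

section \<open>A normalizing automorphism\<close>

text \<open>
  The map is normalized at the point that the Cayley transformation sends to \<open>(e\<^sub>k, 0)\<close>, where it
  takes the value \<open>(e\<^sub>k, 0, 0, 0)\<close>. \<open>ball_to_siegel\<close> composes the inverse Cayley transformation based at that value
  with a dilation and a parabolic automorphism fixing the origin; the complex tangent direction \<open>w\<close>
  at the source corresponds to the component \<open>w z\<^sub>k\<close> of the map, which therefore becomes \<open>f\<^sub>k\<close>.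
\<close>

definition ball_to_siegel ::
  "'m \<Rightarrow> complex^(('m::finite + ('m + 'm)) option) \<Rightarrow> complex^(('m + ('m + 'm)) option)" where
  "ball_to_siegel k Y = (let u = Y $ Some (Inl k); v = Y $ Some (Inr (Inl k)) in \<chi> i. case i of
       None \<Rightarrow> 2 * \<i> * (1 - u) / (1 + v)
     | Some (Inl j) \<Rightarrow> (if j = k then u - 1 - v else Y $ Some (Inl j)) / (1 + v)
     | Some (Inr (Inl j)) \<Rightarrow> (if j = k then Y $ None else Y $ Some (Inr (Inl j))) / (1 + v)
     | Some (Inr (Inr j)) \<Rightarrow> Y $ Some (Inr (Inr j)) / (1 + v))"

definition siegel_to_ball ::
  "'m \<Rightarrow> complex^(('m::finite + ('m + 'm)) option) \<Rightarrow> complex^(('m + ('m + 'm)) option)" where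
  "siegel_to_ball k X = (let e = 1 + X $ Some (Inl k) - \<i> / 2 * X $ None in \<chi> i. case i of
       None \<Rightarrow> X $ Some (Inr (Inl k)) / e
     | Some (Inl j) \<Rightarrow> if j = k then 1 + \<i> / 2 * X $ None / e else X $ Some (Inl j) / e
     | Some (Inr (Inl j)) \<Rightarrow> if j = k then 1 / e - 1 else X $ Some (Inr (Inl j)) / e
     | Some (Inr (Inr j)) \<Rightarrow> X $ Some (Inr (Inr j)) / e)"

lemma ball_to_siegel_nth [simp]:
  "ball_to_siegel k Y $ None = 2 * \<i> * (1 - Y $ Some (Inl k)) / (1 + Y $ Some (Inr (Inl k)))"
  "ball_to_siegel k Y $ Some (Inl j) =
    (if j = k then Y $ Some (Inl k) - 1 - Y $ Some (Inr (Inl k)) else Y $ Some (Inl j)) /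
      (1 + Y $ Some (Inr (Inl k)))"
  "ball_to_siegel k Y $ Some (Inr (Inl j)) =
    (if j = k then Y $ None else Y $ Some (Inr (Inl j))) / (1 + Y $ Some (Inr (Inl k)))"
  "ball_to_siegel k Y $ Some (Inr (Inr j)) = Y $ Some (Inr (Inr j)) / (1 + Y $ Some (Inr (Inl k)))"
  by (simp_all add: ball_to_siegel_def Let_def)

lemma siegel_to_ball_nth [simp]:
  "siegel_to_ball k X $ None = X $ Some (Inr (Inl k)) / (1 + X $ Some (Inl k) - \<i> / 2 * X $ None)"
  "siegel_to_ball k X $ Some (Inl j) = (if j = k
     then 1 + \<i> / 2 * X $ None / (1 + X $ Some (Inl k) - \<i> / 2 * X $ None)
     else X $ Some (Inl j) / (1 + X $ Some (Inl k) - \<i> / 2 * X $ None))"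
  "siegel_to_ball k X $ Some (Inr (Inl j)) = (if j = k
     then 1 / (1 + X $ Some (Inl k) - \<i> / 2 * X $ None) - 1
     else X $ Some (Inr (Inl j)) / (1 + X $ Some (Inl k) - \<i> / 2 * X $ None))"
  "siegel_to_ball k X $ Some (Inr (Inr j)) =
     X $ Some (Inr (Inr j)) / (1 + X $ Some (Inl k) - \<i> / 2 * X $ None)"
  by (simp_all add: siegel_to_ball_def Let_def)

lemma holomorphic_map_on_ball_to_siegel:
  "holomorphic_map_on (ball_to_siegel k) {Y. 1 + Y $ Some (Inr (Inl k)) \<noteq> 0}"
proof (rule holomorphic_map_onI)
  fix x :: "complex^(('a + ('a + 'a)) option)" and i
  assume "x \<in> {Y. 1 + Y $ Some (Inr (Inl k)) \<noteq> 0}"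
  then show "complex_diff_at (\<lambda>x. ball_to_siegel k x $ i) x"
    by (cases i rule: index_cases) (auto intro!: complex_diff_intros)
qed

lemma holomorphic_map_on_siegel_to_ball:
  "holomorphic_map_on (siegel_to_ball k) {X. 1 + X $ Some (Inl k) - \<i> / 2 * X $ None \<noteq> 0}"
proof (rule holomorphic_map_onI)
  fix x :: "complex^(('a + ('a + 'a)) option)" and i
  assume "x \<in> {X. 1 + X $ Some (Inl k) - \<i> / 2 * X $ None \<noteq> 0}"
  then have "1 + x $ Some (Inl k) - \<i> / 2 * x $ None \<noteq> 0" by simp
  then show "complex_diff_at (\<lambda>x. siegel_to_ball k x $ i) x"
    by (cases i rule: index_cases) (simp only: siegel_to_ball_nth, auto intro!: complex_diff_intros)+
qed

text \<open>All components other than u and v enter both sides with the same modulus. What remains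
  is 2 Re((1 - u) conj(1 + v)) - |u - 1 - v|^2 = 1 - |u|^2 - |v|^2.\<close>

lemma norm_ball_to_siegel:
  fixes Y :: "complex^(('m::finite + ('m + 'm)) option)"
  assumes nz: "1 + Y $ Some (Inr (Inl k)) \<noteq> 0"
  shows "Im (ball_to_siegel k Y $ None) - (norm (horiz (ball_to_siegel k Y)))\<^sup>2 =
    (1 - (norm Y)\<^sup>2) / (norm (1 + Y $ Some (Inr (Inl k))))\<^sup>2"
proof -
  define u where "u = Y $ Some (Inl k)"
  define v where "v = Y $ Some (Inr (Inl k))"
  define q where "q = (norm (1 + v))\<^sup>2"
  define A where "A = (\<Sum>j\<in>UNIV - {k}. (norm (Y $ Some (Inl j)))\<^sup>2)"
  define B where "B = (\<Sum>j\<in>UNIV - {k}. (norm (Y $ Some (Inr (Inl j))))\<^sup>2)"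
  define C where "C = (\<Sum>j\<in>UNIV. (norm (Y $ Some (Inr (Inr j))))\<^sup>2)"
  have q: "q > 0" using nz by (simp add: q_def v_def)
  have split: "(\<Sum>j\<in>UNIV. f j) = f k + (\<Sum>j\<in>UNIV - {k}. f j)" for f :: "'m \<Rightarrow> real"
    by (simp add: sum.remove[of UNIV k])
  have Y: "(norm Y)\<^sup>2 = (norm (Y $ None))\<^sup>2 + ((norm u)\<^sup>2 + A + ((norm v)\<^sup>2 + B + C))"
    unfolding norm_vec_sum_squares sum_UNIV_option sum_UNIV_sum A_def B_def C_def u_def v_def
    by (simp add: split[of "\<lambda>j. (norm (Y $ Some (Inl j)))\<^sup>2"] split[of "\<lambda>j. (norm (Y $ Some (Inr (Inl j))))\<^sup>2"])
  have "(norm (horiz (ball_to_siegel k Y)))\<^sup>2 =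
      ((norm (u - 1 - v))\<^sup>2 + A + ((norm (Y $ None))\<^sup>2 + B + C)) / q"
    unfolding norm_vec_sum_squares sum_UNIV_option sum_UNIV_sum A_def B_def C_def q_def
    by (simp add: split[of "\<lambda>j. (norm ((if j = k then _ j else _ j) / _))\<^sup>2"]
        u_def[symmetric] v_def[symmetric] norm_divide power_divide sum_divide_distrib add_divide_distrib)
       (simp add: split[of "\<lambda>j. (norm (if j = k then _ else _ j))\<^sup>2 / _"] u_def[symmetric] v_def[symmetric]
        add_divide_distrib)
  moreover have "Im (ball_to_siegel k Y $ None) = 2 * Re ((1 - u) * cnj (1 + v)) / q"
  proof -
    have "2 * \<i> * (1 - u) / (1 + v) = \<i> * (2 * ((1 - u) * cnj (1 + v))) / of_real q"
      unfolding q_def by (subst complex_div_cnj) (simp add: mult.assoc)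
    then show ?thesis
      unfolding ball_to_siegel_nth u_def[symmetric] v_def[symmetric]
      by (simp only: Im_divide_of_real Im_i_times) simp
  qed
  moreover have "2 * Re ((1 - u) * cnj (1 + v)) - (norm (u - 1 - v))\<^sup>2 = 1 - (norm u)\<^sup>2 - (norm v)\<^sup>2"
    unfolding cmod_power2 by (simp add: algebra_simps power2_eq_square)
  ultimately show ?thesis
    using q unfolding Y v_def[symmetric] q_def[symmetric]
    by (simp add: field_simps)
qed

text \<open>With t the real part of \<open>X $ Some k\<close>, membership in the half space gives Im
  w > t^2, so the real part of the expression exceeds 1 + t + t^2 / 2 = ((1 + t)^2 + 1) / 2.\<close>

lemma siegel_to_ball_denominator:
  assumes "X \<in> siegel"
  shows "1 + X $ Some k - \<i> / 2 * X $ None \<noteq> 0"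
proof
  assume "1 + X $ Some k - \<i> / 2 * X $ None = 0"
  moreover have "Re (1 + X $ Some k - \<i> / 2 * X $ None) = 1 + Re (X $ Some k) + Im (X $ None) / 2"
    by simp
  ultimately have re: "1 + Re (X $ Some k) + Im (X $ None) / 2 = 0"
    by (metis zero_complex.sel(1))
  have "(norm (horiz X $ k))\<^sup>2 \<le> (norm (horiz X))\<^sup>2"
    by (intro power_mono Finite_Cartesian_Product.norm_nth_le) simp
  moreover have "(norm (horiz X))\<^sup>2 < Im (X $ None)" using assms by (simp add: siegel_def)
  ultimately have "(norm (X $ Some k))\<^sup>2 < Im (X $ None)" unfolding horiz_nth by linarith
  moreover have "(Re (X $ Some k))\<^sup>2 \<le> (norm (X $ Some k))\<^sup>2" by (simp add: cmod_power2)
  ultimately have "1 + Re (X $ Some k) + (Re (X $ Some k))\<^sup>2 / 2 < 0" using re by linarith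
  moreover have "1 + Re (X $ Some k) + (Re (X $ Some k))\<^sup>2 / 2 = ((1 + Re (X $ Some k))\<^sup>2 + 1) / 2"
    by (simp add: power2_eq_square algebra_simps)
  ultimately show False by (smt (verit) divide_less_0_iff zero_le_power2)
qed

lemma siegel_to_ball_ball_to_siegel:
  assumes "1 + Y $ Some (Inr (Inl k)) \<noteq> 0"
  shows "siegel_to_ball k (ball_to_siegel k Y) = Y"
proof -
  define v where "v = Y $ Some (Inr (Inl k))"
  define X where "X = ball_to_siegel k Y"
  have v: "1 + v \<noteq> 0" using assms by (simp add: v_def)
  \<comment> \<open>The denominators of the two maps are reciprocal at corresponding points; every
    component then reduces to clearing 1 + v.\<close>
  have e: "1 + X $ Some (Inl k) - \<i> / 2 * X $ None = 1 / (1 + v)"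
  proof -
    have i: "\<i> / 2 * (2 * \<i> * z / (1 + v)) = - (z / (1 + v))" for z
      by (simp add: mult.assoc[symmetric])
    show ?thesis
      using v unfolding X_def ball_to_siegel_nth v_def[symmetric] i by (simp add: field_simps)
  qed
  have i2: "\<i> / 2 * (2 * \<i> * z) = - z" for z
    by (simp add: mult.assoc[symmetric])
  have X0: "X $ None * (1 + v) = 2 * \<i> * (1 - Y $ Some (Inl k))"
    using v by (simp add: X_def v_def)
  have "1 + \<i> / 2 * (X $ None * (1 + v)) = Y $ Some (Inl k)"
    unfolding X0 i2 by simp
  then have u: "1 + \<i> / 2 * X $ None / (1 / (1 + v)) = Y $ Some (Inl k)"
    by (simp add: mult.assoc)
  have "siegel_to_ball k X $ i = Y $ i" for i
    by (cases i rule: index_cases; simp only: siegel_to_ball_nth e u)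
       (use v in \<open>auto simp: X_def v_def[symmetric] field_simps\<close>)
  then show ?thesis by (simp add: vec_eq_iff X_def)
qed

lemma ball_to_siegel_siegel_to_ball:
  assumes "1 + X $ Some (Inl k) - \<i> / 2 * X $ None \<noteq> 0"
  shows "ball_to_siegel k (siegel_to_ball k X) = X"
    and "1 + siegel_to_ball k X $ Some (Inr (Inl k)) \<noteq> 0"
proof -
  define e where "e = 1 + X $ Some (Inl k) - \<i> / 2 * X $ None"
  define Y where "Y = siegel_to_ball k X"
  have e0: "e \<noteq> 0" using assms by (simp add: e_def)
  have Xk: "X $ Some (Inl k) = e - 1 + \<i> / 2 * X $ None" by (simp add: e_def)
  have v: "Y $ Some (Inr (Inl k)) = 1 / e - 1"
    unfolding Y_def siegel_to_ball_nth e_def[symmetric] by simp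
  have d: "1 + Y $ Some (Inr (Inl k)) = 1 / e" unfolding v by simp
  have "ball_to_siegel k Y $ i = X $ i" for i
    by (cases i rule: index_cases; simp only: ball_to_siegel_nth d)
       (use e0 in \<open>auto simp: Y_def e_def[symmetric] Xk field_simps\<close>)
  then show "ball_to_siegel k (siegel_to_ball k X) = X" by (simp add: vec_eq_iff Y_def)
  show "1 + siegel_to_ball k X $ Some (Inr (Inl k)) \<noteq> 0"
    using d e0 unfolding Y_def by simp
qed

lemma biholomorphism_ball_to_siegel:
  "biholomorphism (ball 0 1) siegel (ball_to_siegel k) (siegel_to_ball k)"
proof -
  have b: "1 + Y $ Some (Inr (Inl k)) \<noteq> 0" if "Y \<in> ball 0 1" for Y :: "complex^(('a + ('a + 'a)) option)"
    using one_plus_nth_nonzero[OF that] .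
  have "holomorphic_map_on (ball_to_siegel k) (ball 0 1)"
    using holomorphic_map_on_ball_to_siegel[of k] b unfolding holomorphic_map_on_def by blast
  moreover have "holomorphic_map_on (siegel_to_ball k) siegel"
    using holomorphic_map_on_siegel_to_ball[of k] siegel_to_ball_denominator[of _ "Inl k"]
    unfolding holomorphic_map_on_def by blast
  moreover have "ball_to_siegel k Y \<in> siegel" if Y: "Y \<in> ball 0 1" for Y
  proof -
    have "1 - (norm Y)\<^sup>2 > 0" using Y by (simp add: abs_square_less_1)
    then have "Im (ball_to_siegel k Y $ None) - (norm (horiz (ball_to_siegel k Y)))\<^sup>2 > 0"
      unfolding norm_ball_to_siegel[OF b[OF Y]] using b[OF Y] by simp
    then show ?thesis by (simp add: siegel_def)
  qed
  moreover have "siegel_to_ball k X \<in> ball 0 1" if X: "X \<in> siegel" for X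
  proof -
    note e = ball_to_siegel_siegel_to_ball[OF siegel_to_ball_denominator[OF X, of "Inl k"]]
    have "(1 - (norm (siegel_to_ball k X))\<^sup>2) / (norm (1 + siegel_to_ball k X $ Some (Inr (Inl k))))\<^sup>2 > 0"
      unfolding norm_ball_to_siegel[OF e(2), symmetric] e(1) using X by (simp add: siegel_def)
    then have "1 - (norm (siegel_to_ball k X))\<^sup>2 > 0"
      using e(2) by (simp add: zero_less_divide_iff)
    then show ?thesis by (simp add: abs_square_less_1)
  qed
  ultimately show ?thesis
    using siegel_to_ball_ball_to_siegel[OF b] ball_to_siegel_siegel_to_ball(1)[OF siegel_to_ball_denominator]
    unfolding biholomorphism_def by blast
qed

section \<open>The normal form at the base point\<close>

definition base_point :: "'m \<Rightarrow> complex^('m::finite option)" where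
  "base_point k = (\<chi> i. case i of None \<Rightarrow> \<i> | Some j \<Rightarrow> if j = k then 1 else 0)"

lemma base_point_nth [simp]:
  "base_point k $ None = \<i>" "base_point k $ Some j = (if j = k then 1 else 0)"
  by (simp_all add: base_point_def)

lemma horiz_base_point: "horiz (base_point k) = axis k 1"
  by (simp add: vec_eq_iff axis_def)

lemma hinner_axis: "hinner x (axis k 1) = x $ k"
  by (simp add: hinner_def axis_def if_distrib[of cnj] if_distrib[of "\<lambda>c. _ * c"] cong: if_cong)

text \<open>The Cayley denominator is 2 (1 + \<epsilon>), and the last ball coordinate is minus
  \<epsilon> up to this factor. So \<epsilon>, of weighted order 1 with leading part z_k, is the
  quantity in which the expansion below is carried out.\<close>

lemma cayley_heisenberg_base_point:
  fixes x :: "complex^('m::finite option)" and k :: 'm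
  defines "\<epsilon> \<equiv> x $ Some k - \<i> / 2 * x $ None"
  shows "cayley (heisenberg_translation (base_point k) x) $ None = - \<epsilon> / (1 + \<epsilon>)"
    and "cayley (heisenberg_translation (base_point k) x) $ Some j =
      (x $ Some j + (if j = k then 1 else 0)) / (1 + \<epsilon>)"
proof -
  have s: "heisenberg_translation (base_point k) x $ None = x $ None + \<i> + 2 * \<i> * x $ Some k"
    by (simp add: horiz_base_point hinner_axis)
  have d: "1 - \<i> * heisenberg_translation (base_point k) x $ None = 2 * (1 + \<epsilon>)"
    "1 + \<i> * heisenberg_translation (base_point k) x $ None = 2 * (- \<epsilon>)"
    unfolding s \<epsilon>_def by (simp_all add: complex_eq_iff algebra_simps)
  show "cayley (heisenberg_translation (base_point k) x) $ None = - \<epsilon> / (1 + \<epsilon>)"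
    unfolding cayley_nth d by (rule mult_divide_mult_cancel_left) simp
  have "cayley (heisenberg_translation (base_point k) x) $ Some j =
      (2 * (x $ Some j + (if j = k then 1 else 0))) / (2 * (1 + \<epsilon>))"
    unfolding cayley_nth d by simp
  also have "\<dots> = (x $ Some j + (if j = k then 1 else 0)) / (1 + \<epsilon>)"
    by (rule mult_divide_mult_cancel_left) simp
  finally show "cayley (heisenberg_translation (base_point k) x) $ Some j =
      (x $ Some j + (if j = k then 1 else 0)) / (1 + \<epsilon>)" .
qed

definition normal_matrix :: "'m \<Rightarrow> complex^'m::finite^'m" where
  "normal_matrix k = (\<chi> i j. if i = k \<and> j = k then 1 else 0)"

text \<open>The second-order parts of the components of F: slot \<open>Inl k\<close> holds w^2 (w -
  a) / (1 - conj(a) w), the other \<open>Inl j\<close> hold w z_j, and the \<open>Inr\<close> slots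
  the block with the square root. They are read off by putting w = -z_k to first order and z_k = 1
  to order zero.\<close>

definition normal_quadratic :: "complex \<Rightarrow> 'm \<Rightarrow> complex^'m::finite \<Rightarrow> complex^('m + 'm)" where
  "normal_quadratic a k z = (\<chi> i. case i of
      Inl j \<Rightarrow> (if j = k then - a else - 1) * z $ k * z $ j
    | Inr j \<Rightarrow> (if j = k then of_real (sqrt (1 - (norm a)\<^sup>2)) else 0) * z $ k * z $ k)"

lemma vector_normal_matrix: "z v* normal_matrix k = axis k (z $ k)"
proof -
  have "(\<Sum>i\<in>UNIV. z $ i * (if i = k \<and> j = k then 1 else 0)) = (if j = k then z $ k else 0)" for j
    by (cases "j = k") (simp_all add: if_distrib[of "\<lambda>c. _ * c"] cong: if_cong)
  then show ?thesis
    by (simp add: vec_eq_iff vector_matrix_mult_def normal_matrix_def axis_def)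
qed

lemma rank_normal_matrix: "rank (normal_matrix k :: complex^'m::finite^'m) = 1"
proof -
  have "rank (normal_matrix k :: complex^'m^'m) \<le> 1"
    by (rule rank_le_1_of_kernel[of "axis k 1"]) (simp add: hinner_axis vector_normal_matrix)
  moreover have "rank (normal_matrix k :: complex^'m^'m) \<noteq> 0"
  proof
    assume "rank (normal_matrix k :: complex^'m^'m) = 0"
    then have "rows (normal_matrix k :: complex^'m^'m) \<subseteq> {0}"
      by (simp add: row_rank_def_gen)
    then have "row k (normal_matrix k :: complex^'m^'m) = 0" unfolding rows_def by blast
    then have "row k (normal_matrix k :: complex^'m^'m) $ k = 0" by simp
    then show False by (simp add: row_def normal_matrix_def)
  qed
  ultimately show ?thesis by linarith
qed

lemma homogeneous_quadratic_normal_quadratic: "homogeneous_quadratic (normal_quadratic a k)"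
proof -
  define idx where "idx i = (case i of Inl j \<Rightarrow> j | Inr j \<Rightarrow> k)" for i :: "'a + 'a"
  define co where "co i = (case i of Inl j \<Rightarrow> (if j = k then - a else - 1)
      | Inr j \<Rightarrow> (if j = k then of_real (sqrt (1 - (norm a)\<^sup>2)) else 0))" for i :: "'a + 'a"
  have "normal_quadratic a k z $ l =
      (\<Sum>i\<in>UNIV. \<Sum>j\<in>UNIV. (if i = k then if j = idx l then co l else 0 else 0) * z $ i * z $ j)" for z l
  proof -
    have "(\<Sum>j\<in>UNIV. (if i = k then if j = idx l then co l else 0 else 0) * z $ i * z $ j)
        = (if i = k then co l * z $ k * z $ idx l else 0)" for i
      by (simp add: if_distrib[of "\<lambda>c. c * _"] cong: if_cong)
    then show ?thesis
      by (cases l) (simp_all add: normal_quadratic_def idx_def co_def)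
  qed
  then show ?thesis
    unfolding homogeneous_quadratic_def
    by (intro exI[of _ "\<lambda>l i j. if i = k then if j = idx l then co l else 0 else 0"]) simp
qed

text \<open>The slots of degree two in z_k contribute (|a|^2 + 1 - |a|^2) |z_k|^4, exactly the
  missing j = k term of |z_k|^2 |z|^2.\<close>

lemma norm_normal_quadratic:
  assumes a: "norm a < 1"
  shows "(norm (normal_quadratic a k z))\<^sup>2 = (norm (z $ k))\<^sup>2 * (norm z)\<^sup>2"
proof -
  have a2: "1 - (norm a)\<^sup>2 > 0" using a by (simp add: abs_square_less_1)
  define t where "t = (norm (z $ k))\<^sup>2"
  define B where "B = (\<Sum>j\<in>UNIV - {k}. (norm (z $ j))\<^sup>2)"
  have split: "(\<Sum>j\<in>UNIV. f j) = f k + (\<Sum>j\<in>UNIV - {k}. f j)" for f :: "'a \<Rightarrow> real"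
    by (simp add: sum.remove[of UNIV k])
  have z: "(norm z)\<^sup>2 = t + B"
    unfolding norm_vec_sum_squares B_def t_def by (rule split)
  have "(\<Sum>j\<in>UNIV. (norm (normal_quadratic a k z $ Inl j))\<^sup>2) = (norm a)\<^sup>2 * t * t + t * B"
  proof -
    have "(\<Sum>j\<in>UNIV - {k}. (norm (normal_quadratic a k z $ Inl j))\<^sup>2) = t * B"
      unfolding B_def sum_distrib_left
      by (intro sum.cong) (auto simp: normal_quadratic_def norm_mult power_mult_distrib t_def)
    then show ?thesis
      by (subst split) (simp add: normal_quadratic_def norm_mult power_mult_distrib t_def)
  qed
  moreover have "(\<Sum>j\<in>UNIV. (norm (normal_quadratic a k z $ Inr j))\<^sup>2) = (1 - (norm a)\<^sup>2) * t * t"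
    by (subst split) (use a2 in \<open>simp add: normal_quadratic_def norm_mult power_mult_distrib t_def\<close>)
  ultimately have "(norm (normal_quadratic a k z))\<^sup>2 = (norm a)\<^sup>2 * t * t + t * B + (1 - (norm a)\<^sup>2) * t * t"
    unfolding norm_vec_sum_squares[of "normal_quadratic a k z"] sum_UNIV_sum by simp
  then show ?thesis unfolding z t_def[symmetric] by (simp add: algebra_simps)
qed

text \<open>\<open>H\<close> is prescribed only near 0, because \<open>cayley\<close> undoes
  \<open>cayley_inv\<close> only where the last coordinate is not -1. All components are first
  written exactly, with the error terms as explicit factors, and only then estimated.\<close>

lemma normal_form_F_map:
  fixes a :: complex and k :: "'m::finite"
  assumes a: "norm a < 1"
    and H: "\<forall>\<^sub>F x in at 0. H x = ball_to_siegel k (F_map a (cayley (heisenberg_translation (base_point k) x)))"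
  shows "normal_form (at 0 within S) H (normal_matrix k) (normal_quadratic a k)"
proof -
  define s where "s = complex_of_real (sqrt (1 - (norm a)\<^sup>2))"
  define z where "z x = x $ Some k" for x :: "complex^('m option)"
  define w where "w x = x $ None" for x :: "complex^('m option)"
  define \<epsilon> where "\<epsilon> x = z x - \<i> / 2 * w x" for x
  define E where "E x = 1 + \<epsilon> x" for x
  define \<omega> where "\<omega> x = - \<epsilon> x / E x" for x
  \<comment> \<open>D / E is the denominator 1 + v of \<open>ball_to_siegel\<close>. Its reciprocal
    1 / D differs from 1 by a multiple of w \<epsilon>, of weighted order 3.\<close>
  define D where "D x = 1 - \<i> / 2 * w x * \<epsilon> x / E x" for x
  define q where "q x = 1 - cnj a * \<omega> x" for x
  have z0: "(z \<longlongrightarrow> 0) (at 0)" and w0: "(w \<longlongrightarrow> 0) (at 0)" and x0: "((\<lambda>x. x $ Some j) \<longlongrightarrow> 0) (at 0)" for j :: 'm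
    unfolding z_def[abs_def] w_def[abs_def] by (auto intro!: tendsto_eq_intros)
  have \<epsilon>0: "(\<epsilon> \<longlongrightarrow> 0) (at 0)"
    unfolding \<epsilon>_def[abs_def] by (auto intro!: tendsto_eq_intros z0 w0)
  have E0: "(E \<longlongrightarrow> 1) (at 0)"
    unfolding E_def[abs_def] by (auto intro!: tendsto_eq_intros \<epsilon>0)
  have \<omega>0: "(\<omega> \<longlongrightarrow> 0) (at 0)"
    unfolding \<omega>_def[abs_def] by (auto intro!: tendsto_eq_intros \<epsilon>0 E0)
  have D0: "(D \<longlongrightarrow> 1) (at 0)"
    unfolding D_def[abs_def] by (auto intro!: tendsto_eq_intros \<epsilon>0 E0 w0)
  have q0: "(q \<longlongrightarrow> 1) (at 0)"
    unfolding q_def[abs_def] by (auto intro!: tendsto_eq_intros \<omega>0)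
  have ev: "\<forall>\<^sub>F x in at 0. H x = ball_to_siegel k (F_map a (cayley (heisenberg_translation (base_point k) x)))
      \<and> E x \<noteq> 0 \<and> D x \<noteq> 0"
    using H tendsto_imp_eventually_ne[OF E0, of 0] tendsto_imp_eventually_ne[OF D0, of 0]
    by (simp add: eventually_conj_iff)
  have comp: "H x $ None = w x * (1 / D x)"
    "H x $ Some (Inl j) = (if j = k then z x * (1 / D x) + \<i> / 2 * (w x * \<epsilon> x * (1 / (E x * D x)))
       else x $ Some j * (1 / D x))"
    "H x $ Some (Inr (Inl j)) = (if j = k then (\<epsilon> x)\<^sup>2 * ((\<omega> x - a) / (q x * E x * D x))
       else - (\<epsilon> x * x $ Some j * (1 / (E x * D x))))"
    "H x $ Some (Inr (Inr j)) =
       (\<epsilon> x)\<^sup>2 * (s * (x $ Some j + (if j = k then 1 else 0)) / (q x * (E x)\<^sup>2 * D x))"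
    "1 / D x = 1 + w x * \<epsilon> x * ((\<i> / 2) / (E x * D x))"
    if h: "H x = ball_to_siegel k (F_map a (cayley (heisenberg_translation (base_point k) x))) \<and>
      E x \<noteq> 0 \<and> D x \<noteq> 0" for x j
  proof -
    define C where "C = cayley (heisenberg_translation (base_point k) x)"
    have CN: "C $ None = \<omega> x" and CS: "\<And>j. C $ Some j = (x $ Some j + (if j = k then 1 else 0)) / E x"
      using cayley_heisenberg_base_point[of k x]
      by (simp_all add: C_def \<omega>_def E_def \<epsilon>_def z_def w_def)
    have DE: "D x * E x = E x - \<i> / 2 * w x * \<epsilon> x"
      using h by (simp add: D_def field_simps)
    have wz: "\<i> / 2 * w x = z x - \<epsilon> x" by (simp add: \<epsilon>_def)
    have vk: "F_map a C $ Some (Inr (Inl k)) = \<omega> x * ((z x + 1) / E x)"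
      unfolding F_map_nth CN CS z_def by simp
    have v: "1 + F_map a C $ Some (Inr (Inl k)) = D x / E x"
    proof -
      have "(1 + F_map a C $ Some (Inr (Inl k))) * (E x * E x) = D x * E x"
        unfolding DE wz vk \<omega>_def using h by (simp add: field_simps) (simp add: E_def algebra_simps)
      moreover have "r = d / e" if "r * (e * e) = d * e" "e \<noteq> 0" for r d e :: complex
        using that by (simp add: field_simps)
      ultimately show ?thesis using h by blast
    qed
    have u: "F_map a C $ Some (Inl k) = (z x + 1) / E x" by (simp add: CS z_def)
    have Hx: "H x = ball_to_siegel k (F_map a C)" using h by (simp add: C_def)
    have ED: "E x \<noteq> 0" "D x \<noteq> 0" using h by auto
    have w: "w x = 2 * \<i> * (\<epsilon> x - z x)"
      by (simp add: \<epsilon>_def mult.assoc[symmetric])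
    have "H x $ None = 2 * \<i> * (1 - (z x + 1) / E x) / (D x / E x)"
      unfolding Hx ball_to_siegel_nth v u ..
    also have "\<dots> = 2 * \<i> * (\<epsilon> x - z x) / D x"
      using ED by (simp add: field_simps) (simp add: E_def algebra_simps)
    finally show "H x $ None = w x * (1 / D x)" by (simp add: w)
    have vv: "F_map a C $ Some (Inr (Inl k)) = D x / E x - 1" using v by (simp add: algebra_simps)
    show "H x $ Some (Inl j) = (if j = k then z x * (1 / D x) + \<i> / 2 * (w x * \<epsilon> x * (1 / (E x * D x)))
       else x $ Some j * (1 / D x))"
    proof (cases "j = k")
      case True
      have "H x $ Some (Inl j) = ((z x + 1) / E x - D x / E x) / (D x / E x)"
        unfolding Hx ball_to_siegel_nth v u vv using True by simp
      also have "\<dots> = (z x + 1 - D x) / D x" using ED by (simp add: field_simps)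
      also have "z x + 1 - D x = z x + \<i> / 2 * w x * \<epsilon> x / E x" by (simp add: D_def)
      also have "(z x + \<i> / 2 * w x * \<epsilon> x / E x) / D x =
          z x * (1 / D x) + \<i> / 2 * (w x * \<epsilon> x * (1 / (E x * D x)))"
        by (simp add: add_divide_distrib mult.assoc)
      finally show ?thesis using True by simp
    next
      case False
      then show ?thesis
        unfolding Hx ball_to_siegel_nth v using ED by (simp add: CS)
    qed
    show "H x $ Some (Inr (Inl j)) = (if j = k then (\<epsilon> x)\<^sup>2 * ((\<omega> x - a) / (q x * E x * D x))
       else - (\<epsilon> x * x $ Some j * (1 / (E x * D x))))"
      unfolding Hx ball_to_siegel_nth v unfolding F_map_nth CN CS q_def[symmetric]
      using ED by (simp add: \<omega>_def[of x] power2_eq_square mult_ac)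
    show "H x $ Some (Inr (Inr j)) =
       (\<epsilon> x)\<^sup>2 * (s * (x $ Some j + (if j = k then 1 else 0)) / (q x * (E x)\<^sup>2 * D x))"
      unfolding Hx ball_to_siegel_nth v unfolding F_map_nth CN CS q_def[symmetric] s_def[symmetric]
      using ED by (simp add: \<omega>_def[of x] power2_eq_square mult_ac)
    show "1 / D x = 1 + w x * \<epsilon> x * ((\<i> / 2) / (E x * D x))"
      using DE ED by (simp add: field_simps)
  qed
  have Oz: "O_wt 1 z" unfolding z_def[abs_def] by (rule O_wt_horizontal)
  have Ow: "O_wt 2 w" unfolding w_def[abs_def] by (rule O_wt_vertical)
  have O\<epsilon>: "O_wt 1 \<epsilon>"
    using O_wt_add[OF Oz O_wt_const_mult[of 1 w "- \<i> / 2"]] O_wt_Suc_imp_O_wt[of 1 w] Ow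
    by (simp add: \<epsilon>_def[abs_def] numeral_2_eq_2)
  have \<kappa>: "((\<lambda>x. (\<i> / 2) / (E x * D x)) \<longlongrightarrow> \<i> / 2) (at 0)"
    by (auto intro!: tendsto_eq_intros E0 D0)
  have \<kappa>1: "((\<lambda>x. 1 / (E x * D x) - 1) \<longlongrightarrow> 0) (at 0)"
    by (auto intro!: tendsto_eq_intros E0 D0)
  \<comment> \<open>Effect of dividing a term of order m by D: the change has order m + 3, hence is
    little-o of order m + 2.\<close>
  have small: "o_wt (at 0) (m + 2) (\<lambda>x. f x * (w x * \<epsilon> x * ((\<i> / 2) / (E x * D x))))"
    if "O_wt m f" for m f
  proof (rule O_wt_Suc_imp_o_wt)
    have "Suc (m + 2) = m + (2 + 1)" by simp
    then show "O_wt (Suc (m + 2)) (\<lambda>x. f x * (w x * \<epsilon> x * ((\<i> / 2) / (E x * D x))))"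
      using O_wt_mult[OF that O_wt_mult_bounded[OF O_wt_mult[OF Ow O\<epsilon>] \<kappa>]] by (simp only:)
  qed
  \<comment> \<open>Replaces \<epsilon>^2 by z_k^2: the difference is (\<epsilon> - z)(\<epsilon> +
    z) = -(\<i> / 2) w (\<epsilon> + z), of weighted order 3.\<close>
  have quad: "o_wt (at 0) 2 (\<lambda>x. (\<epsilon> x)\<^sup>2 * \<kappa>' x - c * (z x)\<^sup>2)" if "(\<kappa>' \<longlongrightarrow> c) (at 0)" for \<kappa>' c
  proof -
    have "((\<lambda>x. \<kappa>' x - c) \<longlongrightarrow> 0) (at 0)" using that by (simp add: LIM_zero)
    then have "o_wt (at 0) 2 (\<lambda>x. \<epsilon> x * \<epsilon> x * (\<kappa>' x - c))"
      using o_wt_mult_vanishing[OF O_wt_mult[OF O\<epsilon> O\<epsilon>]] by (simp add: numeral_2_eq_2)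
    moreover have "O_wt (Suc 2) (\<lambda>x. w x * (\<epsilon> x + z x))"
      using O_wt_mult[OF Ow O_wt_add[OF O\<epsilon> Oz]] by simp
    then have "O_wt (Suc 2) (\<lambda>x. (- c * \<i> / 2) * (w x * (\<epsilon> x + z x)))"
      by (rule O_wt_const_mult)
    then have "o_wt (at 0) 2 (\<lambda>x. (- c * \<i> / 2) * (w x * (\<epsilon> x + z x)))"
      by (rule O_wt_Suc_imp_o_wt)
    ultimately have "o_wt (at 0) 2 (\<lambda>x. \<epsilon> x * \<epsilon> x * (\<kappa>' x - c) + (- c * \<i> / 2) * (w x * (\<epsilon> x + z x)))"
      by (rule o_wt_add)
    moreover have "\<epsilon> x * \<epsilon> x * (\<kappa>' x - c) + (- c * \<i> / 2) * (w x * (\<epsilon> x + z x)) = (\<epsilon> x)\<^sup>2 * \<kappa>' x - c * (z x)\<^sup>2" for x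
    proof -
      have "(- c * \<i> / 2) * (w x * (\<epsilon> x + z x)) = c * ((\<epsilon> x - z x) * (\<epsilon> x + z x))"
        by (simp add: \<epsilon>_def)
      then show ?thesis by (simp add: algebra_simps power2_eq_square)
    qed
    ultimately show ?thesis by simp
  qed
  have g: "o_wt (at 0) 4 (\<lambda>x. H x $ None - x $ None)"
  proof (rule o_wt_cong)
    show "o_wt (at 0) 4 (\<lambda>x. w x * (w x * \<epsilon> x * ((\<i> / 2) / (E x * D x))))"
      using small[OF Ow] by simp
    show "\<forall>\<^sub>F x in at 0. w x * (w x * \<epsilon> x * ((\<i> / 2) / (E x * D x))) = H x $ None - x $ None"
      using ev
    proof eventually_elim
      case (elim x)
      show ?case unfolding comp(1)[OF elim] comp(5)[OF elim] by (simp add: w_def algebra_simps)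
    qed
  qed
  have f: "o_wt (at 0) 3 (\<lambda>x. H x $ Some (Inl j) -
      (x $ Some j + (\<i> / 2 * x $ None) * (if j = k then z x else 0)))" for j
  proof (cases "j = k")
    case True
    \<comment> \<open>The summand (\<i> / 2) w \<epsilon> / (E D) of f_k produces the term (\<i> /
      2) w z_k that makes the matrix nonzero; substituting \<epsilon> = z - (\<i> / 2) w leaves w^2
      / 4, which has order 4.\<close>
    have "o_wt (at 0) 3 (\<lambda>x. w x * \<epsilon> x * (1 / (E x * D x) - 1))"
      using o_wt_mult_vanishing[OF O_wt_mult[OF Ow O\<epsilon>] \<kappa>1] by simp
    then have 1: "o_wt (at 0) 3 (\<lambda>x. \<i> / 2 * (w x * \<epsilon> x * (1 / (E x * D x) - 1)))"
      unfolding o_wt_alt by (simp add: norm_mult)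
    have "O_wt (Suc 3) (\<lambda>x. w x * w x)"
      using O_wt_mult[OF Ow Ow] by simp
    then have "O_wt (Suc 3) (\<lambda>x. 1 / 4 * (w x * w x))" by (rule O_wt_const_mult)
    then have 2: "o_wt (at 0) 3 (\<lambda>x. 1 / 4 * (w x * w x))" by (rule O_wt_Suc_imp_o_wt)
    have 3: "o_wt (at 0) 3 (\<lambda>x. z x * (w x * \<epsilon> x * ((\<i> / 2) / (E x * D x))))"
      using small[OF Oz] by (simp add: numeral_3_eq_3)
    show ?thesis
    proof (rule o_wt_cong[OF o_wt_add[OF o_wt_add[OF 3 1] 2]])
      show "\<forall>\<^sub>F x in at 0. z x * (w x * \<epsilon> x * ((\<i> / 2) / (E x * D x)))
          + \<i> / 2 * (w x * \<epsilon> x * (1 / (E x * D x) - 1)) + 1 / 4 * (w x * w x)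
          = H x $ Some (Inl j) - (x $ Some j + (\<i> / 2 * x $ None) * (if j = k then z x else 0))"
        using ev
      proof eventually_elim
        case (elim x)
        define K where "K = 1 / (E x * D x)"
        have K: "(\<i> / 2) / (E x * D x) = \<i> / 2 * K" by (simp add: K_def)
        have "\<i> * (y * (\<i> * y)) = (\<i> * \<i>) * (y * y)" for y
          by (simp only: mult_ac)
        then have w2: "1 / 4 * (w x * w x) = \<i> / 2 * (w x * (\<epsilon> x - z x))"
          by (simp add: \<epsilon>_def)
        show ?case
          unfolding comp(2)[OF elim] comp(5)[OF elim] w2 K unfolding K_def[symmetric]
          using True by (simp add: w_def[symmetric] z_def[symmetric] algebra_simps)
      qed
    qed
  next
    case False
    have 1: "o_wt (at 0) 3 (\<lambda>x. x $ Some j * (w x * \<epsilon> x * ((\<i> / 2) / (E x * D x))))"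
      using small[OF O_wt_horizontal[of j]] by (simp add: numeral_3_eq_3)
    show ?thesis
    proof (rule o_wt_cong[OF 1])
      show "\<forall>\<^sub>F x in at 0. x $ Some j * (w x * \<epsilon> x * ((\<i> / 2) / (E x * D x)))
          = H x $ Some (Inl j) - (x $ Some j + (\<i> / 2 * x $ None) * (if j = k then z x else 0))"
        using ev
      proof eventually_elim
        case (elim x)
        show ?case
          unfolding comp(2)[OF elim] comp(5)[OF elim] using False by (simp add: algebra_simps)
      qed
    qed
  qed
  have \<phi>1: "o_wt (at 0) 2 (\<lambda>x. H x $ Some (Inr (Inl j)) - normal_quadratic a k (horiz x) $ Inl j)" for j
  proof (cases "j = k")
    case True
    have "((\<lambda>x. (\<omega> x - a) / (q x * E x * D x)) \<longlongrightarrow> - a) (at 0)"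
      by (auto intro!: tendsto_eq_intros E0 D0 \<omega>0 q0)
    from quad[OF this] show ?thesis
    proof (rule o_wt_cong)
      show "\<forall>\<^sub>F x in at 0. (\<epsilon> x)\<^sup>2 * ((\<omega> x - a) / (q x * E x * D x)) - - a * (z x)\<^sup>2
          = H x $ Some (Inr (Inl j)) - normal_quadratic a k (horiz x) $ Inl j"
        using ev
      proof eventually_elim
        case (elim x)
        show ?case
          unfolding comp(3)[OF elim] using True
          by (simp add: normal_quadratic_def z_def power2_eq_square)
      qed
    qed
  next
    case False
    have "o_wt (at 0) 2 (\<lambda>x. \<epsilon> x * x $ Some j * (1 / (E x * D x) - 1))"
      using o_wt_mult_vanishing[OF O_wt_mult[OF O\<epsilon> O_wt_horizontal] \<kappa>1] by (simp add: numeral_2_eq_2)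
    then have 1: "o_wt (at 0) 2 (\<lambda>x. - (\<epsilon> x * x $ Some j * (1 / (E x * D x) - 1)))"
      unfolding o_wt_alt by (simp only: norm_minus_cancel)
    have "O_wt (Suc 2) (\<lambda>x. w x * x $ Some j)"
      using O_wt_mult[OF Ow O_wt_horizontal] by simp
    then have "O_wt (Suc 2) (\<lambda>x. \<i> / 2 * (w x * x $ Some j))" by (rule O_wt_const_mult)
    then have 2: "o_wt (at 0) 2 (\<lambda>x. \<i> / 2 * (w x * x $ Some j))" by (rule O_wt_Suc_imp_o_wt)
    show ?thesis
    proof (rule o_wt_cong[OF o_wt_add[OF 1 2]])
      show "\<forall>\<^sub>F x in at 0. - (\<epsilon> x * x $ Some j * (1 / (E x * D x) - 1)) + \<i> / 2 * (w x * x $ Some j)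
          = H x $ Some (Inr (Inl j)) - normal_quadratic a k (horiz x) $ Inl j"
        using ev
      proof eventually_elim
        case (elim x)
        have "\<i> / 2 * (w x * x $ Some j) = (z x - \<epsilon> x) * x $ Some j" by (simp add: \<epsilon>_def)
        then show ?case
          unfolding comp(3)[OF elim] using False
          by (simp add: normal_quadratic_def z_def[symmetric] algebra_simps)
      qed
    qed
  qed
  have \<phi>2: "o_wt (at 0) 2 (\<lambda>x. H x $ Some (Inr (Inr j)) - normal_quadratic a k (horiz x) $ Inr j)" for j
  proof -
    have "((\<lambda>x. s * (x $ Some j + (if j = k then 1 else 0)) / (q x * (E x)\<^sup>2 * D x))
        \<longlongrightarrow> s * (if j = k then 1 else 0)) (at 0)"
      by (auto intro!: tendsto_eq_intros E0 D0 q0)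
    from quad[OF this] show ?thesis
    proof (rule o_wt_cong)
      show "\<forall>\<^sub>F x in at 0. (\<epsilon> x)\<^sup>2 * (s * (x $ Some j + (if j = k then 1 else 0)) / (q x * (E x)\<^sup>2 * D x))
          - s * (if j = k then 1 else 0) * (z x)\<^sup>2
          = H x $ Some (Inr (Inr j)) - normal_quadratic a k (horiz x) $ Inr j"
        using ev
      proof eventually_elim
        case (elim x)
        show ?case
          unfolding comp(4)[OF elim]
          by (simp add: normal_quadratic_def s_def z_def power2_eq_square)
      qed
    qed
  qed
  show ?thesis
    unfolding normal_form_def
  proof (intro conjI allI)
    show "homogeneous_quadratic (normal_quadratic a k)"
      by (rule homogeneous_quadratic_normal_quadratic)
    show "o_wt (at 0 within S) 3 (\<lambda>x. (\<chi> j. H x $ Some (Inl j))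
        - (horiz x + (\<i> / 2 * x $ None) *s (horiz x v* normal_matrix k)))"
    proof (rule o_wt_within, rule o_wt_vec)
      fix j
      have "axis k (x $ Some k) $ j = (if j = k then z x else 0)" for x
        by (simp add: axis_def z_def)
      then show "o_wt (at 0) 3 (\<lambda>x. ((\<chi> j. H x $ Some (Inl j))
          - (horiz x + (\<i> / 2 * x $ None) *s (horiz x v* normal_matrix k))) $ j)"
        using f[of j] unfolding vector_normal_matrix by simp
    qed
    show "o_wt (at 0 within S) 2 (\<lambda>x. (\<chi> l. H x $ Some (Inr l)) - normal_quadratic a k (horiz x))"
    proof (rule o_wt_within, rule o_wt_vec)
      fix l
      show "o_wt (at 0) 2 (\<lambda>x. ((\<chi> l. H x $ Some (Inr l)) - normal_quadratic a k (horiz x)) $ l)"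
        using \<phi>1 \<phi>2 by (cases l) simp_all
    qed
    show "o_wt (at 0 within S) 4 (\<lambda>x. H x $ None - x $ None)"
      by (rule o_wt_within[OF g])
    fix y :: "complex^'m"
    have "(\<Sum>j\<in>UNIV. cnj (y $ j) * (y v* normal_matrix k) $ j) = cnj (y $ k) * y $ k"
      by (simp add: vector_normal_matrix axis_def if_distrib[of "\<lambda>c. _ * c"] cong: if_cong)
    also have "\<dots> = of_real ((norm (y $ k))\<^sup>2)"
      by (simp add: complex_norm_square mult.commute del: of_real_power)
    finally show "(\<Sum>j\<in>UNIV. cnj (y $ j) * (y v* normal_matrix k) $ j) * of_real ((norm y)\<^sup>2)
        = of_real ((norm (normal_quadratic a k y))\<^sup>2)"
      unfolding norm_normal_quadratic[OF a] of_real_mult by simp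
  qed
qed

section \<open>Rank one is attained, and the final statement\<close>

lemma rank_at_F_map_base_point:
  fixes a :: complex and k :: "'m::finite"
  defines "M \<equiv> {p \<in> frontier siegel. F_map a (cayley p) $ None \<noteq> - 1}"
    and "G \<equiv> cayley_inv \<circ> F_map a \<circ> (cayley :: complex^('m option) \<Rightarrow> _)"
  assumes a: "norm a < 1"
  shows "base_point k \<in> M" and "rank_at M G (base_point k) 1"
proof -
  let ?p = "base_point k"
  define y0 where "y0 = F_map a (cayley ?p)"
  have cp: "cayley ?p $ None = 0" "cayley ?p $ Some j = (if j = k then 1 else 0)" for j
    using cayley_heisenberg_base_point[of k 0] by simp_all
  have y0: "y0 $ None = 0" "y0 $ Some (Inl j) = (if j = k then 1 else 0)"
    "y0 $ Some (Inr l) = 0" for j l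
    unfolding y0_def by (simp_all add: cp) (cases l; simp add: cp)
  show pM: "?p \<in> M"
    unfolding M_def frontier_siegel mem_Collect_eq y0_def[symmetric] by (simp add: y0 horiz_base_point norm_axis_1)
  define \<tau> where "\<tau> y = ball_to_siegel k (cayley y)" for y
  \<comment> \<open>The open set where neither the Cayley denominator nor, after clearing it, the
    denominator 1 + v vanishes; \<tau> is holomorphic there and it contains the boundary point
    \<open>G ?p\<close>.\<close>
  define U where "U = {y :: complex^(('m + ('m + 'm)) option).
    1 - \<i> * y $ None \<noteq> 0 \<and> 1 - \<i> * y $ None + 2 * y $ Some (Inr (Inl k)) \<noteq> 0}"
  have U2: "1 + cayley y $ Some (Inr (Inl k)) \<noteq> 0" if "y \<in> U" for y
  proof -
    have nz: "1 - \<i> * y $ None \<noteq> 0" "1 - \<i> * y $ None + 2 * y $ Some (Inr (Inl k)) \<noteq> 0"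
      using that by (auto simp: U_def)
    have "1 + cayley y $ Some (Inr (Inl k)) =
        (1 - \<i> * y $ None + 2 * y $ Some (Inr (Inl k))) / (1 - \<i> * y $ None)"
      using nz(1) by (simp add: add_divide_distrib)
    then show ?thesis using nz by simp
  qed
  have b\<tau>: "biholomorphism siegel siegel \<tau> (\<lambda>y. cayley_inv (siegel_to_ball k y))"
    unfolding \<tau>_def using biholomorphism_compose[OF biholomorphism_cayley biholomorphism_ball_to_siegel] .
  have aut: "holomorphic_automorphism siegel \<tau>"
    by (rule biholomorphism_imp_holomorphic_automorphism[OF open_siegel b\<tau>])
  have "open U"
    unfolding U_def by (intro open_Collect_conj open_Collect_neq continuous_intros)
  have Gp: "G ?p = cayley_inv y0" by (simp add: G_def y0_def)
  have "siegel \<subseteq> U"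
  proof
    fix y :: "complex^(('m + ('m + 'm)) option)" assume y: "y \<in> siegel"
    then have "cayley y \<in> ball 0 1" using biholomorphism_cayley unfolding biholomorphism_def by blast
    from one_plus_nth_nonzero[OF this, of "Some (Inr (Inl k))"]
    have v: "1 + cayley y $ Some (Inr (Inl k)) \<noteq> 0" .
    have nz: "1 - \<i> * y $ None \<noteq> 0" using y siegel_Re_pos[of y] by (simp add: siegel_def)
    have "1 - \<i> * y $ None + 2 * y $ Some (Inr (Inl k)) =
        (1 + cayley y $ Some (Inr (Inl k))) * (1 - \<i> * y $ None)"
      using nz by (simp add: distrib_right)
    then show "y \<in> U" using v nz by (simp add: U_def)
  qed
  moreover have "G ?p \<in> U" unfolding Gp U_def by (simp add: y0)
  ultimately have sub: "siegel \<union> {G ?p} \<subseteq> U" by simp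
  have hol: "holomorphic_map_on \<tau> U"
    unfolding \<tau>_def
  proof (rule holomorphic_map_on_compose[OF _ holomorphic_map_on_ball_to_siegel])
    show "holomorphic_map_on cayley U"
      using holomorphic_map_on_cayley unfolding holomorphic_map_on_def U_def by blast
  qed (use U2 in auto)
  have "ball_to_siegel k y0 $ i = 0" for i
    by (cases i rule: index_cases) (simp_all add: y0)
  then have "ball_to_siegel k y0 = 0" by (simp add: vec_eq_iff)
  moreover have "cayley (cayley_inv y0) = y0"
    by (rule cayley_cayley_inv) (simp add: y0)
  ultimately have \<tau>0: "\<tau> (G ?p) = 0" by (simp add: \<tau>_def Gp)
  have "\<forall>\<^sub>F x in at 0. (\<tau> \<circ> G \<circ> heisenberg_translation ?p) x =
      ball_to_siegel k (F_map a (cayley (heisenberg_translation ?p x)))"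
  proof -
    have "isCont cayley ?p"
      using holomorphic_map_on_imp_isCont[OF holomorphic_map_on_cayley, of ?p] by simp
    moreover have "norm (cayley ?p) \<le> 1"
      using cayley_norm_eq(2)[of ?p] by (simp add: horiz_base_point norm_axis_1)
    then have "isCont (F_map a) (cayley ?p)" by (rule isCont_F_map[OF a])
    moreover have "(heisenberg_translation ?p \<longlongrightarrow> ?p) (at 0)"
      using isCont_heisenberg[where p = ?p and x = 0] unfolding isCont_def by simp
    ultimately have "((\<lambda>x. F_map a (cayley (heisenberg_translation ?p x))) \<longlongrightarrow> y0) (at 0)"
      unfolding y0_def
      by (intro isCont_tendsto_compose[where g = "F_map a"] isCont_tendsto_compose[where g = cayley])
    \<comment> \<open>The limit of the last coordinate is 0, so near the base point it avoids -1 and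
      the inner Cayley transformations cancel.\<close>
    then have "((\<lambda>x. F_map a (cayley (heisenberg_translation ?p x)) $ None) \<longlongrightarrow> y0 $ None) (at 0)"
      by (rule tendsto_vec_nth)
    then have "\<forall>\<^sub>F x in at 0. F_map a (cayley (heisenberg_translation ?p x)) $ None \<noteq> - 1"
      by (rule tendsto_imp_eventually_ne) (simp add: y0)
    then show ?thesis
    proof eventually_elim
      case (elim x)
      show ?case unfolding comp_def \<tau>_def G_def cayley_cayley_inv[OF elim] ..
    qed
  qed
  from normal_form_F_map[OF a this, of "heisenberg_translation ?p -` M"]
  show "rank_at M G ?p 1"
    unfolding rank_at_def
    using aut \<open>open U\<close> sub hol \<tau>0 rank_normal_matrix by blast
qed

lemma geometric_rank_F_map:
  assumes a: "norm a < 1"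
  shows "geometric_rank (F_map a :: complex^('m::finite option) \<Rightarrow> _) = 1"
proof -
  let ?M = "{p \<in> frontier siegel. (F_map a :: complex^('m option) \<Rightarrow> _) (cayley p) $ None \<noteq> - 1}"
  let ?R = "{r. \<exists>p\<in>?M. rank_at ?M (cayley_inv \<circ> F_map a \<circ> cayley) p r}"
  have "?R \<subseteq> {0..1}"
  proof
    fix r assume "r \<in> ?R"
    then obtain p where "p \<in> ?M" "rank_at ?M (cayley_inv \<circ> F_map a \<circ> cayley) p r" by blast
    then have "r \<le> 1" by (rule rank_at_F_map_le_1[OF a])
    then show "r \<in> {0..1}" by simp
  qed
  moreover have "1 \<in> ?R"
    \<comment> \<open>Any index k serves; \<open>undefined\<close> names one in the nonempty index
      type.\<close>
    using rank_at_F_map_base_point[OF a, of undefined] by blast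
  ultimately have "Max ?R = 1"
    by (intro Max_eqI) (auto intro: finite_subset)
  then show ?thesis
    unfolding geometric_rank_def siegel_geometric_rank_def .
qed

lemma holomorphic_automorphism_ball_id:
  "holomorphic_automorphism (ball 0 1) (\<lambda>x. x :: complex^'n::finite)"
proof -
  have "biholomorphism (ball 0 1) (ball 0 1) (\<lambda>x. x) (\<lambda>x. x :: complex^'n)"
    unfolding biholomorphism_def by (auto intro!: holomorphic_map_onI complex_diff_intros)
  then show ?thesis
    using biholomorphism_imp_holomorphic_automorphism by blast
qed

theorem mainTheorem3:
  fixes a :: complex
    and F :: "complex^('m::finite option) \<Rightarrow> complex^(('m + ('m + 'm)) option)"
  assumes "norm a < 1"
    and "F = F_map a"
  shows "proper_holomorphic_ball_map F \<and> rational_map_on F (ball 0 1) \<and>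
    geometric_rank F = 1 \<and>
    (\<forall>w. \<exists>(A :: complex^'m^(('m + ('m + 'm)) option)) b.
       \<forall>x\<in>ball 0 1. x $ None = w \<longrightarrow> F x = A *v horiz x + b) \<and>
    ((\<exists>P :: complex^('m option) \<Rightarrow> complex^(('m + ('m + 'm)) option).
        polynomial_map P \<and> proper_holomorphic_ball_map P \<and> ball_equivalent F P) \<longleftrightarrow> a = 0)"
proof (intro conjI iffI)
  note a = assms(1)
  show "proper_holomorphic_ball_map F"
    unfolding assms(2) by (rule proper_holomorphic_ball_map_F_map[OF a])
  show "rational_map_on F (ball 0 1)"
    unfolding assms(2) by (rule rational_map_on_F_map[OF a])
  show "geometric_rank F = 1"
    unfolding assms(2) by (rule geometric_rank_F_map[OF a])
  show "\<forall>w. \<exists>(A :: complex^'m^(('m + ('m + 'm)) option)) b.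
       \<forall>x\<in>ball 0 1. x $ None = w \<longrightarrow> F x = A *v horiz x + b"
    unfolding assms(2) using F_map_affine by blast
  show "a = 0" if "\<exists>P :: complex^('m option) \<Rightarrow> complex^(('m + ('m + 'm)) option).
        polynomial_map P \<and> proper_holomorphic_ball_map P \<and> ball_equivalent F P"
    using that ball_equivalent_polynomial_imp_zero[OF a] unfolding assms(2) by blast
  show "\<exists>P :: complex^('m option) \<Rightarrow> complex^(('m + ('m + 'm)) option).
        polynomial_map P \<and> proper_holomorphic_ball_map P \<and> ball_equivalent F P" if "a = 0"
  proof -
    \<comment> \<open>For a = 0 the map is itself polynomial, so P = F with identity
      automorphisms.\<close>
    have "ball_equivalent (F_map a) (F_map a :: complex^('m option) \<Rightarrow> _)"
      unfolding ball_equivalent_def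
      by (intro exI[of _ "\<lambda>x. x"] conjI holomorphic_automorphism_ball_id) simp
    then show ?thesis
      unfolding assms(2) using polynomial_map_F_map_0 proper_holomorphic_ball_map_F_map[OF a] that by blast
  qed
qed

end
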